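(* In the setting described in the context, after possibly decreasing $\epsilon$, for $z\in\mathbb{C}$, $u\in\mathbb{R}$ and $t\in\,]-\epsilon,\epsilon[$ set $$d(z,u,t)=\det(I-z\mathcal{L}_{u,t}).$$ Then the map $d$ so defined is analytic on $\mathbb{C}\times\mathbb{R}\times\,]-\epsilon,\epsilon[$: it is the restriction of a holomorphic map.
   Context: Notation. $S^1=\mathbb{R}/\mathbb{Z}\subset\mathbb{C}/\mathbb{Z}$; $\pi:\mathbb{C}\to\mathbb{C}/\mathbb{Z}$ is the canonical projection; $\mathcal{C}_\rho=\{z\in\mathbb{C}/\mathbb{Z}:|\Im z|<\rho\}$; $\mathbb{D}(0,\epsilon)$ is the open disc of centre $0$ and radius $\epsilon$ in $\mathbb{C}$. For an open set $W$ of $\mathbb{C}$ or $\mathbb{C}/\mathbb{Z}$, $\mathcal{A}(W)$ is the Banach space of bounded continuous functions $\overline{W}\to\mathbb{C}$ holomorphic on $W$, with the sup norm. Setting. Let $\epsilon>0$ (which may be decreased finitely many times) and let $t\in\,]-\epsilon,\epsilon[\,\mapsto f_t$ be a curve of analytic maps $S^1\to S^1$ such that $(t,x)\mapsto f_t(x)$ is analytic and such that there is $\lambda>1$ with $f_t'(x)\geqslant\lambda$ for all $t\in\,]-\epsilon,\epsilon[$, $x\in S^1$. After decreasing $\epsilon$, $(t,x)\mapsto f_t(x)$ extends holomorphically to $\mathbb{D}(0,\epsilon)\times U$, with $U$ a neighbourhood of $S^1$ in $\mathbb{C}/\mathbb{Z}$ and $f_t'(x)\neq0$ there; $F_t:\pi^{-1}(U)\to\mathbb{C}$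 denotes the lift of $f_t$, depending holomorphically on $t$. Let $D$ be the common degree of the $f_t$, $t$ real. Let $g:S^1\to\mathbb{R}$ be analytic, extended holomorphically to a neighbourhood of $S^1$. Let $r>0$ with $\mathcal{C}_r\subseteq U$, let $M$ be the supremum of $|F_t(x)|$ over $t\in\mathbb{D}(0,\epsilon)$, $\Re x\in[-\frac r2,1+\frac r2]$, $\Im x\in[-\frac r2,\frac r2[$ (finite after decreasing $\epsilon$), and let $0<r_0<\min\left(\frac r4,\frac{r^2(\lambda-1)}{8M}\right)$. Let $0<R<r_0$ be such that $g$ is defined on a neighbourhood of $\overline{\mathcal{C}_R}$. After decreasing $\epsilon$, for every $t\in\mathbb{D}(0,\epsilon)$ every point of $\mathcal{C}_{r_0}$ has exactly $D$ preimages under $f_t$ in $\mathcal{C}_{r_0}$, and there is $R'<R$ such that for all $t\in\mathbb{D}(0,\epsilon)$ and $x\in\overline{\mathcal{C}_R}$ these $D$ preimages lie in $\mathcal{C}_{R'}$. Transfer operator. For $t\in\mathbb{D}(0,\epsilon)$, $u\in\mathbb{C}$, $\varphi\in\mathcal{A}(\mathcal{C}_R)$, $z\in\overline{\mathcal{C}_R}$, $$\mathcal{L}_{u,t}\varphi(z)=\sum_{x\in\mathcal{C}_R:\,f_t(x)=z}\frac{e^{-ug(x)}}{f_t'(x)}\varphi(x).$$ This is a $\frac23$-summable operator of $\mathcal{A}(\mathcal{C}_R)$ into itself in the sense of Grothendieck (it is represented by $\sum_i\lambda_i l_i\otimes e_i$ with $(l_i)$, $(e_i)$ bounded and $\sum|\lambda_i|^{2/3}<\infty$),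 so its trace and Fredholm determinant $\det(I-z\mathcal{L}_{u,t})$ are well defined. *)

theory Defs
  imports "HOL-Complex_Analysis.Complex_Analysis"
begin

(* Points of C/Z are represented by complex numbers, subsets of C/Z by their 1-periodic
   preimages in C, functions on C/Z by 1-periodic functions, and maps between subsets of
   C/Z by their lifts to C. *)

section \<open>Analyticity in several variables\<close>

definition real_analytic_on :: "(real \<Rightarrow> real) \<Rightarrow> real set \<Rightarrow> bool" where
  "real_analytic_on g S \<longleftrightarrow>
     (\<forall>x0\<in>S. \<exists>(a :: nat \<Rightarrow> real) \<rho>. 0 < \<rho> \<and>
        (\<forall>x. \<bar>x - x0\<bar> < \<rho> \<longrightarrow> ((\<lambda>n. a n * (x - x0) ^ n) has_sum g x) UNIV))"

definition real_analytic2_on :: "(real \<times> real \<Rightarrow> real) \<Rightarrow> (real \<times> real) set \<Rightarrow> bool" where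
  "real_analytic2_on f S \<longleftrightarrow>
     (\<forall>(t0, x0)\<in>S. \<exists>(a :: nat \<Rightarrow> nat \<Rightarrow> real) \<rho>. 0 < \<rho> \<and>
        (\<forall>t x. \<bar>t - t0\<bar> < \<rho> \<and> \<bar>x - x0\<bar> < \<rho> \<longrightarrow>
           ((\<lambda>(m, n). a m n * (t - t0) ^ m * (x - x0) ^ n) has_sum f (t, x)) UNIV))"

(* Holomorphy means that the Frechet derivative exists and is complex linear; both
   predicates are meant for open sets. *)
definition holomorphic2_on :: "(complex \<times> complex \<Rightarrow> complex) \<Rightarrow> (complex \<times> complex) set \<Rightarrow> bool" where
  "holomorphic2_on h W \<longleftrightarrow>
     (\<forall>p\<in>W. \<exists>a b. (h has_derivative (\<lambda>(x, y). a * x + b * y)) (at p))"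

definition holomorphic3_on ::
  "(complex \<times> complex \<times> complex \<Rightarrow> complex) \<Rightarrow> (complex \<times> complex \<times> complex) set \<Rightarrow> bool" where
  "holomorphic3_on h W \<longleftrightarrow>
     (\<forall>p\<in>W. \<exists>a b c. (h has_derivative (\<lambda>(x, y, w). a * x + b * y + c * w)) (at p))"


section \<open>Annuli in C/Z and their spaces of holomorphic functions\<close>

definition periodic_set :: "complex set \<Rightarrow> bool" where
  "periodic_set U \<longleftrightarrow> (\<forall>z. z + 1 \<in> U \<longleftrightarrow> z \<in> U)"

definition annulus :: "real \<Rightarrow> complex set" where
  "annulus \<rho> = {z. \<bar>Im z\<bar> < \<rho>}"

definition closed_annulus :: "real \<Rightarrow> complex set" where
  "closed_annulus \<rho> = {z. \<bar>Im z\<bar> \<le> \<rho>}"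

(* A function on the closed annulus is extended by 0, so that equality of functions is
   equality on the closed annulus. *)
definition hol_space :: "real \<Rightarrow> (complex \<Rightarrow> complex) set" where
  "hol_space \<rho> =
     {\<phi>. (\<forall>z. \<phi> (z + 1) = \<phi> z) \<and>
         continuous_on (closed_annulus \<rho>) \<phi> \<and>
         \<phi> holomorphic_on annulus \<rho> \<and>
         bounded (\<phi> ` closed_annulus \<rho>) \<and>
         (\<forall>z. z \<notin> closed_annulus \<rho> \<longrightarrow> \<phi> z = 0)}"

definition hol_norm :: "real \<Rightarrow> (complex \<Rightarrow> complex) \<Rightarrow> real" where
  "hol_norm \<rho> \<phi> = (SUP z\<in>closed_annulus \<rho>. norm (\<phi> z))"


section \<open>Fredholm determinants of 2/3-summable operators\<close>

(* Here V is a complex vector space of functions, with pointwise operations, and N a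
   complete norm on it. *)

definition bounded_functional ::
  "('a \<Rightarrow> complex) set \<Rightarrow> (('a \<Rightarrow> complex) \<Rightarrow> real) \<Rightarrow> real \<Rightarrow> (('a \<Rightarrow> complex) \<Rightarrow> complex) \<Rightarrow> bool" where
  "bounded_functional V N C l \<longleftrightarrow>
     (\<forall>\<phi>\<in>V. \<forall>\<psi>\<in>V. l (\<lambda>x. \<phi> x + \<psi> x) = l \<phi> + l \<psi>) \<and>
     (\<forall>c. \<forall>\<phi>\<in>V. l (\<lambda>x. c * \<phi> x) = c * l \<phi>) \<and>
     (\<forall>\<phi>\<in>V. norm (l \<phi>) \<le> C * N \<phi>)"

definition summable_rep ::
  "real \<Rightarrow> ('a \<Rightarrow> complex) set \<Rightarrow> (('a \<Rightarrow> complex) \<Rightarrow> real) \<Rightarrow> (('a \<Rightarrow> complex) \<Rightarrow> ('a \<Rightarrow> complex)) \<Rightarrow>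
   (nat \<Rightarrow> complex) \<Rightarrow> (nat \<Rightarrow> ('a \<Rightarrow> complex) \<Rightarrow> complex) \<Rightarrow> (nat \<Rightarrow> 'a \<Rightarrow> complex) \<Rightarrow> bool" where
  "summable_rep p V N T lam l e \<longleftrightarrow>
     (\<exists>C. \<forall>i. bounded_functional V N C (l i) \<and> e i \<in> V \<and> N (e i) \<le> C) \<and>
     summable (\<lambda>i. norm (lam i) powr p) \<and>
     (\<forall>\<phi>\<in>V. T \<phi> \<in> V \<and>
        (\<lambda>n. N (\<lambda>x. T \<phi> x - (\<Sum>i<n. lam i * l i \<phi> * e i x))) \<longlonglongrightarrow> 0)"

(* The trace of the n-th exterior power of the sum of the lam i * (l i \<otimes> e i). *)
definition fredholm_coeff ::
  "(nat \<Rightarrow> complex) \<Rightarrow> (nat \<Rightarrow> ('a \<Rightarrow> complex) \<Rightarrow> complex) \<Rightarrow> (nat \<Rightarrow> 'a \<Rightarrow> complex) \<Rightarrow> nat \<Rightarrow> complex" where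
  "fredholm_coeff lam l e n =
     (1 / fact n) * (\<Sum>\<^sub>\<infinity>i\<in>({..<n} \<rightarrow>\<^sub>E UNIV).
        (\<Prod>a<n. lam (i a)) *
        (\<Sum>\<sigma> | \<sigma> permutes {..<n}. of_int (sign \<sigma>) * (\<Prod>a<n. l (i a) (e (i (\<sigma> a))))))"

(* det (I - z T) as the sum of the (-z)^n tr (\<Lambda>^n T). By Grothendieck's theorem its
   value does not depend on the 2/3-summable representation of T. *)
definition fredholm_det ::
  "('a \<Rightarrow> complex) set \<Rightarrow> (('a \<Rightarrow> complex) \<Rightarrow> real) \<Rightarrow> (('a \<Rightarrow> complex) \<Rightarrow> ('a \<Rightarrow> complex)) \<Rightarrow>
   complex \<Rightarrow> complex" where
  "fredholm_det V N T z =
     (THE d. \<exists>lam l e. summable_rep (2/3) V N T lam l e \<and>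
                       d = (\<Sum>n. (- z) ^ n * fredholm_coeff lam l e n))"


section \<open>The transfer operator\<close>

(* One representative in C of each point x of the annulus in C/Z such that the map with
   lift F sends x to the class of z. *)
definition preimages :: "(complex \<Rightarrow> complex) \<Rightarrow> real \<Rightarrow> complex \<Rightarrow> complex set" where
  "preimages F \<rho> z = {x \<in> annulus \<rho>. 0 \<le> Re x \<and> Re x < 1 \<and> F x - z \<in> \<int>}"

definition transfer_op ::
  "(complex \<Rightarrow> complex \<Rightarrow> complex) \<Rightarrow> (complex \<Rightarrow> complex) \<Rightarrow> real \<Rightarrow> complex \<Rightarrow> complex \<Rightarrow>
   (complex \<Rightarrow> complex) \<Rightarrow> (complex \<Rightarrow> complex)" where
  "transfer_op F g R u t \<phi> =
     (\<lambda>z. if z \<in> closed_annulus R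
          then \<Sum>x\<in>preimages (F t) R z. exp (- u * g x) / deriv (F t) x * \<phi> x
          else 0)"

definition dyn_det ::
  "(complex \<Rightarrow> complex \<Rightarrow> complex) \<Rightarrow> (complex \<Rightarrow> complex) \<Rightarrow> real \<Rightarrow> complex \<Rightarrow> complex \<Rightarrow> complex \<Rightarrow> complex" where
  "dyn_det F g R z u t =
     fredholm_det (hol_space R) (hol_norm R) (transfer_op F g R u t) z"

end

(* The transfer operator sends exp(2 pi i k z) to a function whose n-th Fourier coefficient is the
   integral over [0, 1] of exp(2 pi i k x) exp(- u g(x)) exp(- 2 pi i n F_t(x)). Pushing the line of
   integration to Im x = R' or Im x = - R', where |Im F_t| exceeds R, makes these numbers decay
   exponentially in n; they are entire in u and holomorphic in t. Hence they give a representation of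
   the operator with lambda_i = theta^i, and the resulting Fredholm series converges locally
   uniformly in (z, u, t), so its sum is holomorphic.
   That the Fredholm determinant does not depend on the representation follows from the metric
   approximation property of A(C_R): the Fejer means P_m have finite rank, norm at most 1, and tend
   strongly to the identity, and the trace of the n-th exterior power of T is the limit of an
   expression that involves T only through the functions T b, for b in the range of P_m.
   The sum over preimages is identified with its Fourier series by the residue theorem; applied to
   the weight F_t' the same formula counts the preimages. *)
theory Submission
  imports Defs
begin

section \<open>Holomorphic functions of several variables\<close>

text \<open>The determinant is a definite description over all 2/3-summable representations, so a
  convenient one can be used only once all are known to give the same coefficients. The
  representation keeps \<open>lam\<close> and \<open>e\<close> fixed and puts u and t into the
  functionals alone: each coefficient is a sum of products of scalar holomorphic functions, and
  holomorphy of operator-valued maps never has to be discussed. Nor are the preimages followed as t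
  and z move: the contour integrals see F_t only on two fixed lines. Functions in A(C_R) are
  controlled up to |Im z| = R, so the lines must stay inside while F_t carries them beyond R. Near
  the real axis F_t multiplies |Im| by at least some \<kappa> > 1, which leaves room for R' < R with
  \<kappa> R' > R. A mode of frequency n has norm exp(2 pi |n| R), its coefficient is at most of
  order exp(- 2 pi |n| Q) with R < Q < \<kappa> R', and the gap Q - R is the rate of decay. These
  inequalities are strict at t = 0 and so persist for small complex t.\<close>

lemma infsum_tannery:
  fixes f :: "nat \<Rightarrow> 'i \<Rightarrow> 'b::banach"
  assumes le: "\<And>m i. i \<in> A \<Longrightarrow> norm (f m i) \<le> M i"
    and M: "M summable_on A"
    and lim: "\<And>i. i \<in> A \<Longrightarrow> (\<lambda>m. f m i) \<longlonglongrightarrow> g i"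
  shows "(\<lambda>m. infsum (f m) A) \<longlonglongrightarrow> infsum g A"
proof -
  have gle: "norm (g i) \<le> M i" if "i \<in> A" for i
    by (rule LIMSEQ_le_const2[OF tendsto_norm[OF lim[OF that]]]) (use le[OF that] in auto)
  have "g abs_summable_on A"
    by (rule Infinite_Sum.abs_summable_on_comparison_test'[OF M]) (use gle in auto)
  then have "g summable_on A"
    by (rule abs_summable_summable)
  then have gl: "((\<lambda>X. sum g X) \<longlongrightarrow> infsum g A) (finite_subsets_at_top A)"
    using has_sum_infsum[of g A] unfolding has_sum_def by blast
  have ul: "uniform_limit UNIV (\<lambda>X m. \<Sum>i\<in>X. f m i) (\<lambda>m. infsum (f m) A) (finite_subsets_at_top A)"
    by (rule Weierstrass_m_test_general[OF _ M]) (use le in auto)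
  show ?thesis
  proof (rule swap_uniform_limit'[OF _ gl ul])
    show "\<forall>\<^sub>F X in finite_subsets_at_top A. ((\<lambda>m. \<Sum>i\<in>X. f m i) \<longlongrightarrow> sum g X) sequentially"
      unfolding eventually_finite_subsets_at_top
      by (intro exI[of _ "{}"]) (auto intro!: tendsto_sum lim)
  qed auto
qed

section \<open>Osgood's lemma: joint holomorphy from continuity and separate holomorphy\<close>

lemma continuous_on_local:
  fixes S :: "'a::t2_space set"
  assumes "\<And>p. p \<in> S \<Longrightarrow> \<exists>U. open U \<and> p \<in> U \<and> continuous_on (S \<inter> U) f"
  shows "continuous_on S f"
  unfolding continuous_on_eq_continuous_within
proof
  fix p assume p: "p \<in> S"
  obtain U where U: "open U" "p \<in> U" "continuous_on (S \<inter> U) f"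
    using assms[OF p] by blast
  have "at p within S = at p within (S \<inter> U)"
    by (rule at_within_nhd[OF U(2,1)]) auto
  then show "continuous (at p within S) f"
    using U p by (simp add: continuous_on_eq_continuous_within)
qed

text \<open>Cauchy's formula over a fixed circle around \<open>x0\<close> expresses the derivative
  by an integral whose integrand \<open>k\<close> is jointly continuous in the point, the parameter
  and the angle. The parameter lives in a metric space because it stands for complex variables in
  Osgood's lemma and for a real integration variable later.\<close>

lemma continuous_on_deriv_first:
  fixes h :: "complex \<times> 'y::metric_space \<Rightarrow> complex"
  assumes A: "open A" and cont: "continuous_on (A \<times> B) h"
    and hol: "\<And>y. y \<in> B \<Longrightarrow> (\<lambda>x. h (x, y)) holomorphic_on A"
  shows "continuous_on (A \<times> B) (\<lambda>(x, y). deriv (\<lambda>x. h (x, y)) x)"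
proof (rule continuous_on_local)
  fix p assume p: "p \<in> A \<times> B"
  show "\<exists>U. open U \<and> p \<in> U \<and> continuous_on (A \<times> B \<inter> U) (\<lambda>(x, y). deriv (\<lambda>x. h (x, y)) x)"
  proof -
    obtain x0 y0 where p0: "p = (x0, y0)" "x0 \<in> A" "y0 \<in> B" using p by auto
    obtain \<rho> where \<rho>: "\<rho> > 0" "cball x0 \<rho> \<subseteq> A"
      using A p0 open_contains_cball by blast
    define k where "k = (\<lambda>(x, y) s. h (x0 + \<rho> * exp (2 * of_real pi * \<i> * of_real s), y) /
         (x0 + \<rho> * exp (2 * of_real pi * \<i> * of_real s) - x)\<^sup>2 *
         (2 * of_real pi * \<i> * \<rho> * exp (2 * of_real pi * \<i> * of_real s)))"
    have ne: "x0 + \<rho> * exp (2 * of_real pi * \<i> * of_real s) \<noteq> x"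
      if "x \<in> ball x0 \<rho>" for x s
      using that \<rho>(1) by (auto simp: dist_norm norm_mult norm_exp)
    have inA: "x0 + \<rho> * exp (2 * of_real pi * \<i> * of_real s) \<in> A" for s
      using \<rho> by (intro subsetD[OF \<rho>(2)]) (auto simp: dist_norm norm_mult norm_exp)
    have "continuous_on ((ball x0 \<rho> \<times> B) \<times> cbox 0 (1::real)) (\<lambda>(q, s). k q s)"
      unfolding k_def case_prod_unfold
      by (intro continuous_intros continuous_on_compose2[OF cont]) (use inA ne in auto)
    then have "continuous_on (ball x0 \<rho> \<times> B) (\<lambda>q. integral (cbox 0 1) (k q))"
      by (rule integral_continuous_on_param)
    then have c: "continuous_on (ball x0 \<rho> \<times> B) (\<lambda>q. 1 / (2 * of_real pi * \<i>) * integral (cbox 0 1) (k q))"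
      by (intro continuous_intros)
    have eq: "deriv (\<lambda>x. h (x, y)) x = 1 / (2 * of_real pi * \<i>) * integral (cbox 0 1) (k (x, y))"
      if "x \<in> ball x0 \<rho>" "y \<in> B" for x y
    proof -
      have "((\<lambda>w. h (w, y) / (w - x)^(Suc 1)) has_contour_integral (2 * pi * \<i>) / (fact 1) * (deriv ^^ 1) (\<lambda>w. h (w, y)) x)
             (circlepath x0 \<rho>)"
      proof (rule Cauchy_has_contour_integral_higher_derivative_circlepath)
        show "continuous_on (cball x0 \<rho>) (\<lambda>w. h (w, y))"
          using holomorphic_on_imp_continuous_on[OF hol[OF that(2)]] \<rho>(2) continuous_on_subset by blast
        show "(\<lambda>w. h (w, y)) holomorphic_on ball x0 \<rho>"
          using hol[OF that(2)] \<rho>(2) by (meson ball_subset_cball holomorphic_on_subset)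
      qed (use that in auto)
      then have "((\<lambda>s. h (circlepath x0 \<rho> s, y) / (circlepath x0 \<rho> s - x)^2 * vector_derivative (circlepath x0 \<rho>) (at s))
          has_integral (2 * pi * \<i> * deriv (\<lambda>w. h (w, y)) x)) {0..1}"
        by (simp add: has_contour_integral numeral_2_eq_2)
      moreover have "(\<lambda>s. h (circlepath x0 \<rho> s, y) / (circlepath x0 \<rho> s - x)^2 * vector_derivative (circlepath x0 \<rho>) (at s)) = k (x, y)"
        by (rule ext, simp add: k_def vector_derivative_circlepath) (simp add: circlepath)
      ultimately have "(k (x, y) has_integral (2 * pi * \<i> * deriv (\<lambda>w. h (w, y)) x)) (cbox 0 1)"
        by simp
      then show ?thesis
        by (simp add: integral_unique)
    qed
    have "continuous_on (ball x0 \<rho> \<times> B) (\<lambda>(x, y). deriv (\<lambda>x. h (x, y)) x)"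
      by (rule continuous_on_eq[OF c]) (use eq in auto)
    then show ?thesis
      using p0 \<rho> by (intro exI[of _ "ball x0 \<rho> \<times> UNIV"])
        (auto intro!: open_Times elim!: continuous_on_subset)
  qed
qed

text \<open>Adds one variable to a known derivative: a map is differentiable at a point where one
  partial derivative exists and the other is continuous. Continuity of the partial in
  \<open>x\<close> comes from \<open>continuous_on_deriv_first\<close>, so in \<open>y\<close> a
  derivative at the single point \<open>y0\<close> suffices.\<close>

lemma osgood_step:
  fixes h :: "complex \<times> 'y::real_normed_vector \<Rightarrow> complex"
  assumes A: "open A" and B: "open B" and cont: "continuous_on (A \<times> B) h"
    and hol: "\<And>y. y \<in> B \<Longrightarrow> (\<lambda>x. h (x, y)) holomorphic_on A"
    and x0: "x0 \<in> A" and y0: "y0 \<in> B"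
    and D: "((\<lambda>y. h (x0, y)) has_derivative L) (at y0)"
  shows "(h has_derivative (\<lambda>(x, y). deriv (\<lambda>x. h (x, y0)) x0 * x + L y)) (at (x0, y0))"
proof -
  obtain \<rho> where \<rho>: "\<rho> > 0" "ball x0 \<rho> \<subseteq> A"
    using A x0 open_contains_ball by blast
  define d where "d = (\<lambda>x y. deriv (\<lambda>x. h (x, y)) x)"
  have dc: "continuous_on (A \<times> B) (\<lambda>(x, y). d x y)"
    unfolding d_def by (rule continuous_on_deriv_first[OF A cont hol])
  \<comment> \<open>The variables are swapped because \<open>has_derivative_partialsI\<close>
    expects the continuous partial derivative in the second place; the swap is undone below.\<close>
  have "((\<lambda>(y, x). h (x, y)) has_derivative (\<lambda>(ty, tx). L ty + blinfun_mult_right (d x0 y0) tx))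
     (at (y0, x0) within B \<times> ball x0 \<rho>)"
  proof (rule has_derivative_partialsI[where f = "\<lambda>y x. h (x, y)" and fy = "\<lambda>y x. blinfun_mult_right (d x y)"])
    show "((\<lambda>y. h (x0, y)) has_derivative L) (at y0 within B)"
      by (rule has_derivative_at_withinI[OF D])
    show "((\<lambda>x. h (x, y)) has_derivative blinfun_apply (blinfun_mult_right (d x y))) (at x within ball x0 \<rho>)"
      if "y \<in> B" "x \<in> ball x0 \<rho>" for y x
    proof -
      have "((\<lambda>x. h (x, y)) has_field_derivative d x y) (at x)"
        unfolding d_def by (rule holomorphic_derivI[OF hol[OF that(1)] A]) (use that \<rho> in auto)
      then show ?thesis
        by (simp add: has_field_derivative_def has_derivative_at_withinI blinfun_mult_right.rep_eq)
    qed
    have "continuous (at (y0, x0)) (\<lambda>q. d (snd q) (fst q))"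
    proof -
      have "continuous_on (B \<times> A) (\<lambda>q. (\<lambda>(x, y). d x y) (snd q, fst q))"
        by (rule continuous_on_compose2[OF dc]) (auto intro!: continuous_intros)
      then show ?thesis
        unfolding continuous_on_eq_continuous_at[OF open_Times[OF B A]] using x0 y0
        by (simp add: case_prod_unfold)
    qed
    then have "continuous (at (y0, x0)) (\<lambda>q. blinfun_mult_right (d (snd q) (fst q)))"
      by (rule bounded_linear.continuous[OF bounded_linear_blinfun_mult_right])
    then show "continuous (at (y0, x0) within B \<times> ball x0 \<rho>) (\<lambda>(y, x). blinfun_mult_right (d x y))"
      by (simp add: case_prod_unfold continuous_at_imp_continuous_at_within)
  qed (use \<rho> in auto)
  then have *: "((\<lambda>(y, x). h (x, y)) has_derivative (\<lambda>(ty, tx). L ty + d x0 y0 * tx)) (at (y0, x0))"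
    using y0 \<rho> by (simp only: at_within_open[OF _ open_Times[OF B open_ball]] mem_Times_iff fst_conv
        snd_conv centre_in_ball blinfun_mult_right.rep_eq)
  have "((\<lambda>p. (snd p, fst p)) has_derivative (\<lambda>p. (snd p, fst p))) (at (x0, y0))"
    by (intro has_derivative_Pair has_derivative_fst has_derivative_snd has_derivative_ident)
  then have "((\<lambda>p. (\<lambda>(y, x). h (x, y)) (snd p, fst p)) has_derivative
      (\<lambda>p. (\<lambda>(ty, tx). L ty + d x0 y0 * tx) (snd p, fst p))) (at (x0, y0))"
    by (rule has_derivative_compose) (use * in simp)
  then have "((\<lambda>p. h p) has_derivative (\<lambda>p. L (snd p) + d x0 y0 * fst p)) (at (x0, y0))"
    by (simp only: case_prod_unfold fst_conv snd_conv prod.collapse)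
  then show ?thesis
    by (rule has_derivative_eq_rhs) (auto simp: d_def fun_eq_iff)
qed

lemma holomorphic3_onI:
  assumes W: "open W" and cont: "continuous_on W h"
    and 1: "\<And>z u t. (z, u, t) \<in> W \<Longrightarrow> (\<lambda>x. h (x, u, t)) field_differentiable (at z)"
    and 2: "\<And>z u t. (z, u, t) \<in> W \<Longrightarrow> (\<lambda>x. h (z, x, t)) field_differentiable (at u)"
    and 3: "\<And>z u t. (z, u, t) \<in> W \<Longrightarrow> (\<lambda>x. h (z, u, x)) field_differentiable (at t)"
  shows "holomorphic3_on h W"
  unfolding holomorphic3_on_def
proof
  fix p assume p: "p \<in> W"
  obtain z u t where pe: "p = (z, u, t)" by (cases p)
  obtain A BC where ABC: "open A" "open BC" "z \<in> A" "(u, t) \<in> BC" "A \<times> BC \<subseteq> W"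
    by (rule open_prod_elim[OF W p[unfolded pe]]) auto
  obtain B C where BC: "open B" "open C" "u \<in> B" "t \<in> C" "B \<times> C \<subseteq> BC"
    by (rule open_prod_elim[OF ABC(2,4)]) auto
  have sub: "A \<times> B \<times> C \<subseteq> W" using ABC BC by blast
  \<comment> \<open>Osgood's step in (u, t) at frozen z; the resulting derivative serves as
    \<open>L\<close> when z is added.\<close>
  have d2: "((\<lambda>p. h (z, p)) has_derivative (\<lambda>(x, y). deriv (\<lambda>x. h (z, x, t)) u * x + deriv (\<lambda>x. h (z, u, x)) t * y)) (at (u, t))"
  proof (rule osgood_step[OF BC(1,2)])
    show "continuous_on (B \<times> C) (\<lambda>p. h (z, p))"
      by (rule continuous_on_compose2[OF cont]) (use sub ABC in \<open>auto intro!: continuous_intros\<close>)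
    show "(\<lambda>x. h (z, x, y)) holomorphic_on B" if "y \<in> C" for y
      unfolding holomorphic_on_def using sub ABC(3) that
      by (auto intro!: field_differentiable_at_within 2)
    show "((\<lambda>y. h (z, u, y)) has_derivative (*) (deriv (\<lambda>x. h (z, u, x)) t)) (at t)"
      using 3[of z u t] p pe by (simp add: field_differentiable_derivI flip: has_field_derivative_def)
  qed (use BC in auto)
  have "(h has_derivative (\<lambda>(x, y). deriv (\<lambda>x. h (x, u, t)) z * x +
      (\<lambda>(x, y). deriv (\<lambda>x. h (z, x, t)) u * x + deriv (\<lambda>x. h (z, u, x)) t * y) y)) (at (z, u, t))"
  proof (rule osgood_step[OF ABC(1) _ _ _ _ _ d2])
    show "open (B \<times> C)" using BC by (simp add: open_Times)
    show "continuous_on (A \<times> B \<times> C) h"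
      by (rule continuous_on_subset[OF cont sub])
    show "(\<lambda>x. h (x, y)) holomorphic_on A" if "y \<in> B \<times> C" for y
      unfolding holomorphic_on_def using sub that
      by (cases y) (auto intro!: field_differentiable_at_within 1)
  qed (use ABC BC in auto)
  then have "(h has_derivative (\<lambda>(x, y, w). deriv (\<lambda>x. h (x, u, t)) z * x +
      deriv (\<lambda>x. h (z, x, t)) u * y + deriv (\<lambda>x. h (z, u, x)) t * w)) (at p)"
    unfolding pe by (rule has_derivative_eq_rhs) (auto simp: fun_eq_iff)
  then show "\<exists>a b c. (h has_derivative (\<lambda>(x, y, w). a * x + b * y + c * w)) (at p)"
    by - (rule exI[of _ "deriv (\<lambda>x. h (x, u, t)) z"], rule exI[of _ "deriv (\<lambda>x. h (z, x, t)) u"],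
        rule exI[of _ "deriv (\<lambda>x. h (z, u, x)) t"])
qed

lemma holomorphic3_onE:
  assumes "holomorphic3_on h W" "p \<in> W"
  obtains a b c where "(h has_derivative (\<lambda>(x, y, w). a * x + b * y + c * w)) (at p)"
proof -
  from assms have "\<exists>a b c. (h has_derivative (\<lambda>(x, y, w). a * x + b * y + c * w)) (at p)"
    unfolding holomorphic3_on_def by (rule bspec)
  then show thesis
    by (elim exE) (rule that)
qed

lemma holomorphic3_on_imp_continuous_on:
  assumes "holomorphic3_on h W"
  shows "continuous_on W h"
proof (rule continuous_at_imp_continuous_on, rule ballI)
  fix p assume "p \<in> W"
  with assms show "isCont h p"
    by (rule holomorphic3_onE) (rule has_derivative_continuous)
qed

lemma holomorphic3_on_imp_field_differentiable:
  assumes "holomorphic3_on h W" "(z, u, t) \<in> W"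
  shows "(\<lambda>x. h (x, u, t)) field_differentiable (at z)"
    and "(\<lambda>x. h (z, x, t)) field_differentiable (at u)"
    and "(\<lambda>x. h (z, u, x)) field_differentiable (at t)"
proof -
  obtain a b c where d: "(h has_derivative (\<lambda>(x, y, w). a * x + b * y + c * w)) (at (z, u, t))"
    using assms by (rule holomorphic3_onE)
  have "((\<lambda>x. (x, u, t)) has_derivative (\<lambda>x. (x, 0, 0))) (at z)"
    by (intro has_derivative_Pair has_derivative_const has_derivative_ident)
  from has_derivative_compose[OF this d]
  have "((\<lambda>x. h (x, u, t)) has_field_derivative a) (at z)"
    by (simp add: has_field_derivative_def)
  then show "(\<lambda>x. h (x, u, t)) field_differentiable (at z)"
    by (auto simp: field_differentiable_def)
  have "((\<lambda>x. (z, x, t)) has_derivative (\<lambda>x. (0, x, 0))) (at u)"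
    by (intro has_derivative_Pair has_derivative_const has_derivative_ident)
  from has_derivative_compose[OF this d]
  have "((\<lambda>x. h (z, x, t)) has_field_derivative b) (at u)"
    by (simp add: has_field_derivative_def)
  then show "(\<lambda>x. h (z, x, t)) field_differentiable (at u)"
    by (auto simp: field_differentiable_def)
  have "((\<lambda>x. (z, u, x)) has_derivative (\<lambda>x. (0, 0, x))) (at t)"
    by (intro has_derivative_Pair has_derivative_const has_derivative_ident)
  from has_derivative_compose[OF this d]
  have "((\<lambda>x. h (z, u, x)) has_field_derivative c) (at t)"
    by (simp add: has_field_derivative_def)
  then show "(\<lambda>x. h (z, u, x)) field_differentiable (at t)"
    by (auto simp: field_differentiable_def)
qed

section \<open>Uniform limits, sums and products of holomorphic maps\<close>

lemma field_differentiable_uniform_limit: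
  fixes h :: "'i \<Rightarrow> complex \<Rightarrow> complex"
  assumes S: "open S" "z \<in> S" and F: "F \<noteq> bot"
    and h: "\<And>i x. x \<in> S \<Longrightarrow> h i field_differentiable (at x)"
    and lim: "uniform_limit S h g F"
  shows "g field_differentiable (at z)"
proof -
  obtain \<rho> where \<rho>: "\<rho> > 0" "cball z \<rho> \<subseteq> S"
    using S open_contains_cball by blast
  have hol: "h i holomorphic_on S" for i
    using h by (auto simp: holomorphic_on_def intro: field_differentiable_at_within)
  have "g holomorphic_on ball z \<rho>"
  proof (rule holomorphic_uniform_limit)
    show "\<forall>\<^sub>F n in F. continuous_on (cball z \<rho>) (h n) \<and> h n holomorphic_on ball z \<rho>"
      by (intro always_eventually allI conjI holomorphic_on_imp_continuous_on
          holomorphic_on_subset[OF hol]) (use \<rho>(2) ball_subset_cball in auto)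
    show "uniform_limit (cball z \<rho>) h g F"
      by (rule uniform_limit_on_subset[OF lim \<rho>(2)])
  qed (use F in auto)
  then show ?thesis
    by (rule holomorphic_on_imp_differentiable_at) (use \<rho> in auto)
qed

lemma holomorphic3_uniform_limit:
  assumes W: "open W" and F: "F \<noteq> bot"
    and h: "\<And>i. holomorphic3_on (h i) W"
    and lim: "uniform_limit W h g F"
  shows "holomorphic3_on g W"
proof (rule holomorphic3_onI[OF W])
  show "continuous_on W g"
    by (rule uniform_limit_theorem[OF _ lim F])
      (use h holomorphic3_on_imp_continuous_on in \<open>auto intro!: always_eventually\<close>)
next
  \<comment> \<open>\<open>e\<close> embeds a complex line parallel to an axis; on its preimage of
    \<open>W\<close> the one-variable theorem of Weierstrass applies.\<close>
  have slice: "(\<lambda>x. g (e x)) field_differentiable (at a)"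
    if e: "continuous_on UNIV e" "e a \<in> W"
      and d: "\<And>i x. e x \<in> W \<Longrightarrow> (\<lambda>x. h i (e x)) field_differentiable (at x)" for e a
  proof (rule field_differentiable_uniform_limit[where S = "e -` W" and h = "\<lambda>i x. h i (e x)" and F = F])
    show "open (e -` W)" by (rule open_vimage[OF W e(1)])
    show "uniform_limit (e -` W) (\<lambda>i x. h i (e x)) (\<lambda>x. g (e x)) F"
      by (rule uniform_limit_compose'[OF lim]) auto
  qed (use e F d in simp_all)
  fix z u t assume p: "(z, u, t) \<in> W"
  show "(\<lambda>x. g (x, u, t)) field_differentiable (at z)"
    by (rule slice) (use p holomorphic3_on_imp_field_differentiable(1)[OF h] in \<open>auto intro!: continuous_intros\<close>)
  show "(\<lambda>x. g (z, x, t)) field_differentiable (at u)"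
    by (rule slice) (use p holomorphic3_on_imp_field_differentiable(2)[OF h] in \<open>auto intro!: continuous_intros\<close>)
  show "(\<lambda>x. g (z, u, x)) field_differentiable (at t)"
    by (rule slice) (use p holomorphic3_on_imp_field_differentiable(3)[OF h] in \<open>auto intro!: continuous_intros\<close>)
qed

lemma holomorphic3_const: "holomorphic3_on (\<lambda>_. c) W"
  unfolding holomorphic3_on_def by (auto intro!: exI[of _ 0] simp: case_prod_unfold)

lemma holomorphic3_mult:
  assumes W: "open W" and f: "holomorphic3_on f W" and g: "holomorphic3_on g W"
  shows "holomorphic3_on (\<lambda>p. f p * g p) W"
  by (intro holomorphic3_onI W continuous_on_mult field_differentiable_mult
      f[THEN holomorphic3_on_imp_continuous_on] g[THEN holomorphic3_on_imp_continuous_on]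
      holomorphic3_on_imp_field_differentiable[OF f] holomorphic3_on_imp_field_differentiable[OF g])

lemma holomorphic3_add:
  assumes W: "open W" and f: "holomorphic3_on f W" and g: "holomorphic3_on g W"
  shows "holomorphic3_on (\<lambda>p. f p + g p) W"
  by (intro holomorphic3_onI W continuous_on_add field_differentiable_add
      f[THEN holomorphic3_on_imp_continuous_on] g[THEN holomorphic3_on_imp_continuous_on]
      holomorphic3_on_imp_field_differentiable[OF f] holomorphic3_on_imp_field_differentiable[OF g])

lemma holomorphic3_sum:
  assumes "open W"
  shows "(\<And>i. i \<in> I \<Longrightarrow> holomorphic3_on (f i) W) \<Longrightarrow> holomorphic3_on (\<lambda>p. \<Sum>i\<in>I. f i p) W"
  by (induction I rule: infinite_finite_induct) (auto intro: holomorphic3_const holomorphic3_add assms)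

lemma holomorphic3_prod:
  assumes "open W"
  shows "(\<And>i. i \<in> I \<Longrightarrow> holomorphic3_on (f i) W) \<Longrightarrow> holomorphic3_on (\<lambda>p. \<Prod>i\<in>I. f i p) W"
  by (induction I rule: infinite_finite_induct) (auto intro: holomorphic3_const holomorphic3_mult assms)

lemma holomorphic3_on_UN:
  assumes "\<And>i. i \<in> I \<Longrightarrow> holomorphic3_on h (W i)"
  shows "holomorphic3_on h (\<Union>i\<in>I. W i)"
  unfolding holomorphic3_on_def
proof
  fix p assume "p \<in> (\<Union>i\<in>I. W i)"
  then obtain i where i: "i \<in> I" "p \<in> W i" by auto
  show "\<exists>a b c. (h has_derivative (\<lambda>(x, y, w). a * x + b * y + c * w)) (at p)"
    by (rule bspec[OF assms[unfolded holomorphic3_on_def, OF i(1)] i(2)])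
qed

section \<open>Independence of the representation\<close>

text \<open>Finitely many convergent nonnegative series may be multiplied out; this provides the
  domination for all sums over index tuples.\<close>

lemma summable_on_prod_PiE_nat:
  fixes f :: "'a \<Rightarrow> nat \<Rightarrow> real"
  assumes "finite A" and pos: "\<And>a i. a \<in> A \<Longrightarrow> 0 \<le> f a i" and "\<And>a. a \<in> A \<Longrightarrow> summable (f a)"
  shows "(\<lambda>g. \<Prod>a\<in>A. f a (g a)) summable_on (A \<rightarrow>\<^sub>E UNIV)"
proof -
  have "Infinite_Set_Sum.abs_summable_on (f a) UNIV" if "a \<in> A" for a
    using that assms by (simp add: abs_summable_on_nat_iff')
  then have "Infinite_Set_Sum.abs_summable_on (\<lambda>g. \<Prod>a\<in>A. f a (g a)) (PiE A (\<lambda>_. UNIV))"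
    using assms(1) by (intro Infinite_Set_Sum.abs_summable_on_prod_PiE) auto
  then have "(\<lambda>g. norm (\<Prod>a\<in>A. f a (g a))) summable_on (A \<rightarrow>\<^sub>E UNIV)"
    unfolding abs_summable_equivalent .
  moreover have "norm (\<Prod>a\<in>A. f a (g a)) = (\<Prod>a\<in>A. f a (g a))" for g
    using pos by (simp add: prod_nonneg)
  ultimately show ?thesis by simp
qed

lemma has_sum_sum:
  fixes f :: "'j \<Rightarrow> 'i \<Rightarrow> 'b::topological_comm_monoid_add"
  assumes "\<And>j. j \<in> J \<Longrightarrow> (f j has_sum s j) A"
  shows "((\<lambda>x. \<Sum>j\<in>J. f j x) has_sum (\<Sum>j\<in>J. s j)) A"
  using assms by (induction J rule: infinite_finite_induct) (auto intro: has_sum_add)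

section \<open>Bounded functionals on spaces of functions\<close>

lemma bounded_functional_add:
  "bounded_functional V N C l \<Longrightarrow> \<phi> \<in> V \<Longrightarrow> \<psi> \<in> V \<Longrightarrow> l (\<lambda>x. \<phi> x + \<psi> x) = l \<phi> + l \<psi>"
  unfolding bounded_functional_def by blast

lemma bounded_functional_mult:
  "bounded_functional V N C l \<Longrightarrow> \<phi> \<in> V \<Longrightarrow> l (\<lambda>x. c * \<phi> x) = c * l \<phi>"
  unfolding bounded_functional_def by blast

lemma bounded_functional_le:
  "bounded_functional V N C l \<Longrightarrow> \<phi> \<in> V \<Longrightarrow> norm (l \<phi>) \<le> C * N \<phi>"
  unfolding bounded_functional_def by blast

definition func_space :: "('a \<Rightarrow> complex) set \<Rightarrow> bool" where
  "func_space V \<longleftrightarrow> (\<lambda>x. 0) \<in> V \<and> (\<forall>\<phi>\<in>V. \<forall>\<psi>\<in>V. (\<lambda>x. \<phi> x + \<psi> x) \<in> V) \<and> (\<forall>c. \<forall>\<phi>\<in>V. (\<lambda>x. c * \<phi> x) \<in> V)"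

lemma func_space_sum:
  assumes "func_space V" "\<And>q. q \<in> I \<Longrightarrow> \<beta> q \<in> V"
  shows "(\<lambda>x. \<Sum>q\<in>I. c q * \<beta> q x) \<in> V"
  using assms by (induction I rule: infinite_finite_induct) (auto simp: func_space_def)

lemma func_space_diff:
  assumes V: "func_space V" and "\<phi> \<in> V" "\<psi> \<in> V"
  shows "(\<lambda>x. \<phi> x - \<psi> x) \<in> V"
proof -
  have "(\<lambda>x. (-1) * \<psi> x) \<in> V"
    using assms unfolding func_space_def by blast
  then have "(\<lambda>x. \<phi> x + (\<lambda>x. (-1) * \<psi> x) x) \<in> V"
    using assms unfolding func_space_def by (simp only:)
  then show ?thesis by simp
qed

lemma bounded_functional_sum:
  assumes V: "func_space V" and l: "bounded_functional V N C l" and "\<And>q. q \<in> I \<Longrightarrow> \<beta> q \<in> V"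
  shows "l (\<lambda>x. \<Sum>q\<in>I. c q * \<beta> q x) = (\<Sum>q\<in>I. c q * l (\<beta> q))"
proof -
  have 0: "l (\<lambda>x. 0) = 0"
    using bounded_functional_mult[OF l, of "\<lambda>x. 0" 0] V by (simp add: func_space_def)
  show ?thesis
    using assms(3)
  proof (induction I rule: infinite_finite_induct)
    case (insert q I)
    have "(\<lambda>x. c q * \<beta> q x) \<in> V"
      using V insert.prems by (simp add: func_space_def)
    moreover have "(\<lambda>x. \<Sum>q\<in>I. c q * \<beta> q x) \<in> V"
      by (rule func_space_sum[OF V]) (use insert.prems in auto)
    ultimately have "l (\<lambda>x. c q * \<beta> q x + (\<Sum>q\<in>I. c q * \<beta> q x)) = l (\<lambda>x. c q * \<beta> q x) + l (\<lambda>x. \<Sum>q\<in>I. c q * \<beta> q x)"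
      by (rule bounded_functional_add[OF l])
    also have "l (\<lambda>x. c q * \<beta> q x) = c q * l (\<beta> q)"
      by (rule bounded_functional_mult[OF l]) (use insert.prems in auto)
    finally show ?case
      using insert by simp
  qed (auto simp: 0)
qed

lemma bounded_functional_diff:
  assumes V: "func_space V" and l: "bounded_functional V N C l" and "\<phi> \<in> V" "\<psi> \<in> V"
  shows "l (\<lambda>x. \<phi> x - \<psi> x) = l \<phi> - l \<psi>"
proof -
  have "(\<lambda>x. (-1) * \<psi> x) \<in> V"
    using assms unfolding func_space_def by blast
  then have "l (\<lambda>x. \<phi> x + (-1) * \<psi> x) = l \<phi> + l (\<lambda>x. (-1) * \<psi> x)"
    using assms bounded_functional_add by blast
  also have "l (\<lambda>x. (-1) * \<psi> x) = - l \<psi>"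
    using bounded_functional_mult[OF l, of \<psi> "-1"] assms by simp
  finally show ?thesis by simp
qed

definition minor :: "nat \<Rightarrow> (nat \<Rightarrow> nat \<Rightarrow> complex) \<Rightarrow> (nat \<Rightarrow> nat) \<Rightarrow> complex" where
  "minor n b i = (\<Sum>\<sigma> | \<sigma> permutes {..<n}. of_int (sign \<sigma>) * (\<Prod>a<n. b (i a) (i (\<sigma> a))))"

text \<open>Leibniz's formula has n! terms; this factor cancels against 1 / n! in
  \<open>fredholm_coeff\<close>.\<close>

lemma norm_minor_le:
  assumes "\<And>i j. norm (b i j) \<le> C"
  shows "norm (minor n b i) \<le> fact n * C ^ n"
proof -
  have "norm (of_int (sign \<sigma>) * (\<Prod>a<n. b (i a) (i (\<sigma> a)))) \<le> C ^ n" for \<sigma> :: "nat \<Rightarrow> nat"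
  proof -
    have "norm (of_int (sign \<sigma>) * (\<Prod>a<n. b (i a) (i (\<sigma> a)))) = (\<Prod>a<n. norm (b (i a) (i (\<sigma> a))))"
      by (simp add: norm_mult prod_norm sign_def)
    also have "\<dots> \<le> (\<Prod>a<n. C)" by (intro prod_mono) (use assms in auto)
    finally show ?thesis by simp
  qed
  then have "norm (minor n b i) \<le> (\<Sum>\<sigma> | \<sigma> permutes {..<n}. C ^ n)"
    unfolding minor_def by (intro order_trans[OF norm_sum] sum_mono)
  also have "\<dots> = fact n * C ^ n"
    by (simp add: card_permutations[of "{..<n}" n])
  finally show ?thesis .
qed

text \<open>Moves the permutation from \<open>i\<close> to \<open>k\<close>, so that each factor
  depends on a single entry \<open>i a\<close> and a sum over tuples \<open>i\<close>
  factorises.\<close>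

lemma prod_inv_permutes:
  assumes "\<sigma> permutes A"
  shows "(\<Prod>a\<in>A. f (k a) (i (\<sigma> a))) = (\<Prod>a\<in>A. f (k (inv \<sigma> a)) (i a))"
  using prod.permute[OF assms, of "\<lambda>a. f (k (inv \<sigma> a)) (i a)"] permutes_inverses[OF assms]
  by (simp add: o_def)

text \<open>The bounded approximation property: the finite rank operators with coordinates
  \<open>\<alpha>\<close> and vectors \<open>\<beta>\<close> are uniformly bounded by
  \<open>K\<close> and tend strongly to the identity. The single coordinates are bounded for each
  \<open>m\<close> separately, by \<open>A m\<close>, and are used at fixed
  \<open>m\<close>.\<close>

locale approximation =
  fixes V :: "('a \<Rightarrow> complex) set" and N :: "('a \<Rightarrow> complex) \<Rightarrow> real"
    and I :: "nat \<Rightarrow> 'q set" and \<alpha> :: "nat \<Rightarrow> 'q \<Rightarrow> ('a \<Rightarrow> complex) \<Rightarrow> complex"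
    and \<beta> :: "nat \<Rightarrow> 'q \<Rightarrow> 'a \<Rightarrow> complex" and A :: "nat \<Rightarrow> real" and K :: real
  assumes V: "func_space V"
    and N_nonneg: "\<And>\<phi>. \<phi> \<in> V \<Longrightarrow> 0 \<le> N \<phi>"
    and fin: "\<And>m. finite (I m)"
    and \<alpha>: "\<And>m q. q \<in> I m \<Longrightarrow> bounded_functional V N (A m) (\<alpha> m q)"
    and \<beta>: "\<And>m q. q \<in> I m \<Longrightarrow> \<beta> m q \<in> V"
    and K: "\<And>m \<phi>. \<phi> \<in> V \<Longrightarrow> N (\<lambda>x. \<Sum>q\<in>I m. \<alpha> m q \<phi> * \<beta> m q x) \<le> K * N \<phi>"
    and conv: "\<And>\<phi>. \<phi> \<in> V \<Longrightarrow> (\<lambda>m. N (\<lambda>x. (\<Sum>q\<in>I m. \<alpha> m q \<phi> * \<beta> m q x) - \<phi> x)) \<longlonglongrightarrow> 0"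
begin

text \<open>The trace of the n-th exterior power of the finite matrix with entries
  \<open>\<alpha> m p (T (\<beta> m q))\<close>, that is, of T followed by the m-th approximation.
  No representation of T occurs in it.\<close>

definition approx_coeff :: "(('a \<Rightarrow> complex) \<Rightarrow> 'a \<Rightarrow> complex) \<Rightarrow> nat \<Rightarrow> nat \<Rightarrow> complex" where
  "approx_coeff T n m = (1 / fact n) * (\<Sum>\<sigma> | \<sigma> permutes {..<n}. of_int (sign \<sigma>) *
     (\<Sum>k\<in>{..<n} \<rightarrow>\<^sub>E I m. \<Prod>a<n. \<alpha> m (k (inv \<sigma> a)) (T (\<beta> m (k a)))))"

lemma summable_powr_imp_summable:
  fixes lam :: "nat \<Rightarrow> complex"
  assumes "summable (\<lambda>i. norm (lam i) powr p)" "0 < p" "p \<le> 1"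
  shows "summable (\<lambda>i. norm (lam i))"
proof (rule summable_comparison_test_ev[OF _ assms(1)])
  have "(\<lambda>i. norm (lam i) powr p) \<longlonglongrightarrow> 0"
    by (rule summable_LIMSEQ_zero[OF assms(1)])
  then have "\<forall>\<^sub>F i in sequentially. norm (lam i) powr p < 1"
    by (rule order_tendstoD) auto
  then show "\<forall>\<^sub>F i in sequentially. norm (norm (lam i)) \<le> norm (lam i) powr p"
  proof eventually_elim
    case (elim i)
    then have le: "norm (lam i) \<le> 1"
      using assms(2) by (metis linorder_not_le ge_one_powr_ge_zero less_imp_le)
    show ?case
    proof (cases "lam i = 0")
      case False
      then show ?thesis
        using powr_mono'[of p 1 "norm (lam i)"] le assms by simp
    qed auto
  qed
qed

text \<open>The representation converges in norm, so a bounded functional may be applied term by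
  term.\<close>

lemma functional_sums:
  assumes rep: "summable_rep p V N T lam l e" and \<phi>: "\<phi> \<in> V" and f: "bounded_functional V N C f"
  shows "(\<lambda>i. lam i * l i \<phi> * f (e i)) sums f (T \<phi>)"
proof -
  have e: "e i \<in> V" for i
    using rep unfolding summable_rep_def by auto
  have T: "T \<phi> \<in> V"
    and lim: "(\<lambda>n. N (\<lambda>x. T \<phi> x - (\<Sum>i<n. lam i * l i \<phi> * e i x))) \<longlonglongrightarrow> 0"
    using \<phi> rep unfolding summable_rep_def by auto
  have "(\<lambda>n. f (T \<phi>) - (\<Sum>i<n. lam i * l i \<phi> * f (e i))) \<longlonglongrightarrow> 0"
  proof (rule Lim_null_comparison)
    show "(\<lambda>n. C * N (\<lambda>x. T \<phi> x - (\<Sum>i<n. lam i * l i \<phi> * e i x))) \<longlonglongrightarrow> 0"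
      using tendsto_mult_right_zero[OF lim] by simp
    show "\<forall>\<^sub>F n in sequentially. norm (f (T \<phi>) - (\<Sum>i<n. lam i * l i \<phi> * f (e i)))
        \<le> C * N (\<lambda>x. T \<phi> x - (\<Sum>i<n. lam i * l i \<phi> * e i x))"
    proof (rule always_eventually, rule allI)
      fix n
      have s: "(\<lambda>x. \<Sum>i<n. lam i * l i \<phi> * e i x) \<in> V"
        by (rule func_space_sum[OF V]) (use e in auto)
      have "f (\<lambda>x. T \<phi> x - (\<Sum>i<n. lam i * l i \<phi> * e i x)) = f (T \<phi>) - (\<Sum>i<n. lam i * l i \<phi> * f (e i))"
        by (subst bounded_functional_diff[OF V f T s], subst bounded_functional_sum[OF V f]) (use e in auto)
      then show "norm (f (T \<phi>) - (\<Sum>i<n. lam i * l i \<phi> * f (e i)))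
        \<le> C * N (\<lambda>x. T \<phi> x - (\<Sum>i<n. lam i * l i \<phi> * e i x))"
        using bounded_functional_le[OF f func_space_diff[OF V T s]] by simp
    qed
  qed
  then have "(\<lambda>n. f (T \<phi>) - (f (T \<phi>) - (\<Sum>i<n. lam i * l i \<phi> * f (e i)))) \<longlonglongrightarrow> f (T \<phi>) - 0"
    by (intro tendsto_intros)
  then show ?thesis
    by (simp add: sums_def)
qed

text \<open>Put \<open>P m (e j)\<close> for \<open>e j\<close> in the coefficient. As m grows,
  dominated convergence brings back the coefficient itself; at fixed m the finite sum defining
  \<open>P m\<close> can be pulled out, and the sums over the representation collapse to values of
  T. So the coefficient is a limit of quantities that depend on T alone.\<close>

lemma fredholm_coeff_LIMSEQ:
  assumes rep: "summable_rep p V N T lam l e" and p: "0 < p" "p \<le> 1"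
  shows "approx_coeff T n \<longlonglongrightarrow> fredholm_coeff lam l e n"
proof -
  obtain C where C: "\<And>i. bounded_functional V N C (l i)" "\<And>i. e i \<in> V" "\<And>i. N (e i) \<le> C"
    using rep unfolding summable_rep_def by auto
  have C0: "0 \<le> C" using N_nonneg[OF C(2)] C(3) order_trans by blast
  have sl: "summable (\<lambda>i. norm (lam i))"
    using rep p unfolding summable_rep_def by (intro summable_powr_imp_summable) auto
  define P where "P = (\<lambda>m \<phi> x. \<Sum>q\<in>I m. \<alpha> m q \<phi> * \<beta> m q x)"
  have PV: "P m \<phi> \<in> V" for m \<phi>
    unfolding P_def by (rule func_space_sum[OF V]) (use \<beta> in auto)
  define X where "X = (\<lambda>m i j. l i (P m (e j)))"
  have X: "X m i j = (\<Sum>q\<in>I m. \<alpha> m q (e j) * l i (\<beta> m q))" for m i j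
    unfolding X_def P_def by (rule bounded_functional_sum[OF V C(1)]) (use \<beta> in auto)
  define B where "B = C * (\<bar>K\<bar> * C)"
  have B0: "0 \<le> B" using C0 by (simp add: B_def)
  have Xle: "norm (X m i j) \<le> B" for m i j
  proof -
    have "norm (X m i j) \<le> C * N (P m (e j))"
      unfolding X_def by (rule bounded_functional_le[OF C(1) PV])
    also have "N (P m (e j)) \<le> K * N (e j)"
      unfolding P_def by (rule K[OF C(2)])
    also have "\<dots> \<le> \<bar>K\<bar> * C"
      using C(3)[of j] N_nonneg[OF C(2)[of j]] by (intro mult_mono) auto
    finally show ?thesis using C0 by (simp add: B_def mult_left_mono)
  qed
  have Xlim: "(\<lambda>m. X m i j) \<longlonglongrightarrow> l i (e j)" for i j
  proof -
    have "(\<lambda>m. X m i j - l i (e j)) \<longlonglongrightarrow> 0"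
    proof (rule Lim_null_comparison)
      show "\<forall>\<^sub>F m in sequentially. norm (X m i j - l i (e j)) \<le> C * N (\<lambda>x. P m (e j) x - e j x)"
        unfolding X_def
        using bounded_functional_le[OF C(1) func_space_diff[OF V PV C(2)]]
        by (simp add: bounded_functional_diff[OF V C(1) PV C(2)])
      show "(\<lambda>m. C * N (\<lambda>x. P m (e j) x - e j x)) \<longlonglongrightarrow> 0"
        unfolding P_def by (rule tendsto_mult_right_zero[OF conv[OF C(2)]])
    qed
    then show ?thesis by (simp add: LIM_zero_cancel)
  qed
  define tm where "tm = (\<lambda>Y i. (\<Prod>a<n. lam (i a)) * minor n Y i)"
  let ?S = "{..<n} \<rightarrow>\<^sub>E (UNIV :: nat set)"
  have finp: "finite {\<sigma>. \<sigma> permutes {..<n}}" by (simp add: finite_permutations)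
  have summ: "(\<lambda>i. \<Prod>a<n. norm (lam (i a))) summable_on ?S"
    by (rule summable_on_prod_PiE_nat) (use sl in auto)
  \<comment> \<open>The bound \<open>fact n * B ^ n\<close> on the minors is uniform in m, and the
    products of the summable \<open>norm (lam i)\<close> dominate the rest.\<close>
  have "(\<lambda>m. infsum (tm (X m)) ?S) \<longlonglongrightarrow> infsum (tm (\<lambda>i j. l i (e j))) ?S"
  proof (rule infsum_tannery)
    show "(\<lambda>i. (\<Prod>a<n. norm (lam (i a))) * (fact n * B ^ n)) summable_on ?S"
      by (rule summable_on_cmult_left[OF summ])
    fix m i
    have "norm (\<Prod>a<n. lam (i a)) * norm (minor n (X m) i) \<le> norm (\<Prod>a<n. lam (i a)) * (fact n * B ^ n)"
      by (rule mult_left_mono[OF norm_minor_le[OF Xle] norm_ge_zero])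
    then show "norm (tm (X m) i) \<le> (\<Prod>a<n. norm (lam (i a))) * (fact n * B ^ n)"
      by (simp only: tm_def norm_mult prod_norm)
  next
    fix i show "(\<lambda>m. tm (X m) i) \<longlonglongrightarrow> tm (\<lambda>i j. l i (e j)) i"
      unfolding tm_def minor_def by (intro tendsto_intros Xlim)
  qed
  then have lim: "(\<lambda>m. (1 / fact n) * infsum (tm (X m)) ?S) \<longlonglongrightarrow> fredholm_coeff lam l e n"
    unfolding fredholm_coeff_def tm_def minor_def by (intro tendsto_intros)
  \<comment> \<open>At fixed m: expand \<open>X m\<close> over \<open>I m\<close>, exchange the
    finite sums with the sum over tuples, and evaluate each factor by
    \<open>functional_sums\<close>.\<close>
  have eq: "(1 / fact n) * infsum (tm (X m)) ?S = approx_coeff T n m" for m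
  proof -
    \<comment> \<open>The factor at position \<open>a\<close> once the permutation acts on
      \<open>k\<close>. It involves the tuple only through \<open>j\<close>, standing for
      \<open>i a\<close>, so the sum over tuples is a product of n single series.\<close>
    define h where "h = (\<lambda>(\<sigma>::nat\<Rightarrow>nat) k a j. lam j * l j (\<beta> m (k a)) * \<alpha> m (k (inv \<sigma> a)) (e j))"
    have hsm: "summable (\<lambda>j. norm (h \<sigma> k a j))"
      and hs: "(\<lambda>j. norm (h \<sigma> k a j)) summable_on UNIV" and hsum: "infsum (h \<sigma> k a) UNIV = \<alpha> m (k (inv \<sigma> a)) (T (\<beta> m (k a)))"
      if "\<sigma> permutes {..<n}" "k \<in> {..<n} \<rightarrow>\<^sub>E I m" "a < n" for \<sigma> k a
    proof -
      have ka: "k a \<in> I m" "k (inv \<sigma> a) \<in> I m"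
        using that permutes_in_image[OF permutes_inv[OF that(1)], of a] by auto
      show "summable (\<lambda>j. norm (h \<sigma> k a j))"
      proof (rule summable_comparison_test_ev)
        show "summable (\<lambda>j. norm (lam j) * (C * N (\<beta> m (k a)) * (\<bar>A m\<bar> * C)))"
          by (rule summable_mult2[OF sl])
        show "\<forall>\<^sub>F j in sequentially. norm (norm (h \<sigma> k a j)) \<le> norm (lam j) * (C * N (\<beta> m (k a)) * (\<bar>A m\<bar> * C))"
        proof (rule always_eventually, rule allI)
          fix j
          have "norm (\<alpha> m (k (inv \<sigma> a)) (e j)) \<le> A m * N (e j)"
            by (rule bounded_functional_le[OF \<alpha>[OF ka(2)] C(2)])
          also have "\<dots> \<le> \<bar>A m\<bar> * C"
            using C(3)[of j] N_nonneg[OF C(2)[of j]] by (intro mult_mono) auto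
          finally have 2: "norm (\<alpha> m (k (inv \<sigma> a)) (e j)) \<le> \<bar>A m\<bar> * C" .
          have 1: "norm (l j (\<beta> m (k a))) \<le> C * N (\<beta> m (k a))"
            by (rule bounded_functional_le[OF C(1) \<beta>[OF ka(1)]])
          have "norm (l j (\<beta> m (k a))) * norm (\<alpha> m (k (inv \<sigma> a)) (e j)) \<le> C * N (\<beta> m (k a)) * (\<bar>A m\<bar> * C)"
            by (rule mult_mono[OF 1 2 order_trans[OF norm_ge_zero 1] norm_ge_zero])
          then have "norm (lam j) * (norm (l j (\<beta> m (k a))) * norm (\<alpha> m (k (inv \<sigma> a)) (e j)))
              \<le> norm (lam j) * (C * N (\<beta> m (k a)) * (\<bar>A m\<bar> * C))"
            by (rule mult_left_mono) simp
          then show "norm (norm (h \<sigma> k a j)) \<le> norm (lam j) * (C * N (\<beta> m (k a)) * (\<bar>A m\<bar> * C))"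
            by (simp only: h_def norm_mult real_norm_def abs_mult abs_norm_cancel mult.assoc)
        qed
      qed
      then show "(\<lambda>j. norm (h \<sigma> k a j)) summable_on UNIV"
        by (simp add: summable_on_UNIV_nonneg_real_iff)
      then have "h \<sigma> k a summable_on UNIV"
        by (rule abs_summable_summable)
      then have "h \<sigma> k a sums infsum (h \<sigma> k a) UNIV"
        by (intro has_sum_imp_sums has_sum_infsum)
      moreover have "h \<sigma> k a sums \<alpha> m (k (inv \<sigma> a)) (T (\<beta> m (k a)))"
        unfolding h_def by (rule functional_sums[OF rep \<beta>[OF ka(1)] \<alpha>[OF ka(2)]])
      ultimately show "infsum (h \<sigma> k a) UNIV = \<alpha> m (k (inv \<sigma> a)) (T (\<beta> m (k a)))"
        by (rule sums_unique2)
    qed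
    have hprod: "((\<lambda>i. \<Prod>a<n. h \<sigma> k a (i a)) has_sum (\<Prod>a<n. \<alpha> m (k (inv \<sigma> a)) (T (\<beta> m (k a))))) ?S"
      if "\<sigma> permutes {..<n}" "k \<in> {..<n} \<rightarrow>\<^sub>E I m" for \<sigma> k
    proof -
      have "(\<lambda>i. \<Prod>a<n. norm (h \<sigma> k a (i a))) summable_on ?S"
        by (rule summable_on_prod_PiE_nat) (simp_all add: hsm[OF that])
      then have "(\<lambda>i. norm (\<Prod>a<n. h \<sigma> k a (i a))) summable_on ?S"
        by (simp only: prod_norm)
      then have "(\<lambda>i. \<Prod>a<n. h \<sigma> k a (i a)) summable_on ?S"
        by (rule abs_summable_summable)
      moreover have "infsum (\<lambda>i. \<Prod>a<n. h \<sigma> k a (i a)) ?S = (\<Prod>a<n. infsum (h \<sigma> k a) UNIV)"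
        by (rule infsum_prod_PiE_abs) (simp_all add: hs[OF that])
      ultimately show ?thesis
        using has_sum_infsum[of "\<lambda>i. \<Prod>a<n. h \<sigma> k a (i a)" ?S] by (simp add: hsum[OF that])
    qed
    have termeq: "tm (X m) i = (\<Sum>\<sigma> | \<sigma> permutes {..<n}. of_int (sign \<sigma>) * (\<Sum>k\<in>{..<n} \<rightarrow>\<^sub>E I m. \<Prod>a<n. h \<sigma> k a (i a)))" for i
      unfolding tm_def minor_def
    proof (subst sum_distrib_left, rule sum.cong)
      fix \<sigma> assume "\<sigma> \<in> {\<sigma>. \<sigma> permutes {..<n}}"
      then have \<sigma>: "\<sigma> permutes {..<n}" by simp
      have "(\<Prod>a<n. X m (i a) (i (\<sigma> a))) = (\<Sum>k\<in>{..<n} \<rightarrow>\<^sub>E I m. \<Prod>a<n. \<alpha> m (k a) (e (i (\<sigma> a))) * l (i a) (\<beta> m (k a)))"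
        unfolding X by (rule prod_sum_PiE) (use fin in auto)
      then have "(\<Prod>a<n. lam (i a)) * (\<Prod>a<n. X m (i a) (i (\<sigma> a))) = (\<Sum>k\<in>{..<n} \<rightarrow>\<^sub>E I m. \<Prod>a<n. h \<sigma> k a (i a))"
        using prod_inv_permutes[OF \<sigma>, of "\<lambda>q j. \<alpha> m q (e j)" _ i]
        by (simp add: sum_distrib_left h_def prod.distrib mult_ac)
      then show "(\<Prod>a<n. lam (i a)) * (of_int (sign \<sigma>) * (\<Prod>a<n. X m (i a) (i (\<sigma> a)))) =
          of_int (sign \<sigma>) * (\<Sum>k\<in>{..<n} \<rightarrow>\<^sub>E I m. \<Prod>a<n. h \<sigma> k a (i a))"
        by (simp add: mult_ac)
    qed auto
    have "(tm (X m) has_sum (\<Sum>\<sigma> | \<sigma> permutes {..<n}. of_int (sign \<sigma>) *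
     (\<Sum>k\<in>{..<n} \<rightarrow>\<^sub>E I m. \<Prod>a<n. \<alpha> m (k (inv \<sigma> a)) (T (\<beta> m (k a)))))) ?S"
      unfolding termeq by (intro has_sum_sum has_sum_cmult_right hprod) simp_all
    then show ?thesis
      unfolding approx_coeff_def by (simp add: infsumI)
  qed
  show ?thesis
    using lim unfolding eq .
qed

lemma fredholm_det_eq:
  assumes rep: "summable_rep (2/3) V N T lam l e"
  shows "fredholm_det V N T z = (\<Sum>n. (- z) ^ n * fredholm_coeff lam l e n)"
  unfolding fredholm_det_def
proof (rule the_equality)
  show "\<exists>lam' l' e'. summable_rep (2/3) V N T lam' l' e' \<and>
      (\<Sum>n. (- z) ^ n * fredholm_coeff lam l e n) = (\<Sum>n. (- z) ^ n * fredholm_coeff lam' l' e' n)"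
    using rep by blast
  fix d assume "\<exists>lam' l' e'. summable_rep (2/3) V N T lam' l' e' \<and>
      d = (\<Sum>n. (- z) ^ n * fredholm_coeff lam' l' e' n)"
  then obtain lam' l' e' where rep': "summable_rep (2/3) V N T lam' l' e'"
    and d: "d = (\<Sum>n. (- z) ^ n * fredholm_coeff lam' l' e' n)" by blast
  have "fredholm_coeff lam' l' e' n = fredholm_coeff lam l e n" for n
    \<comment> \<open>Both are limits of the same sequence \<open>approx_coeff T n\<close>, which
      does not see the representation.\<close>
    by (rule LIMSEQ_unique[OF fredholm_coeff_LIMSEQ[OF rep'] fredholm_coeff_LIMSEQ[OF rep]]) auto
  then show "d = (\<Sum>n. (- z) ^ n * fredholm_coeff lam l e n)"
    by (simp add: d)
qed

end

section \<open>Fejer means on annuli\<close>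

lemma annulus_eq_vimage: "annulus R = Im -` {-R<..<R}"
  by (auto simp: annulus_def)

lemma closed_annulus_eq_vimage: "closed_annulus R = Im -` {-R..R}"
  by (auto simp: closed_annulus_def)

lemma open_annulus: "open (annulus R)"
  unfolding annulus_eq_vimage by (intro open_vimage open_greaterThanLessThan continuous_intros)

lemma convex_annulus: "convex (annulus R)"
  unfolding annulus_eq_vimage
  by (intro convex_linear_vimage bounded_linear.linear bounded_linear_Im convex_real_interval)

lemma annulus_subset_closed_annulus: "annulus R \<subseteq> closed_annulus R"
  by (auto simp: annulus_def closed_annulus_def)

lemma closure_annulus:
  assumes "0 < R"
  shows "closed_annulus R \<subseteq> closure (annulus R)"
proof
  fix z assume z: "z \<in> closed_annulus R"
  have "(\<lambda>n. Complex (Re z) (Im z * (1 - 1 / real (Suc n)))) \<longlonglongrightarrow> Complex (Re z) (Im z * (1 - 0))"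
    by (intro tendsto_intros LIMSEQ_inverse_real_of_nat[unfolded inverse_eq_divide])
  moreover have "Complex (Re z) (Im z * (1 - 1 / real (Suc n))) \<in> annulus R" for n
  proof -
    have "\<bar>Im z\<bar> * (1 - 1 / real (Suc n)) \<le> R * (1 - 1 / real (Suc n))"
      using z by (intro mult_right_mono) (auto simp: closed_annulus_def)
    also have "\<dots> < R" using assms by (simp add: field_simps)
    finally show ?thesis by (simp add: annulus_def abs_mult)
  qed
  ultimately show "z \<in> closure (annulus R)"
    unfolding closure_sequential by (intro exI conjI allI) auto
qed

lemma periodic_of_int:
  fixes \<phi> :: "complex \<Rightarrow> 'b"
  assumes "\<And>z. \<phi> (z + 1) = \<phi> z"
  shows "\<phi> (z + of_int n) = \<phi> z"
proof (induction n arbitrary: z rule: int_induct[where k = 0])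
  case (step1 i)
  then show ?case using assms[of "z + of_int i"] by (simp add: algebra_simps)
next
  case (step2 i)
  then show ?case using assms[of "z + of_int (i - 1)"] by (simp add: algebra_simps)
qed auto

section \<open>Fourier modes\<close>

definition fourier_mode :: "int \<Rightarrow> complex \<Rightarrow> complex" where
  "fourier_mode k z = exp (2 * of_real pi * \<i> * of_int k * z)"

lemma fourier_mode_add: "fourier_mode k (z + w) = fourier_mode k z * fourier_mode k w"
  by (simp add: fourier_mode_def algebra_simps exp_add)

lemma fourier_mode_add_index: "fourier_mode (j + k) z = fourier_mode j z * fourier_mode k z"
  by (simp add: fourier_mode_def algebra_simps exp_add)

lemma fourier_mode_0 [simp]: "fourier_mode 0 z = 1" "fourier_mode k 0 = 1"
  by (simp_all add: fourier_mode_def)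

lemma fourier_mode_minus: "fourier_mode (- k) z = inverse (fourier_mode k z)"
  by (simp_all add: fourier_mode_def exp_minus)

lemma fourier_mode_of_int [simp]: "fourier_mode k (of_int n) = 1"
proof -
  have "fourier_mode k (of_int n) = exp ((2 * of_int (k * n) * of_real pi) * \<i>)"
    by (simp add: fourier_mode_def mult_ac)
  also have "\<dots> = 1"
    using exp_integer_2pi[of "of_int (k * n)"] by (simp only: Ints_of_int of_real_mult of_real_of_int_eq of_real_numeral True_implies_equals)
  finally show ?thesis .
qed

lemma fourier_mode_periodic: "fourier_mode k (z + 1) = fourier_mode k z"
  using fourier_mode_of_int[of k 1] by (simp add: fourier_mode_add del: fourier_mode_of_int)

lemma norm_fourier_mode: "norm (fourier_mode k z) = exp (- 2 * pi * of_int k * Im z)"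
  by (simp add: fourier_mode_def norm_exp)

lemma continuous_on_fourier_mode [continuous_intros]:
  "continuous_on A f \<Longrightarrow> continuous_on A (\<lambda>x. fourier_mode k (f x))"
  unfolding fourier_mode_def by (intro continuous_intros)

lemma holomorphic_on_fourier_mode [holomorphic_intros]:
  "f holomorphic_on A \<Longrightarrow> (\<lambda>x. fourier_mode k (f x)) holomorphic_on A"
  unfolding fourier_mode_def by (intro holomorphic_intros)

section \<open>The space A(C_R) and its norm\<close>

lemma hol_space_imp_le_norm:
  assumes "\<phi> \<in> hol_space R" "z \<in> closed_annulus R"
  shows "norm (\<phi> z) \<le> hol_norm R \<phi>"
proof -
  have "bdd_above ((\<lambda>z. norm (\<phi> z)) ` closed_annulus R)"
    using assms(1) unfolding hol_space_def bounded_iff by (fastforce intro: bdd_aboveI2)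
  then show ?thesis
    unfolding hol_norm_def using assms(2) by (rule cSUP_upper2) auto
qed

lemma hol_norm_le:
  assumes "0 < R" "\<And>z. z \<in> closed_annulus R \<Longrightarrow> norm (\<phi> z) \<le> c"
  shows "hol_norm R \<phi> \<le> c"
  unfolding hol_norm_def
proof (rule cSUP_least)
  have "0 \<in> closed_annulus R" using assms(1) by (simp add: closed_annulus_def)
  then show "closed_annulus R \<noteq> {}" by blast
qed (use assms in auto)

lemma hol_norm_nonneg:
  assumes "0 < R" "\<phi> \<in> hol_space R"
  shows "0 \<le> hol_norm R \<phi>"
proof -
  have "0 \<in> closed_annulus R" using assms(1) by (simp add: closed_annulus_def)
  then have "norm (\<phi> 0) \<le> hol_norm R \<phi>" by (rule hol_space_imp_le_norm[OF assms(2)])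
  then show ?thesis using norm_ge_zero order_trans by blast
qed

lemma hol_spaceI:
  assumes "\<And>z. \<phi> (z + 1) = \<phi> z" "continuous_on (closed_annulus R) \<phi>" "\<phi> holomorphic_on annulus R"
    "\<And>z. z \<in> closed_annulus R \<Longrightarrow> norm (\<phi> z) \<le> B" "\<And>z. z \<notin> closed_annulus R \<Longrightarrow> \<phi> z = 0"
  shows "\<phi> \<in> hol_space R"
  using assms unfolding hol_space_def bounded_iff by auto

lemma func_space_hol_space: "func_space (hol_space R)"
  unfolding func_space_def
proof (intro conjI ballI allI)
  show "(\<lambda>x. 0) \<in> hol_space R" by (rule hol_spaceI[where B = 0]) auto
next
  fix \<phi> \<psi> assume a: "\<phi> \<in> hol_space R" "\<psi> \<in> hol_space R"
  show "(\<lambda>x. \<phi> x + \<psi> x) \<in> hol_space R"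
  proof (rule hol_spaceI)
    fix z assume "z \<in> closed_annulus R"
    then show "norm (\<phi> z + \<psi> z) \<le> hol_norm R \<phi> + hol_norm R \<psi>"
      using a by (intro norm_triangle_mono hol_space_imp_le_norm)
  qed (use a in \<open>auto simp: hol_space_def intro!: continuous_intros holomorphic_intros\<close>)
next
  fix c \<phi> assume a: "\<phi> \<in> hol_space R"
  show "(\<lambda>x. c * \<phi> x) \<in> hol_space R"
  proof (rule hol_spaceI)
    fix z assume "z \<in> closed_annulus R"
    then show "norm (c * \<phi> z) \<le> norm c * hol_norm R \<phi>"
      unfolding norm_mult using a by (intro mult_left_mono hol_space_imp_le_norm) auto
  qed (use a in \<open>auto simp: hol_space_def intro!: continuous_intros holomorphic_intros\<close>)
qed

definition annulus_mode :: "real \<Rightarrow> int \<Rightarrow> complex \<Rightarrow> complex" where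
  "annulus_mode R k z = (if z \<in> closed_annulus R then fourier_mode k z else 0)"

lemma norm_fourier_mode_le:
  assumes "z \<in> closed_annulus R"
  shows "norm (fourier_mode k z) \<le> exp (2 * pi * \<bar>of_int k\<bar> * R)"
proof -
  have "- (of_int k * Im z) \<le> \<bar>of_int k\<bar> * \<bar>Im z\<bar>"
    by (metis abs_ge_minus_self abs_mult)
  also have "\<dots> \<le> \<bar>of_int k\<bar> * R"
    using assms by (intro mult_left_mono) (auto simp: closed_annulus_def)
  finally have "2 * pi * (- (of_int k * Im z)) \<le> 2 * pi * (\<bar>of_int k\<bar> * R)"
    by (rule mult_left_mono) simp
  then show ?thesis
    by (simp add: norm_fourier_mode mult.assoc)
qed

lemma annulus_mode_in_hol_space: "annulus_mode R k \<in> hol_space R"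
proof (rule hol_spaceI)
  show "annulus_mode R k (z + 1) = annulus_mode R k z" for z
    by (simp add: annulus_mode_def closed_annulus_def fourier_mode_periodic)
  have "continuous_on (closed_annulus R) (fourier_mode k)"
    by (intro continuous_intros)
  then show "continuous_on (closed_annulus R) (annulus_mode R k)"
    by (rule continuous_on_eq) (simp add: annulus_mode_def)
  have "fourier_mode k holomorphic_on annulus R"
    by (intro holomorphic_intros)
  then show "annulus_mode R k holomorphic_on annulus R"
    by (rule holomorphic_transform) (use annulus_subset_closed_annulus in \<open>auto simp: annulus_mode_def\<close>)
  show "norm (annulus_mode R k z) \<le> exp (2 * pi * \<bar>of_int k\<bar> * R)" if "z \<in> closed_annulus R" for z
    using that by (simp add: annulus_mode_def norm_fourier_mode_le)
qed (simp add: annulus_mode_def)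

text \<open>A primitive \<open>p\<close> exists on the convex strip, and
  \<open>p (w + 1) - p w\<close> has derivative zero by periodicity. The boundary lines, where
  \<open>h\<close> is merely continuous, are reached by closure.\<close>

lemma integral_periodic_const:
  assumes R: "0 < R" and hol: "h holomorphic_on annulus R"
    and cont: "continuous_on (closed_annulus R) h"
    and per: "\<And>z. h (z + 1) = h z" and z: "z \<in> closed_annulus R"
  shows "integral {0..1} (\<lambda>s. h (z + of_real s)) = integral {0..1} (\<lambda>s. h (of_real s))"
proof -
  define J where "J = (\<lambda>z. integral {0..1} (\<lambda>s. h (z + of_real s)))"
  obtain p where p: "\<And>x. x \<in> annulus R \<Longrightarrow> (p has_field_derivative h x) (at x)"
    using holomorphic_convex_primitive'[OF convex_annulus open_annulus hol] at_within_open[OF _ open_annulus]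
    by metis
  have shift: "w + of_real s \<in> annulus R" if "w \<in> annulus R" for w s
    using that by (simp add: annulus_def)
  have J: "J w = p (w + 1) - p w" if w: "w \<in> annulus R" for w
  proof -
    have "((\<lambda>s. h (w + of_real s)) has_integral (p (w + of_real 1) - p (w + of_real 0))) {0..1}"
    proof (rule fundamental_theorem_of_calculus)
      fix s :: real
      have "((\<lambda>s. w + of_real s) has_vector_derivative 1) (at s within {0..1})"
        by (auto intro!: derivative_eq_intros)
      from field_vector_diff_chain_within[OF this, of p "h (w + of_real s)"] p[OF shift[OF w, of s]]
      show "((\<lambda>s. p (w + of_real s)) has_vector_derivative h (w + of_real s)) (at s within {0..1})"
        by (simp add: o_def has_field_derivative_at_within)
    qed simp
    then show ?thesis unfolding J_def by (simp add: integral_unique)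
  qed
  have "\<exists>c. \<forall>w\<in>annulus R. p (w + 1) - p w = c"
  proof (rule has_field_derivative_zero_constant[OF convex_annulus])
    fix w assume w: "w \<in> annulus R"
    have "((\<lambda>w. p (w + 1)) has_field_derivative h (w + 1)) (at w)"
      using p[OF shift[OF w, of 1]] by (simp add: DERIV_shift)
    from DERIV_diff[OF this p[OF w]]
    show "((\<lambda>w. p (w + 1) - p w) has_field_derivative 0) (at w within annulus R)"
      by (simp add: per has_field_derivative_at_within)
  qed
  then obtain c where c: "\<And>w. w \<in> annulus R \<Longrightarrow> J w = c"
    using J by auto
  have "continuous_on (closed_annulus R \<times> cbox 0 1) (\<lambda>(w, s). h (w + of_real s))"
    unfolding case_prod_unfold
    by (rule continuous_on_compose2[OF cont]) (auto intro!: continuous_intros simp: closed_annulus_def)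
  then have "continuous_on (closed_annulus R) J"
    unfolding J_def cbox_interval[symmetric] by (rule integral_continuous_on_param)
  moreover have "closure (annulus R) = closed_annulus R"
  proof
    have "closed (closed_annulus R)"
      unfolding closed_annulus_eq_vimage by (intro closed_vimage continuous_intros closed_atLeastAtMost)
    then show "closure (annulus R) \<subseteq> closed_annulus R"
      by (rule closure_minimal[OF annulus_subset_closed_annulus])
  qed (rule closure_annulus[OF R])
  ultimately have "J z = c"
    using c z by (intro continuous_constant_on_closure[of "annulus R" J c z]) auto
  moreover have "J 0 = c" using R by (intro c) (simp add: annulus_def)
  ultimately show ?thesis by (simp add: J_def)
qed

definition fourier_coeff :: "(complex \<Rightarrow> complex) \<Rightarrow> int \<Rightarrow> complex" where
  "fourier_coeff \<phi> k = integral {0..1} (\<lambda>s. \<phi> (of_real s) * fourier_mode (- k) (of_real s))"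

lemma hol_space_continuous:
  assumes "\<phi> \<in> hol_space R" "continuous_on A f" "\<And>x. x \<in> A \<Longrightarrow> f x \<in> closed_annulus R"
  shows "continuous_on A (\<lambda>x. \<phi> (f x))"
  by (rule continuous_on_compose2[of "closed_annulus R" \<phi>]) (use assms in \<open>auto simp: hol_space_def\<close>)

lemma hol_space_periodic: "\<phi> \<in> hol_space R \<Longrightarrow> \<phi> (z + 1) = \<phi> z"
  by (simp add: hol_space_def)

text \<open>Integrating along the line through \<open>z\<close> instead of the real axis leaves only
  real translates of \<open>z\<close>, so that each term of the Fourier series, at complex
  \<open>z\<close> too, is a convolution over a real period.\<close>

lemma fourier_coeff_mult_mode:
  assumes R: "0 < R" and \<phi>: "\<phi> \<in> hol_space R" and z: "z \<in> closed_annulus R"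
  shows "fourier_coeff \<phi> k * fourier_mode k z = integral {0..1} (\<lambda>s. \<phi> (z + of_real s) * fourier_mode (- k) (of_real s))"
proof -
  have "fourier_coeff \<phi> k = integral {0..1} (\<lambda>s. \<phi> (z + of_real s) * fourier_mode (- k) (z + of_real s))"
    unfolding fourier_coeff_def
    by (rule integral_periodic_const[OF R _ _ _ z, symmetric])
      (use \<phi> in \<open>auto simp: hol_space_def fourier_mode_periodic intro!: continuous_intros holomorphic_intros\<close>)
  also have "\<dots> = integral {0..1} (\<lambda>s. fourier_mode (- k) z * (\<phi> (z + of_real s) * fourier_mode (- k) (of_real s)))"
    by (simp add: fourier_mode_add mult_ac)
  also have "\<dots> = fourier_mode (- k) z * integral {0..1} (\<lambda>s. \<phi> (z + of_real s) * fourier_mode (- k) (of_real s))"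
    by (rule integral_mult_right)
  finally show ?thesis
    by (simp add: fourier_mode_minus) (simp add: fourier_mode_def)
qed

section \<open>Orthogonality of the modes and the Fejer kernel\<close>

lemma integral_fourier_mode:
  "integral {0..1} (\<lambda>s. fourier_mode k (of_real s)) = (if k = 0 then 1 else 0)"
proof (cases "k = 0")
  case False
  let ?c = "2 * of_real pi * \<i> * of_int k :: complex"
  have c: "?c \<noteq> 0" using False by simp
  have "((\<lambda>s. fourier_mode k (of_real s)) has_integral (fourier_mode k (of_real 1) / ?c - fourier_mode k (of_real 0) / ?c)) {0..1}"
  proof (rule fundamental_theorem_of_calculus)
    fix s :: real
    have "((\<lambda>z. fourier_mode k z / ?c) has_field_derivative fourier_mode k (of_real s)) (at (of_real s))"
      unfolding fourier_mode_def using c by (auto intro!: derivative_eq_intros)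
    then show "((\<lambda>s. fourier_mode k (of_real s) / ?c) has_vector_derivative fourier_mode k (of_real s)) (at s within {0..1})"
      by (rule has_vector_derivative_real_field)
  qed simp
  then show ?thesis
    using False fourier_mode_of_int[of k 1] by (simp add: integral_unique del: fourier_mode_of_int)
qed simp

text \<open>The squared modulus makes positivity visible; multiplied out in
  \<open>fejer_kernel_sum\<close>, it is the Cesaro mean of the Dirichlet kernels.\<close>

definition fejer_kernel :: "nat \<Rightarrow> real \<Rightarrow> real" where
  "fejer_kernel m s = (norm (\<Sum>j\<le>m. fourier_mode (int j) (of_real s)))\<^sup>2 / real (Suc m)"

lemma fejer_kernel_nonneg: "0 \<le> fejer_kernel m s"
  by (simp add: fejer_kernel_def)

lemma continuous_on_fejer_kernel: "continuous_on A (fejer_kernel m)"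
  unfolding fejer_kernel_def by (intro continuous_intros) auto

lemma fejer_kernel_sum:
  "of_real (fejer_kernel m s) = (\<Sum>(j, k)\<in>{..m} \<times> {..m}. fourier_mode (- (int j - int k)) (of_real s)) / of_nat (Suc m)"
proof -
  let ?S = "\<Sum>j\<le>m. fourier_mode (int j) (of_real s)"
  have cnj: "cnj (fourier_mode (int j) (of_real s)) = fourier_mode (- int j) (of_real s)" for j
    by (simp add: fourier_mode_def exp_cnj)
  have "of_real ((norm ?S)\<^sup>2) = cnj ?S * ?S"
    by (simp add: complex_norm_square mult.commute del: of_real_power)
  also have "\<dots> = (\<Sum>j\<le>m. \<Sum>k\<le>m. fourier_mode (- int j) (of_real s) * fourier_mode (int k) (of_real s))"
    by (simp add: cnj sum_product)
  also have "\<dots> = (\<Sum>(j, k)\<in>{..m} \<times> {..m}. fourier_mode (- (int j - int k)) (of_real s))"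
    by (simp add: sum.cartesian_product fourier_mode_add_index[symmetric])
  finally show ?thesis
    by (simp add: fejer_kernel_def del: of_real_power)
qed

lemma integral_fejer_kernel: "(fejer_kernel m has_integral 1) {0..1}"
proof -
  have "integral {0..1} (\<lambda>s. of_real (fejer_kernel m s)) = (\<Sum>(j, k)\<in>{..m} \<times> {..m}. integral {0..1} (\<lambda>s. fourier_mode (- (int j - int k)) (of_real s))) / (of_nat (Suc m) :: complex)"
    unfolding fejer_kernel_sum case_prod_unfold
    by (subst integral_divide, subst integral_sum)
       (auto intro!: integrable_continuous_interval continuous_intros)
  also have "\<dots> = (\<Sum>j\<le>m. \<Sum>k\<le>m. if k = j then 1 else 0) / of_nat (Suc m)"
    unfolding integral_fourier_mode sum.cartesian_product
    by (intro arg_cong2[of _ _ _ _ "(/)"] sum.cong) auto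
  also have "\<dots> = 1"
    by (simp del: of_nat_Suc)
  finally have "integral {0..1} (\<lambda>s. of_real (fejer_kernel m s)) = (1 :: complex)" .
  moreover have i: "fejer_kernel m integrable_on {0..1}"
    by (intro integrable_continuous_interval continuous_on_fejer_kernel)
  ultimately have "integral {0..1} (fejer_kernel m) = 1"
    using integral_linear[OF i bounded_linear_of_real[where 'a = complex]] by (simp add: o_def)
  then show ?thesis
    using i by (simp add: has_integral_integrable_integral)
qed

text \<open>A geometric sum with ratio q on the unit circle has modulus at most 2 / |1 - q|, and by
  compactness |1 - q| stays away from 0 for s at distance \<delta> from the integers.\<close>

lemma fejer_kernel_concentrated:
  assumes "0 < \<delta>"
  obtains C where "\<And>m s. \<delta> \<le> s \<Longrightarrow> s \<le> 1 - \<delta> \<Longrightarrow> fejer_kernel m s \<le> C / real (Suc m)"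
proof (cases "\<delta> \<le> 1 - \<delta>")
  case False
  show thesis by (rule that[of 0]) (use False in linarith)
next
  case True
  have cont: "continuous_on {\<delta>..1 - \<delta>} (\<lambda>s. norm (1 - fourier_mode 1 (of_real s)))"
    by (intro continuous_intros)
  have "\<exists>x\<in>{\<delta>..1 - \<delta>}. \<forall>y\<in>{\<delta>..1 - \<delta>}. norm (1 - fourier_mode 1 (of_real x)) \<le> norm (1 - fourier_mode 1 (of_real y))"
    by (rule continuous_attains_inf) (use True cont in auto)
  then obtain s0 where s0: "s0 \<in> {\<delta>..1 - \<delta>}"
    and min: "\<And>s. s \<in> {\<delta>..1 - \<delta>} \<Longrightarrow> norm (1 - fourier_mode 1 (of_real s0)) \<le> norm (1 - fourier_mode 1 (of_real s))"
    by blast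
  define c where "c = norm (1 - fourier_mode 1 (of_real s0))"
  have ne1: "fourier_mode 1 (of_real s) \<noteq> 1" if s: "s \<in> {\<delta>..1 - \<delta>}" for s :: real
  proof
    assume "fourier_mode 1 (of_real s) = 1"
    then obtain n :: int where "2 * pi * s = of_int (2 * n) * pi"
      unfolding fourier_mode_def exp_eq_1 by auto
    then have "s = of_int n" by simp
    then have "0 < real_of_int n" "real_of_int n < 1" using s assms by auto
    then show False by simp
  qed
  then have c: "0 < c" using s0 by (simp add: c_def) 
  show thesis
  proof (rule that)
    fix m s assume "\<delta> \<le> s" "s \<le> 1 - \<delta>"
    then have s: "s \<in> {\<delta>..1 - \<delta>}" by simp
    let ?q = "fourier_mode 1 (of_real s)"
    have pow: "fourier_mode (int j) (of_real s) = ?q ^ j" for j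
      by (simp add: fourier_mode_def exp_of_nat_mult[symmetric] mult_ac)
    have nq: "norm ?q = 1" by (simp add: norm_fourier_mode)
    have "norm (\<Sum>j\<le>m. fourier_mode (int j) (of_real s)) = norm (1 - ?q ^ Suc m) / norm (1 - ?q)"
      unfolding pow sum_gp0 using ne1[OF s] by (simp add: norm_divide)
    also have "\<dots> \<le> 2 / c"
    proof (rule frac_le)
      show "norm (1 - ?q ^ Suc m) \<le> 2"
        using norm_triangle_ineq4[of 1 "?q ^ Suc m"] by (simp add: norm_power norm_mult nq)
      show "c \<le> norm (1 - ?q)" unfolding c_def by (rule min[OF s])
    qed (use c in auto)
    finally have "(norm (\<Sum>j\<le>m. fourier_mode (int j) (of_real s)))\<^sup>2 \<le> (2 / c)\<^sup>2"
      by (rule power_mono) simp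
    then show "fejer_kernel m s \<le> (2 / c)\<^sup>2 / real (Suc m)"
      unfolding fejer_kernel_def by (rule divide_right_mono) simp
  qed
qed

text \<open>Indexed by pairs (j, k): the frequency n = j - k is hit m + 1 - |n| times, so the Cesaro
  weights arise by counting.\<close>

definition fejer_functional :: "nat \<Rightarrow> nat \<times> nat \<Rightarrow> (complex \<Rightarrow> complex) \<Rightarrow> complex" where
  "fejer_functional m q \<phi> = fourier_coeff \<phi> (int (fst q) - int (snd q)) / of_nat (Suc m)"

definition fejer_mode :: "real \<Rightarrow> nat \<Rightarrow> nat \<times> nat \<Rightarrow> complex \<Rightarrow> complex" where
  "fejer_mode R m q = annulus_mode R (int (fst q) - int (snd q))"

abbreviation fejer_mean :: "real \<Rightarrow> nat \<Rightarrow> (complex \<Rightarrow> complex) \<Rightarrow> complex \<Rightarrow> complex" where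
  "fejer_mean R m \<phi> z \<equiv> \<Sum>q\<in>{..m} \<times> {..m}. fejer_functional m q \<phi> * fejer_mode R m q z"

lemma fejer_sum:
  assumes R: "0 < R" and \<phi>: "\<phi> \<in> hol_space R" and z: "z \<in> closed_annulus R"
  shows "fejer_mean R m \<phi> z
     = integral {0..1} (\<lambda>s. \<phi> (z + of_real s) * of_real (fejer_kernel m s))"
proof -
  define k where "k = (\<lambda>q :: nat \<times> nat. int (fst q) - int (snd q))"
  have "fejer_mean R m \<phi> z =
     (\<Sum>q\<in>{..m} \<times> {..m}. integral {0..1} (\<lambda>s. \<phi> (z + of_real s) * (fourier_mode (- k q) (of_real s) / of_nat (Suc m))))"
  proof (rule sum.cong)
    fix q :: "nat \<times> nat"
    have "fejer_functional m q \<phi> * fejer_mode R m q z =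
        fourier_coeff \<phi> (k q) * fourier_mode (k q) z / of_nat (Suc m)"
      using z by (simp add: fejer_functional_def fejer_mode_def annulus_mode_def k_def)
    also have "\<dots> = integral {0..1} (\<lambda>s. \<phi> (z + of_real s) * fourier_mode (- k q) (of_real s) / of_nat (Suc m))"
      unfolding fourier_coeff_mult_mode[OF R \<phi> z] by (rule integral_divide[symmetric])
    finally show "fejer_functional m q \<phi> * fejer_mode R m q z = integral {0..1} (\<lambda>s. \<phi> (z + of_real s) * (fourier_mode (- k q) (of_real s) / of_nat (Suc m)))"
      by simp
  qed simp
  also have "\<dots> = integral {0..1} (\<lambda>s. \<Sum>q\<in>{..m} \<times> {..m}. \<phi> (z + of_real s) * (fourier_mode (- k q) (of_real s) / of_nat (Suc m)))"
    by (rule integral_sum[symmetric])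
      (auto intro!: integrable_continuous_interval continuous_intros hol_space_continuous[OF \<phi>] z simp: closed_annulus_def simp del: of_nat_Suc,
        use z in \<open>auto simp: closed_annulus_def\<close>)
  finally show ?thesis
    by (simp only: k_def fejer_kernel_sum case_prod_unfold sum_distrib_left sum_divide_distrib)
qed

text \<open>Uniformity over the unbounded strip: an integer translation moves \<open>z\<close> into
  one period, and the rectangle with margin 1 on either side is compact.\<close>

lemma hol_space_translation_continuous:
  assumes R: "0 < R" and \<phi>: "\<phi> \<in> hol_space R" and e: "0 < e"
  obtains \<delta> where "0 < \<delta>" "\<And>z s. z \<in> closed_annulus R \<Longrightarrow> \<bar>s\<bar> < \<delta> \<Longrightarrow> norm (\<phi> (z + of_real s) - \<phi> z) < e"
proof -
  let ?K = "cbox (Complex (- 1) (- R)) (Complex 2 R)"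
  have "continuous_on ?K \<phi>"
    using \<phi> by (rule hol_space_continuous) (auto intro!: continuous_intros simp: in_cbox_complex_iff closed_annulus_def)
  then have "uniformly_continuous_on ?K \<phi>"
    by (rule compact_uniformly_continuous) simp
  then obtain d where d: "0 < d" "\<And>x y. x \<in> ?K \<Longrightarrow> y \<in> ?K \<Longrightarrow> dist y x < d \<Longrightarrow> dist (\<phi> y) (\<phi> x) < e"
    using e unfolding uniformly_continuous_on_def by blast
  show thesis
  proof (rule that[of "min d 1"])
    fix z :: complex and s :: real assume z: "z \<in> closed_annulus R" and s: "\<bar>s\<bar> < min d 1"
    define w where "w = z + of_int (- \<lfloor>Re z\<rfloor>)"
    have per: "\<phi> w = \<phi> z" "\<phi> (w + of_real s) = \<phi> (z + of_real s)"
      using periodic_of_int[of \<phi> z "- \<lfloor>Re z\<rfloor>"] periodic_of_int[of \<phi> "z + of_real s" "- \<lfloor>Re z\<rfloor>"] hol_space_periodic[OF \<phi>]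
      by (simp_all add: w_def algebra_simps)
    have "0 \<le> Re w" "Re w < 1" by (simp_all add: w_def) linarith+
    moreover have "Im w = Im z" by (simp add: w_def)
    ultimately have "w \<in> ?K" "w + of_real s \<in> ?K"
      using z s by (auto simp: in_cbox_complex_iff closed_annulus_def)
    then have "dist (\<phi> (w + of_real s)) (\<phi> w) < e"
      using s by (intro d(2)) (auto simp: dist_norm)
    then show "norm (\<phi> (z + of_real s) - \<phi> z) < e"
      by (simp add: per dist_norm)
  qed (use d in auto)
qed

lemma fejer_integrable:
  assumes \<phi>: "\<phi> \<in> hol_space R" and z: "z \<in> closed_annulus R"
  shows "(\<lambda>s. \<phi> (z + of_real s) * of_real (fejer_kernel m s)) integrable_on {0..1}"
proof (rule integrable_continuous_interval)
  have "continuous_on {0..1} (\<lambda>s. \<phi> (z + of_real s))"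
    using \<phi> by (rule hol_space_continuous) (use z in \<open>auto intro!: continuous_intros simp: closed_annulus_def\<close>)
  then show "continuous_on {0..1} (\<lambda>s. \<phi> (z + of_real s) * of_real (fejer_kernel m s))"
    by (intro continuous_intros continuous_on_fejer_kernel)
qed

text \<open>Convolution along horizontal lines with a nonnegative kernel of mass 1 does not increase
  the supremum.\<close>

lemma fejer_norm_le:
  assumes R: "0 < R" and \<phi>: "\<phi> \<in> hol_space R"
  shows "hol_norm R (fejer_mean R m \<phi>) \<le> hol_norm R \<phi>"
proof (rule hol_norm_le[OF R])
  fix z assume z: "z \<in> closed_annulus R"
  have "norm (integral {0..1} (\<lambda>s. \<phi> (z + of_real s) * of_real (fejer_kernel m s))) \<le> integral {0..1} (\<lambda>s. hol_norm R \<phi> * fejer_kernel m s)"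
  proof (rule integral_norm_bound_integral[OF fejer_integrable[OF \<phi> z]])
    show "(\<lambda>s. hol_norm R \<phi> * fejer_kernel m s) integrable_on {0..1}"
      by (intro integrable_continuous_interval continuous_intros continuous_on_fejer_kernel)
    fix s :: real
    have "norm (\<phi> (z + of_real s)) \<le> hol_norm R \<phi>"
      by (rule hol_space_imp_le_norm[OF \<phi>]) (use z in \<open>simp add: closed_annulus_def\<close>)
    then show "norm (\<phi> (z + of_real s) * of_real (fejer_kernel m s)) \<le> hol_norm R \<phi> * fejer_kernel m s"
      by (simp add: norm_mult fejer_kernel_nonneg mult_right_mono)
  qed
  also have "\<dots> = hol_norm R \<phi>"
    using integral_fejer_kernel[of m] by (simp add: integral_unique)
  finally show "norm (fejer_mean R m \<phi> z) \<le> hol_norm R \<phi>"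
    unfolding fejer_sum[OF R \<phi> z] .
qed

lemma fejer_LIMSEQ:
  assumes R: "0 < R" and \<phi>: "\<phi> \<in> hol_space R"
  shows "(\<lambda>m. hol_norm R (\<lambda>z. fejer_mean R m \<phi> z - \<phi> z)) \<longlonglongrightarrow> 0"
    (is "?N \<longlonglongrightarrow> 0")
proof -
  have N0: "0 \<le> ?N m" for m
  proof -
    have "(\<lambda>z. fejer_mean R m \<phi> z - \<phi> z) \<in> hol_space R"
      by (intro func_space_diff[OF func_space_hol_space] func_space_sum[OF func_space_hol_space] \<phi>)
        (simp add: fejer_mode_def annulus_mode_in_hol_space)
    then show ?thesis by (rule hol_norm_nonneg[OF R])
  qed
  show ?thesis
  proof (rule LIMSEQ_I)
    fix e :: real assume e: "0 < e"
    obtain \<delta> where \<delta>: "0 < \<delta>" "\<And>z s. z \<in> closed_annulus R \<Longrightarrow> \<bar>s\<bar> < \<delta> \<Longrightarrow> norm (\<phi> (z + of_real s) - \<phi> z) < e / 2"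
      using hol_space_translation_continuous[OF R \<phi>, of "e / 2"] e by (metis half_gt_zero)
    obtain C where C: "\<And>m s. \<delta> \<le> s \<Longrightarrow> s \<le> 1 - \<delta> \<Longrightarrow> fejer_kernel m s \<le> C / real (Suc m)"
      using fejer_kernel_concentrated[OF \<delta>(1)] by metis
    \<comment> \<open>\<open>2 * hol_norm R \<phi>\<close> bounds the difference of \<phi> at two
      points; it is used where the kernel is at most of order 1 / (m + 1).\<close>
    define C' where "C' = 2 * hol_norm R \<phi> * \<bar>C\<bar>"
    have \<phi>0: "0 \<le> hol_norm R \<phi>" by (rule hol_norm_nonneg[OF R \<phi>])
    have C'0: "0 \<le> C'" using \<phi>0 by (simp add: C'_def)
    have le: "?N m \<le> e / 2 + C' / real (Suc m)" for m
    proof (rule hol_norm_le[OF R])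
      fix z assume z: "z \<in> closed_annulus R"
      have zs: "z + of_real s \<in> closed_annulus R" for s using z by (simp add: closed_annulus_def)
      have "((\<lambda>s. \<phi> z * of_real (fejer_kernel m s)) has_integral \<phi> z * of_real 1) {0..1}"
        by (intro has_integral_mult_right has_integral_of_real integral_fejer_kernel)
      then have "((\<lambda>s. \<phi> (z + of_real s) * of_real (fejer_kernel m s) - \<phi> z * of_real (fejer_kernel m s)) has_integral
          integral {0..1} (\<lambda>s. \<phi> (z + of_real s) * of_real (fejer_kernel m s)) - \<phi> z * of_real 1) {0..1}"
        by (intro has_integral_diff integrable_integral fejer_integrable[OF \<phi> z])
      then have hi: "((\<lambda>s. (\<phi> (z + of_real s) - \<phi> z) * of_real (fejer_kernel m s)) has_integral
          fejer_mean R m \<phi> z - \<phi> z) {0..1}"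
        by (simp only: fejer_sum[OF R \<phi> z] left_diff_distrib of_real_1 mult_1_right)
      have hi2: "((\<lambda>s. e / 2 * fejer_kernel m s + C' / real (Suc m)) has_integral (e / 2 * 1 + C' / real (Suc m))) {0..1}"
        using has_integral_const_real[of "C' / real (Suc m)" 0 1]
        by (intro has_integral_add has_integral_mult_right integral_fejer_kernel) simp
      have "norm (integral {0..1} (\<lambda>s. (\<phi> (z + of_real s) - \<phi> z) * of_real (fejer_kernel m s)))
         \<le> integral {0..1} (\<lambda>s. e / 2 * fejer_kernel m s + C' / real (Suc m))"
      proof (rule integral_norm_bound_integral)
        fix s :: real assume s: "s \<in> {0..1}"
        have k0: "0 \<le> fejer_kernel m s" by (rule fejer_kernel_nonneg)
        have ek: "0 \<le> e / 2 * fejer_kernel m s" using e k0 by simp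
        have Cm: "0 \<le> C' / real (Suc m)" using C'0 by simp
        have "norm (\<phi> (z + of_real s) - \<phi> z) * fejer_kernel m s \<le> e / 2 * fejer_kernel m s + C' / real (Suc m)"
        proof (cases "\<delta> \<le> s \<and> s \<le> 1 - \<delta>")
          case True
          have "fejer_kernel m s \<le> \<bar>C\<bar> / real (Suc m)"
            using C[of s m] True by (meson abs_ge_self divide_right_mono of_nat_0_le_iff order_trans)
          moreover have "norm (\<phi> (z + of_real s) - \<phi> z) \<le> 2 * hol_norm R \<phi>"
            using norm_triangle_ineq4[of "\<phi> (z + of_real s)" "\<phi> z"] hol_space_imp_le_norm[OF \<phi> z] hol_space_imp_le_norm[OF \<phi> zs[of s]]
            by linarith
          ultimately have "norm (\<phi> (z + of_real s) - \<phi> z) * fejer_kernel m s \<le> 2 * hol_norm R \<phi> * (\<bar>C\<bar> / real (Suc m))"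
            using k0 \<phi>0 by (intro mult_mono) auto
          then show ?thesis using ek by (simp add: C'_def)
        next
          case False
          have "norm (\<phi> (z + of_real s) - \<phi> z) \<le> e / 2"
          proof (cases "s < \<delta>")
            case True
            then show ?thesis using \<delta>(2)[OF z, of s] s by auto
          next
            case False
            \<comment> \<open>Near the right end s is close to the integer 1, and periodicity allows
              s - 1 in its place.\<close>
            then have "norm (\<phi> (z + of_real (s - 1)) - \<phi> z) < e / 2"
              using \<open>\<not> (\<delta> \<le> s \<and> s \<le> 1 - \<delta>)\<close> s by (intro \<delta>(2)[OF z]) auto
            then show ?thesis
              using hol_space_periodic[OF \<phi>, of "z + of_real (s - 1)"] by (simp add: algebra_simps)
          qed
          then have "norm (\<phi> (z + of_real s) - \<phi> z) * fejer_kernel m s \<le> e / 2 * fejer_kernel m s"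
            using k0 by (rule mult_right_mono)
          then show ?thesis using Cm by linarith
        qed
        then show "norm ((\<phi> (z + of_real s) - \<phi> z) * of_real (fejer_kernel m s)) \<le> e / 2 * fejer_kernel m s + C' / real (Suc m)"
          by (simp add: norm_mult abs_of_nonneg[OF k0])
      qed (use hi hi2 in \<open>auto simp: has_integral_integrable_integral\<close>)
      then show "norm (fejer_mean R m \<phi> z - \<phi> z) \<le> e / 2 + C' / real (Suc m)"
        using hi hi2 by (simp add: has_integral_integrable_integral)
    qed
    obtain M where M: "2 * C' / e < real M" using reals_Archimedean2 by blast
    show "\<exists>no. \<forall>m\<ge>no. norm (?N m - 0) < e"
    proof (intro exI allI impI)
      fix m assume "M \<le> m"
      then have "2 * C' / e < real (Suc m)" using M by simp
      then have "C' / real (Suc m) < e / 2" using e by (simp add: field_simps)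
      then have "?N m < e" using le[of m] by linarith
      then show "norm (?N m - 0) < e" using N0[of m] by simp
    qed
  qed
qed

lemma approximation_hol_space:
  assumes R: "0 < R"
  shows "approximation (hol_space R) (hol_norm R) (\<lambda>m. {..m} \<times> {..m}) fejer_functional (fejer_mode R) (\<lambda>_. 1) 1"
proof
  show "func_space (hol_space R)" by (rule func_space_hol_space)
  show "0 \<le> hol_norm R \<phi>" if "\<phi> \<in> hol_space R" for \<phi>
    by (rule hol_norm_nonneg[OF R that])
  show "fejer_mode R m q \<in> hol_space R" for m q
    by (simp add: fejer_mode_def annulus_mode_in_hol_space)
  show "bounded_functional (hol_space R) (hol_norm R) 1 (fejer_functional m q)" for m q
    unfolding bounded_functional_def
  proof (intro conjI ballI allI)
    define k where "k = - (int (fst q) - int (snd q))"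
    have int: "(\<lambda>s. \<phi> (of_real s) * fourier_mode k (of_real s)) integrable_on {0..1}" if "\<phi> \<in> hol_space R" for \<phi>
      using R by (intro integrable_continuous_interval continuous_intros hol_space_continuous[OF that]) (auto simp: closed_annulus_def)
    show "fejer_functional m q (\<lambda>x. \<phi> x + \<psi> x) = fejer_functional m q \<phi> + fejer_functional m q \<psi>"
      if "\<phi> \<in> hol_space R" "\<psi> \<in> hol_space R" for \<phi> \<psi>
      unfolding fejer_functional_def fourier_coeff_def k_def[symmetric]
      using int[OF that(1)] int[OF that(2)] by (simp add: distrib_right integral_add add_divide_distrib)
    show "fejer_functional m q (\<lambda>x. c * \<phi> x) = c * fejer_functional m q \<phi>" for c \<phi>
      unfolding fejer_functional_def fourier_coeff_def k_def[symmetric] by (simp add: mult.assoc)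
    fix \<phi> assume \<phi>: "\<phi> \<in> hol_space R"
    have "norm (integral {0..1} (\<lambda>s. \<phi> (of_real s) * fourier_mode k (of_real s))) \<le> integral {0..1} (\<lambda>s::real. hol_norm R \<phi>)"
    proof (rule integral_norm_bound_integral[OF int[OF \<phi>]])
      fix s :: real
      have "norm (\<phi> (of_real s)) \<le> hol_norm R \<phi>"
        using R by (intro hol_space_imp_le_norm[OF \<phi>]) (simp add: closed_annulus_def)
      then show "norm (\<phi> (of_real s) * fourier_mode k (of_real s)) \<le> hol_norm R \<phi>"
        by (simp add: norm_mult norm_fourier_mode)
    qed auto
    then have "norm (fourier_coeff \<phi> (int (fst q) - int (snd q))) \<le> hol_norm R \<phi>"
      unfolding fourier_coeff_def k_def[symmetric] by simp
    moreover have "norm (fourier_coeff \<phi> (int (fst q) - int (snd q))) / real (Suc m) \<le> norm (fourier_coeff \<phi> (int (fst q) - int (snd q))) / 1"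
      by (rule divide_left_mono) auto
    ultimately show "norm (fejer_functional m q \<phi>) \<le> 1 * hol_norm R \<phi>"
      by (simp add: fejer_functional_def norm_divide del: of_nat_Suc)
  qed
qed (use fejer_norm_le[OF R] fejer_LIMSEQ[OF R] in auto)

section \<open>Sums over preimages\<close>

lemma fourier_mode_1_eq_1_iff: "fourier_mode 1 w = 1 \<longleftrightarrow> w \<in> \<int>"
proof
  assume "fourier_mode 1 w = 1"
  then obtain n :: int where n: "Re (2 * of_real pi * \<i> * w) = 0" "Im (2 * of_real pi * \<i> * w) = of_int (2 * n) * pi"
    unfolding fourier_mode_def exp_eq_1 by auto
  then have "w = of_int n"
    by (intro complex_eqI) simp_all
  then show "w \<in> \<int>" by simp
next
  assume "w \<in> \<int>"
  then obtain n where "w = of_int n" by (rule Ints_cases)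
  then show "fourier_mode 1 w = 1" by simp
qed

lemma has_field_derivative_fourier_mode:
  "(fourier_mode k has_field_derivative 2 * of_real pi * \<i> * of_int k * fourier_mode k z) (at z)"
  unfolding fourier_mode_def by (auto intro!: derivative_eq_intros)

lemma integral_periodic_shift:
  fixes g :: "real \<Rightarrow> complex"
  assumes a: "0 \<le> a" "a \<le> 1" and cont: "continuous_on UNIV g" and per: "\<And>s. g (s + 1) = g s"
  shows "integral {0..1} (\<lambda>s. g (s + a)) = integral {0..1} g"
proof -
  have i: "g integrable_on {u..v}" for u v
    by (rule integrable_continuous_interval[OF continuous_on_subset[OF cont]]) auto
  have sh: "integral {u..v} (\<lambda>s. g (s + c)) = integral {u + c..v + c} g" for u v c
    using integral_shift[OF continuous_on_subset[OF cont], of u c v] by (simp add: o_def)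
  have "integral {0..1} (\<lambda>s. g (s + a)) = integral {a..1 + a} g"
    using sh[of 0 1 a] by simp
  also have "\<dots> = integral {a..1} g + integral {1..1 + a} g"
    using a by (intro Henstock_Kurzweil_Integration.integral_combine[symmetric] i) auto
  also have "integral {1..1 + a} g = integral {0..a} g"
    using sh[of 0 a 1] by (simp add: per add.commute)
  also have "integral {a..1} g + integral {0..a} g = integral {0..1} g"
    using a Henstock_Kurzweil_Integration.integral_combine[of 0 a 1 g] i by (simp add: add.commute)
  finally show ?thesis .
qed

lemma contour_integral_periodic_rectpath:
  assumes \<rho>: "0 < \<rho>" and cont: "continuous_on (path_image (rectpath (Complex a (- \<rho>)) (Complex (a + 1) \<rho>))) f"
    and per: "\<And>y. \<bar>y\<bar> \<le> \<rho> \<Longrightarrow> f (Complex (a + 1) y) = f (Complex a y)"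
  shows "contour_integral (rectpath (Complex a (- \<rho>)) (Complex (a + 1) \<rho>)) f =
     integral {0..1} (\<lambda>s. f (Complex (s + a) (- \<rho>))) - integral {0..1} (\<lambda>s. f (Complex (s + a) \<rho>))"
proof -
  define a1 a2 a3 a4 where a: "a1 = Complex a (- \<rho>)" "a2 = Complex (a + 1) (- \<rho>)" "a3 = Complex (a + 1) \<rho>" "a4 = Complex a \<rho>"
  have rp: "rectpath a1 a3 = linepath a1 a2 +++ linepath a2 a3 +++ linepath a3 a4 +++ linepath a4 a1"
    by (simp add: rectpath_def Let_def a)
  have pi: "path_image (rectpath a1 a3) = closed_segment a1 a2 \<union> closed_segment a2 a3 \<union> closed_segment a3 a4 \<union> closed_segment a4 a1"
    unfolding rp by (simp add: path_image_join Un_assoc)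
  have int: "f contour_integrable_on linepath a1 a2" "f contour_integrable_on linepath a2 a3"
     "f contour_integrable_on linepath a3 a4" "f contour_integrable_on linepath a4 a1"
    using cont unfolding a(1,3)[symmetric] pi
    by (auto intro!: contour_integrable_continuous_linepath elim!: continuous_on_subset)
  have "contour_integral (rectpath a1 a3) f = contour_integral (linepath a1 a2) f + contour_integral (linepath a2 a3) f
      + contour_integral (linepath a3 a4) f + contour_integral (linepath a4 a1) f"
    unfolding rp using int by (simp add: contour_integrable_joinI)
  also have "contour_integral (linepath a1 a2) f = integral {0..1} (\<lambda>s. f (Complex (s + a) (- \<rho>)))"
  proof -
    have "linepath a1 a2 s = Complex (s + a) (- \<rho>)" for s
      by (simp add: a linepath_def complex_eq_iff algebra_simps)
    moreover have "a2 - a1 = 1" by (simp add: a complex_eq_iff)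
    ultimately show ?thesis by (simp add: contour_integral_integral)
  qed
  also have "contour_integral (linepath a3 a4) f = - integral {0..1} (\<lambda>s. f (Complex (s + a) \<rho>))"
  proof -
    have "linepath a4 a3 s = Complex (s + a) \<rho>" for s
      by (simp add: a linepath_def complex_eq_iff algebra_simps)
    moreover have "a3 - a4 = 1" by (simp add: a complex_eq_iff)
    ultimately have "contour_integral (linepath a4 a3) f = integral {0..1} (\<lambda>s. f (Complex (s + a) \<rho>))"
      by (simp add: contour_integral_integral)
    then show ?thesis
      using contour_integral_reversepath[of "linepath a4 a3" f] by simp
  qed
  also have "contour_integral (linepath a4 a1) f = - contour_integral (linepath a1 a4) f"
    using contour_integral_reversepath[of "linepath a1 a4" f] by simp
  also have "contour_integral (linepath a1 a4) f = contour_integral (linepath a2 a3) f"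
  proof -
    have l: "linepath a1 a4 s = Complex a ((2 * s - 1) * \<rho>)" "linepath a2 a3 s = Complex (a + 1) ((2 * s - 1) * \<rho>)" for s
      by (simp_all add: a linepath_def complex_eq_iff algebra_simps)
    have "a4 - a1 = a3 - a2" by (simp add: a complex_eq_iff)
    moreover have "f (Complex (a + 1) ((2 * s - 1) * \<rho>)) = f (Complex a ((2 * s - 1) * \<rho>))" if "s \<in> {0..1}" for s
    proof (rule per)
      have "\<bar>2 * s - 1\<bar> * \<rho> \<le> 1 * \<rho>" using that \<rho> by (intro mult_right_mono) auto
      then show "\<bar>(2 * s - 1) * \<rho>\<bar> \<le> \<rho>" using \<rho> by (simp add: abs_mult)
    qed
    ultimately show ?thesis
      unfolding contour_integral_integral by (intro integral_cong) (simp add: l)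
  qed
  finally show ?thesis by (simp add: a)
qed

lemma residue_simple_zero_quotient:
  assumes S: "open S" "p \<in> S" and \<phi>: "\<phi> holomorphic_on S" and h: "h holomorphic_on S"
    and ne: "\<And>x. x \<in> S \<Longrightarrow> x \<noteq> p \<Longrightarrow> h x \<noteq> 0" and h0: "h p = 0"
    and h': "(h has_field_derivative h') (at p)" "h' \<noteq> 0"
  shows "residue (\<lambda>x. \<phi> x / h x) p = \<phi> p / h'"
proof (rule residue_simple'[OF S])
  show "(\<lambda>x. \<phi> x / h x) holomorphic_on S - {p}"
    using ne by (intro holomorphic_intros holomorphic_on_subset[OF \<phi>] holomorphic_on_subset[OF h]) auto
  have "((\<lambda>x. (h x - h p) / (x - p)) \<longlongrightarrow> h') (at p)"
    using h'(1) by (simp add: has_field_derivative_iff)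
  moreover have "(\<phi> \<longlongrightarrow> \<phi> p) (at p)"
    using \<phi> S by (metis at_within_open continuous_on_def holomorphic_on_imp_continuous_on)
  ultimately have "((\<lambda>x. \<phi> x / ((h x - h p) / (x - p))) \<longlongrightarrow> \<phi> p / h') (at p)"
    using h'(2) by (intro tendsto_divide)
  then show "((\<lambda>x. \<phi> x / h x * (x - p)) \<longlongrightarrow> \<phi> p / h') (at p)"
    by (simp add: h0)
qed

lemma geometric_integral_sums:
  fixes \<phi> w :: "real \<Rightarrow> complex"
  assumes \<phi>: "continuous_on {0..1} \<phi>" and w: "continuous_on {0..1} w"
    and q: "q < 1" "\<And>s. s \<in> {0..1} \<Longrightarrow> norm (w s) \<le> q"
  shows "(\<lambda>n. integral {0..1} (\<lambda>s. \<phi> s * w s ^ n)) sums integral {0..1} (\<lambda>s. \<phi> s / (1 - w s))"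
proof -
  have "0 \<le> q" using order_trans[OF norm_ge_zero q(2)[of 0]] by simp
  have "compact (\<phi> ` {0..1})" using \<phi> by (rule compact_continuous_image) simp
  then have "bounded (\<phi> ` {0..1})" by (rule compact_imp_bounded)
  then obtain B where B: "\<And>s. s \<in> {0..1} \<Longrightarrow> norm (\<phi> s) \<le> B"
    unfolding bounded_iff by blast
  have u: "uniform_limit {0..1} (\<lambda>n s. \<Sum>k<n. \<phi> s * w s ^ k) (\<lambda>s. \<Sum>k. \<phi> s * w s ^ k) sequentially"
  proof (rule Weierstrass_m_test)
    show "norm (\<phi> s * w s ^ n) \<le> B * q ^ n" if "s \<in> {0..1}" for n s
      unfolding norm_mult norm_power
      by (rule mult_mono[OF B[OF that] power_mono[OF q(2)[OF that] norm_ge_zero]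
            order_trans[OF norm_ge_zero B[OF that]] zero_le_power[OF norm_ge_zero]])
    show "summable (\<lambda>n. B * q ^ n)"
      using q(1) \<open>0 \<le> q\<close> by (intro summable_mult summable_geometric) simp
  qed
  have c: "continuous_on {0..1} (\<lambda>s. \<Sum>k<n. \<phi> s * w s ^ k)" for n
    by (intro continuous_intros \<phi> w)
  obtain I J where IJ: "\<And>n. ((\<lambda>s. \<Sum>k<n. \<phi> s * w s ^ k) has_integral I n) {0..1}"
      "((\<lambda>s. \<Sum>k. \<phi> s * w s ^ k) has_integral J) {0..1}" "I \<longlonglongrightarrow> J"
  proof (rule uniform_limit_integral[OF u c sequentially_bot])
    fix I J
    assume "\<And>n. ((\<lambda>s. \<Sum>k<n. \<phi> s * w s ^ k) has_integral I n) {0..1}"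
      "((\<lambda>s. \<Sum>k. \<phi> s * w s ^ k) has_integral J) {0..1}" "I \<longlonglongrightarrow> J"
    then show thesis by (rule that)
  qed
  have Ieq: "I n = (\<Sum>k<n. integral {0..1} (\<lambda>s. \<phi> s * w s ^ k))" for n
  proof -
    have "I n = integral {0..1} (\<lambda>s. \<Sum>k<n. \<phi> s * w s ^ k)"
      using IJ(1)[of n] by (simp add: integral_unique)
    then show ?thesis
      by (subst (asm) integral_sum) (auto intro!: integrable_continuous_interval continuous_intros \<phi> w)
  qed
  have Jeq: "J = integral {0..1} (\<lambda>s. \<phi> s / (1 - w s))"
  proof -
    have "J = integral {0..1} (\<lambda>s. \<Sum>k. \<phi> s * w s ^ k)"
      using IJ(2) by (simp add: integral_unique)
    also have "\<dots> = integral {0..1} (\<lambda>s. \<phi> s / (1 - w s))"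
    proof (rule integral_cong)
      fix s :: real assume "s \<in> {0..1}"
      then have "norm (w s) < 1" by (rule le_less_trans[OF q(2) q(1)])
      then have "(\<lambda>k. \<phi> s * w s ^ k) sums (\<phi> s * (1 / (1 - w s)))"
        by (intro sums_mult geometric_sums)
      then show "(\<Sum>k. \<phi> s * w s ^ k) = \<phi> s / (1 - w s)"
        by (simp add: sums_iff)
    qed
    finally show ?thesis .
  qed
  have "I = (\<lambda>n. \<Sum>k<n. integral {0..1} (\<lambda>s. \<phi> s * w s ^ k))" using Ieq by (rule ext)
  then show ?thesis
    using IJ(3) unfolding sums_def Jeq by (simp only:)
qed

lemma sums_interleave:
  fixes f g :: "nat \<Rightarrow> complex"
  assumes "g sums x" and "f sums y"
  shows "(\<lambda>n. if even n then f (n div 2) else g ((n - 1) div 2)) sums (x + y)"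
proof -
  have "(\<lambda>n. if even n then Re (f (n div 2)) else Re (g ((n - 1) div 2))) sums (Re x + Re y)"
    "(\<lambda>n. if even n then Im (f (n div 2)) else Im (g ((n - 1) div 2))) sums (Im x + Im y)"
    using assms unfolding sums_complex_iff by (auto intro: sums_if)
  then show ?thesis
    unfolding sums_complex_iff by (simp add: if_distrib[of Re] if_distrib[of Im] cong: if_cong)
qed

text \<open>The frequencies \<open>0, -1, -2, \<dots>\<close> (even indices) are read off the upper line,
  the frequencies \<open>1, 2, \<dots>\<close> (odd indices) off the lower one: these are the lines on
  which the respective exponentials of \<open>F\<close> are small.\<close>

definition mode_freq :: "nat \<Rightarrow> int" where
  "mode_freq i = (if even i then - int (i div 2) else int (i div 2) + 1)"

definition mode_line :: "real \<Rightarrow> nat \<Rightarrow> real \<Rightarrow> complex" where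
  "mode_line \<rho> i s = Complex s (if even i then \<rho> else - \<rho>)"

locale annulus_map =
  fixes F :: "complex \<Rightarrow> complex" and d :: int and r :: real
  assumes holo: "F holomorphic_on annulus r"
    and shift: "\<And>x. x \<in> annulus r \<Longrightarrow> F (x + 1) = F x + of_int d"
    and deriv_nz: "\<And>x. x \<in> annulus r \<Longrightarrow> deriv F x \<noteq> 0"
begin

lemma deriv_shift:
  assumes x: "x \<in> annulus r"
  shows "deriv F (x + 1) = deriv F x"
proof -
  have "((\<lambda>x. F (x + 1)) has_field_derivative deriv F x) (at x)"
  proof (rule has_field_derivative_transform_within_open[OF _ open_annulus x])
    have "(F has_field_derivative deriv F x) (at x)"
      by (rule holomorphic_derivI[OF holo open_annulus x])
    then show "((\<lambda>x. F x + of_int d) has_field_derivative deriv F x) (at x)"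
      by (auto intro!: derivative_eq_intros)
  qed (simp add: shift)
  then have "(F has_field_derivative deriv F x) (at (x + 1))"
    by (simp add: DERIV_shift)
  then show ?thesis by (rule DERIV_imp_deriv)
qed

text \<open>The residue of \<open>\<phi> / (E - 1)\<close>, with \<open>E x = exp (2 \<pi> \<i> (F x - z))\<close>, at a preimage
  \<open>x\<close> of \<open>z\<close> is \<open>\<phi> x / (2 \<pi> \<i> F' x)\<close>, and over a period rectangle the vertical sides cancel.\<close>

lemma preimages_sum_eq_integrals:
  assumes \<rho>: "0 < \<rho>" "\<rho> < r" and \<phi>: "\<phi> holomorphic_on annulus r"
    and \<phi>_per: "\<And>x. x \<in> annulus r \<Longrightarrow> \<phi> (x + 1) = \<phi> x"
    and top: "\<And>s. Im z < Im (F (Complex s \<rho>))" and bot: "\<And>s. Im (F (Complex s (- \<rho>))) < Im z"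
  shows "(\<Sum>x\<in>preimages F \<rho> z. \<phi> x / deriv F x) =
       integral {0..1} (\<lambda>s. \<phi> (Complex s (- \<rho>)) / (fourier_mode 1 (F (Complex s (- \<rho>)) - z) - 1))
     - integral {0..1} (\<lambda>s. \<phi> (Complex s \<rho>) / (fourier_mode 1 (F (Complex s \<rho>) - z) - 1))"
    (is "?lhs = ?rhs")
proof -
  define E where "E = (\<lambda>x. fourier_mode 1 (F x - z))"
  define h where "h = (\<lambda>x. E x - 1)"
  have h_holo: "h holomorphic_on annulus r"
    unfolding h_def E_def by (intro holomorphic_intros holo)
  have E_per: "E (x + 1) = E x" if "x \<in> annulus r" for x
  proof -
    have "F (x + 1) - z = (F x - z) + of_int d" using shift[OF that] by simp
    then show ?thesis unfolding E_def by (simp only: fourier_mode_add fourier_mode_of_int mult_1_right)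
  qed
  have h0_iff: "h x = 0 \<longleftrightarrow> F x - z \<in> \<int>" for x
    by (simp add: h_def E_def fourier_mode_1_eq_1_iff)
  have E_top: "norm (E (Complex s \<rho>)) < 1" for s
    using top[of s] by (simp add: E_def norm_fourier_mode)
  have E_bot: "1 < norm (E (Complex s (- \<rho>)))" for s
    using bot[of s] by (simp add: E_def norm_fourier_mode mult_less_0_iff)
  have h_line: "h (Complex s \<rho>) \<noteq> 0" "h (Complex s (- \<rho>)) \<noteq> 0" for s
    using E_top[of s] E_bot[of s] by (auto simp: h_def)
  have in_ann: "Complex s y \<in> annulus r" if "\<bar>y\<bar> \<le> \<rho>" for s y
    using that \<rho> by (simp add: annulus_def)
  \<comment> \<open>The compact rectangle \<open>K\<close> inside the strip has room around every
    period rectangle from \<open>a\<close> to \<open>a + 1\<close> with 0 < a < 1; compactness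
    leaves finitely many zeros of \<open>h\<close> in it.\<close>
  define r2 where "r2 = (\<rho> + r) / 2"
  have r2: "\<rho> < r2" "r2 < r" using \<rho> by (simp_all add: r2_def)
  define K where "K = cbox (Complex (- 1) (- r2)) (Complex 3 r2)"
  have K_sub: "K \<subseteq> annulus r" using r2 by (auto simp: K_def in_cbox_complex_iff annulus_def)
  define Z where "Z = {x \<in> K. h x = 0}"
  have finZ: "finite Z"
    unfolding Z_def
  proof (rule holomorphic_compact_finite_zeros[OF h_holo open_annulus])
    show "connected (annulus r)" by (intro convex_connected convex_annulus)
    \<comment> \<open>|E| < 1 on the upper line and |E| > 1 on the lower one.\<close>
    show "\<not> h constant_on annulus r"
    proof
      assume "h constant_on annulus r"
      then have "h (Complex 0 \<rho>) = h (Complex 0 (- \<rho>))"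
        using in_ann[of \<rho> 0] in_ann[of "- \<rho>" 0] \<rho> unfolding constant_on_def by auto
      then show False using E_top[of 0] E_bot[of 0] by (simp add: h_def)
    qed
  qed (use K_sub in \<open>auto simp: K_def\<close>)
  have pre: "preimages F \<rho> z = {x \<in> annulus \<rho>. 0 \<le> Re x \<and> Re x < 1 \<and> h x = 0}"
    by (simp add: preimages_def h0_iff)
  \<comment> \<open>Finitely many zeros leave an abscissa \<open>a\<close> whose vertical line
    misses all of them; the vertical sides of the contour are placed there and at
    \<open>a + 1\<close>.\<close>
  have "infinite ({0<..<1} - Re ` Z)" using finZ by (simp add: infinite_Ioo Diff_infinite_finite)
  then obtain a where "a \<in> {0<..<1} - Re ` Z" by (metis ex_in_conv infinite_imp_nonempty)
  then have a: "0 < a" "a < 1" and aZ: "\<And>x. x \<in> Z \<Longrightarrow> Re x \<noteq> a" by auto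
  have hper: "h (x + 1) = h x" if "x \<in> annulus r" for x using E_per[OF that] by (simp add: h_def)
  have h_a: "h (Complex a y) \<noteq> 0" if "\<bar>y\<bar> \<le> \<rho>" for y
    using aZ[of "Complex a y"] that a r2 by (auto simp: Z_def K_def in_cbox_complex_iff abs_le_iff)
  have Ca1: "Complex (a + 1) y = Complex a y + 1" for y by (simp add: complex_eq_iff)
  have h_a1: "h (Complex (a + 1) y) \<noteq> 0" if "\<bar>y\<bar> \<le> \<rho>" for y
    using h_a[OF that] hper[OF in_ann[OF that, of a]] by (simp add: Ca1)
  define a1 a3 where "a1 = Complex a (- \<rho>)" and "a3 = Complex (a + 1) \<rho>"
  define S where "S = box (Complex (- 1) (- r2)) (Complex 3 r2)"
  define f where "f = (\<lambda>x. \<phi> x / h x)"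
  have SK: "S \<subseteq> K" unfolding S_def K_def by (rule box_subset_cbox)
  have S_ann: "S \<subseteq> annulus r" using SK K_sub by blast
  define P where "P = Z \<inter> S"
  have f_holo: "f holomorphic_on S - P"
    unfolding f_def using SK
    by (intro holomorphic_intros holomorphic_on_subset[OF \<phi>] holomorphic_on_subset[OF h_holo])
      (use S_ann in \<open>auto simp: P_def Z_def\<close>)
  have rect: "Re a1 \<le> Re a3" "Im a1 \<le> Im a3" using \<rho> by (auto simp: a1_def a3_def)
  have pimg: "path_image (rectpath a1 a3) \<subseteq> S - P"
  proof
    fix x assume "x \<in> path_image (rectpath a1 a3)"
    then have x: "(Re x \<in> {a, a + 1} \<and> Im x \<in> {- \<rho>..\<rho>}) \<or> (Im x \<in> {- \<rho>, \<rho>} \<and> Re x \<in> {a..a + 1})"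
      unfolding path_image_rectpath[OF rect] by (auto simp: a1_def a3_def)
    have xc: "x = Complex (Re x) (Im x)" by simp
    have "h x \<noteq> 0"
      using x h_a[of "Im x"] h_a1[of "Im x"] h_line[of "Re x"] xc
      by (metis abs_le_iff atLeastAtMost_iff insert_iff minus_le_iff singletonD)
    moreover have "x \<in> S"
      using x a r2 \<rho> by (auto simp: S_def in_box_complex_iff)
    ultimately show "x \<in> S - P" by (simp add: P_def Z_def)
  qed
  have rectS: "cbox a1 a3 \<subseteq> S"
    using a r2 \<rho> by (auto simp: a1_def a3_def S_def in_cbox_complex_iff in_box_complex_iff)
  have "contour_integral (rectpath a1 a3) f = 2 * pi * \<i> * (\<Sum>p\<in>P. winding_number (rectpath a1 a3) p * residue f p)"
  proof (rule Residue_theorem[OF _ _ _ f_holo])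
    show "open S" "connected S" unfolding S_def by (auto intro: convex_connected convex_box)
    show "finite P" using finZ by (simp add: P_def)
    show "\<forall>z. z \<notin> S \<longrightarrow> winding_number (rectpath a1 a3) z = 0"
      using rectS winding_number_rectpath_outside[OF rect] by blast
  qed (use pimg in auto)
  also have "(\<Sum>p\<in>P. winding_number (rectpath a1 a3) p * residue f p) = (\<Sum>p\<in>P \<inter> box a1 a3. residue f p)"
  proof (rule sum.mono_neutral_cong_right)
    show "\<forall>p\<in>P - P \<inter> box a1 a3. winding_number (rectpath a1 a3) p * residue f p = 0"
    proof
      fix p assume p: "p \<in> P - P \<inter> box a1 a3"
      then have "p \<notin> path_image (rectpath a1 a3)" using pimg by blast
      then have "p \<notin> cbox a1 a3"
        using p path_image_rectpath_cbox_minus_box[OF rect] by blast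
      then show "winding_number (rectpath a1 a3) p * residue f p = 0"
        using winding_number_rectpath_outside[OF rect] by simp
    qed
  qed (use finZ winding_number_rectpath in \<open>auto simp: P_def\<close>)
  also have "(\<Sum>p\<in>P \<inter> box a1 a3. residue f p) = (\<Sum>p\<in>P \<inter> box a1 a3. \<phi> p / (2 * pi * \<i> * deriv F p))"
  proof (rule sum.cong)
    fix p assume p: "p \<in> P \<inter> box a1 a3"
    have pS: "p \<in> S" "h p = 0" using p by (auto simp: P_def Z_def)
    define T where "T = S - (P - {p})"
    have "open T" unfolding T_def using finZ by (intro open_Diff finite_imp_closed) (auto simp: S_def P_def)
    moreover have "p \<in> T" using p by (simp add: T_def P_def)
    moreover have TS: "T \<subseteq> annulus r" using S_ann by (auto simp: T_def)
    moreover have "(h has_field_derivative 2 * pi * \<i> * deriv F p) (at p)"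
    proof -
      have F': "(F has_field_derivative deriv F p) (at p)"
        by (rule holomorphic_derivI[OF holo open_annulus]) (use pS S_ann in auto)
      have E1: "exp (2 * of_real pi * \<i> * (F p - z)) = 1"
        using pS(2) by (simp add: h_def E_def fourier_mode_def)
      show ?thesis
        unfolding h_def E_def fourier_mode_def
        by (rule derivative_eq_intros F' refl)+ (use E1 in simp)
    qed
    moreover have "deriv F p \<noteq> 0" using deriv_nz pS S_ann by blast
    ultimately show "residue f p = \<phi> p / (2 * pi * \<i> * deriv F p)"
      unfolding f_def using pS SK
      by (intro residue_simple_zero_quotient[of T] holomorphic_on_subset[OF \<phi>] holomorphic_on_subset[OF h_holo])
         (auto simp: T_def P_def Z_def)
  qed simp
  also have "2 * pi * \<i> * (\<Sum>p\<in>P \<inter> box a1 a3. \<phi> p / (2 * pi * \<i> * deriv F p)) = (\<Sum>p\<in>P \<inter> box a1 a3. \<phi> p / deriv F p)"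
    by (simp add: sum_distrib_left)
  also have "\<dots> = (\<Sum>x\<in>preimages F \<rho> z. \<phi> x / deriv F x)"
  proof -
    have Pb: "P \<inter> box a1 a3 = {x \<in> annulus \<rho>. a < Re x \<and> Re x < a + 1 \<and> h x = 0}"
      using a r2 by (auto simp: P_def Z_def S_def K_def a1_def a3_def in_box_complex_iff in_cbox_complex_iff annulus_def)
    have sub: "annulus \<rho> \<subseteq> annulus r" using \<rho> by (auto simp: annulus_def)
    have hper': "h (x - 1) = h x" if "x \<in> annulus \<rho>" for x
      using hper[of "x - 1"] that sub by (auto simp: annulus_def)
    show ?thesis
    \<comment> \<open>The residues lie over (a, a + 1), the representatives in
      \<open>preimages\<close> over [0, 1); translation by 1 matches the two, as \<phi> and F' are
      periodic.\<close>
    proof (rule sum.reindex_bij_witness[where i = "\<lambda>x. if Re x < a then x + 1 else x" and j = "\<lambda>x. if Re x < 1 then x else x - 1"])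
      fix x assume "x \<in> P \<inter> box a1 a3"
      then have x: "x \<in> annulus \<rho>" "a < Re x" "Re x < a + 1" "h x = 0" by (auto simp: Pb)
      show "(if Re x < 1 then x else x - 1) \<in> preimages F \<rho> z"
        using x a hper'[OF x(1)] by (auto simp: pre annulus_def)
      show "(if Re (if Re x < 1 then x else x - 1) < a then (if Re x < 1 then x else x - 1) + 1 else if Re x < 1 then x else x - 1) = x"
        using x a by auto
      have "x - 1 \<in> annulus r" using x sub by (auto simp: annulus_def)
      then show "\<phi> (if Re x < 1 then x else x - 1) / deriv F (if Re x < 1 then x else x - 1) = \<phi> x / deriv F x"
        using \<phi>_per[of "x - 1"] deriv_shift[of "x - 1"] by auto
    next
      fix x assume "x \<in> preimages F \<rho> z"
      then have x: "x \<in> annulus \<rho>" "0 \<le> Re x" "Re x < 1" "h x = 0" by (auto simp: pre)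
      have "x \<in> Z" using x r2 by (auto simp: Z_def K_def in_cbox_complex_iff annulus_def)
      then have "Re x \<noteq> a" by (rule aZ)
      then show "(if Re x < a then x + 1 else x) \<in> P \<inter> box a1 a3"
        using x a hper[of x] sub by (auto simp: Pb annulus_def)
      show "(if Re (if Re x < a then x + 1 else x) < 1 then (if Re x < a then x + 1 else x) else (if Re x < a then x + 1 else x) - 1) = x"
        using x a by auto
    qed
  qed
  finally have main: "contour_integral (rectpath a1 a3) f = (\<Sum>x\<in>preimages F \<rho> z. \<phi> x / deriv F x)" .
  have f_per: "f (x + 1) = f x" if "x \<in> annulus r" for x
    using hper[OF that] \<phi>_per[OF that] by (simp add: f_def)
  have contour: "contour_integral (rectpath a1 a3) f = integral {0..1} (\<lambda>s. f (Complex (s + a) (- \<rho>))) - integral {0..1} (\<lambda>s. f (Complex (s + a) \<rho>))"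
    unfolding a1_def a3_def
  proof (rule contour_integral_periodic_rectpath[OF \<rho>(1)])
    show "continuous_on (path_image (rectpath (Complex a (- \<rho>)) (Complex (a + 1) \<rho>))) f"
      using holomorphic_on_imp_continuous_on[OF f_holo] pimg unfolding a1_def a3_def
      by (rule continuous_on_subset)
    show "f (Complex (a + 1) y) = f (Complex a y)" if "\<bar>y\<bar> \<le> \<rho>" for y
      unfolding Ca1 by (rule f_per[OF in_ann[OF that]])
  qed
  have shift_a: "integral {0..1} (\<lambda>s. f (Complex (s + a) y)) = integral {0..1} (\<lambda>s. f (Complex s y))"
    if y: "y = \<rho> \<or> y = - \<rho>" for y
  proof (rule integral_periodic_shift[of a "\<lambda>s. f (Complex s y)"])
    have yr: "\<bar>y\<bar> \<le> \<rho>" using y \<rho> by auto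
    have cc: "continuous_on UNIV (\<lambda>s. Complex s y)"
      unfolding Complex_eq by (intro continuous_intros)
    have c1: "continuous_on UNIV (\<lambda>s. \<phi> (Complex s y))"
      by (rule continuous_on_compose2[OF holomorphic_on_imp_continuous_on[OF \<phi>] cc]) (use in_ann[OF yr] in auto)
    have c2: "continuous_on UNIV (\<lambda>s. h (Complex s y))"
      by (rule continuous_on_compose2[OF holomorphic_on_imp_continuous_on[OF h_holo] cc]) (use in_ann[OF yr] in auto)
    show "continuous_on UNIV (\<lambda>s. f (Complex s y))"
      unfolding f_def using y h_line by (intro continuous_on_divide c1 c2) auto
    show "f (Complex (s + 1) y) = f (Complex s y)" for s
      using f_per[OF in_ann[OF yr, of s]] by (simp add: Complex_eq algebra_simps)
  qed (use a in auto)
  show "?lhs = ?rhs"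
    using contour unfolding main shift_a[OF disjI1[OF refl]] shift_a[OF disjI2[OF refl]]
    by (simp add: f_def h_def E_def)
qed

text \<open>On the upper line |E| < 1 and 1 / (1 - E) is expanded in powers of E, on the lower one
  |E| > 1 and 1 / (E - 1) in powers of 1 / E. Since E is a mode of F x times a mode of z, this gives
  a Fourier series in z with coefficients free of z; the margin \<delta> supplies the common ratio
  \<open>exp (- 2 * pi * \<delta>)\<close>.\<close>

lemma preimages_sum_sums:
  assumes \<rho>: "0 < \<rho>" "\<rho> < r" and \<phi>: "\<phi> holomorphic_on annulus r"
    and \<phi>_per: "\<And>x. x \<in> annulus r \<Longrightarrow> \<phi> (x + 1) = \<phi> x"
    and \<delta>: "0 < \<delta>" and top: "\<And>s. Im z + \<delta> \<le> Im (F (Complex s \<rho>))"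
    and bot: "\<And>s. Im (F (Complex s (- \<rho>))) \<le> Im z - \<delta>"
  shows "(\<lambda>i. fourier_mode (mode_freq i) z * integral {0..1} (\<lambda>s. \<phi> (mode_line \<rho> i s) * fourier_mode (- mode_freq i) (F (mode_line \<rho> i s))))
     sums (\<Sum>x\<in>preimages F \<rho> z. \<phi> x / deriv F x)"
proof -
  define E where "E = (\<lambda>x. fourier_mode 1 (F x - z))"
  define q where "q = exp (- 2 * pi * \<delta>)"
  have q: "q < 1" using \<delta> by (simp add: q_def)
  have cc: "continuous_on {0..1} (\<lambda>s. Complex s y)" for y
    unfolding Complex_eq by (intro continuous_intros)
  have in_ann: "Complex s y \<in> annulus r" if "y = \<rho> \<or> y = - \<rho>" for s y
    using that \<rho> by (auto simp: annulus_def)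
  have c\<phi>: "continuous_on {0..1} (\<lambda>s. \<phi> (Complex s y))" if "y = \<rho> \<or> y = - \<rho>" for y
    by (rule continuous_on_compose2[OF holomorphic_on_imp_continuous_on[OF \<phi>] cc]) (use in_ann[OF that] in auto)
  have cE: "continuous_on {0..1} (\<lambda>s. E (Complex s y))" if "y = \<rho> \<or> y = - \<rho>" for y
    unfolding E_def
    by (intro continuous_intros continuous_on_compose2[OF holomorphic_on_imp_continuous_on[OF holo] cc]) (use in_ann[OF that] in auto)
  have E_ne: "E x \<noteq> 0" for x by (simp add: E_def fourier_mode_def)
  have E_top: "norm (E (Complex s \<rho>)) \<le> q" for s
  proof -
    have "2 * pi * \<delta> \<le> 2 * pi * (Im (F (Complex s \<rho>)) - Im z)"
      using top[of s] by (intro mult_left_mono) auto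
    then show ?thesis by (simp add: E_def norm_fourier_mode q_def)
  qed
  have E_exp: "E x = exp (2 * of_real pi * \<i> * (F x - z))" for x
    by (simp add: E_def fourier_mode_def)
  have pow: "E x ^ n = fourier_mode (int n) (F x) * fourier_mode (- int n) z" for x n
    unfolding E_exp fourier_mode_def exp_of_nat_mult[symmetric] exp_add[symmetric]
    by (rule arg_cong[of _ _ exp]) (simp add: algebra_simps)
  have E_inv: "1 / E x = exp (- (2 * of_real pi * \<i> * (F x - z)))" for x
    unfolding E_exp exp_minus inverse_eq_divide ..
  have E_bot: "norm (1 / E (Complex s (- \<rho>))) \<le> q" for s
  proof -
    have "2 * pi * \<delta> \<le> 2 * pi * (Im z - Im (F (Complex s (- \<rho>))))"
      using bot[of s] by (intro mult_left_mono) auto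
    then show ?thesis
      unfolding E_inv norm_exp_eq_Re q_def by (simp add: algebra_simps)
  qed
  have pow': "(1 / E x) ^ Suc n = fourier_mode (- (int n + 1)) (F x) * fourier_mode (int n + 1) z" for x n
    unfolding E_inv fourier_mode_def exp_of_nat_mult[symmetric] exp_add[symmetric]
    by (rule arg_cong[of _ _ exp]) (simp add: algebra_simps)
  let ?It = "integral {0..1} (\<lambda>s. \<phi> (Complex s \<rho>) / (1 - E (Complex s \<rho>)))"
  let ?Ib = "integral {0..1} (\<lambda>s. \<phi> (Complex s (- \<rho>)) / (E (Complex s (- \<rho>)) - 1))"
  have "(\<lambda>n. integral {0..1} (\<lambda>s. \<phi> (Complex s \<rho>) * E (Complex s \<rho>) ^ n)) sums ?It"
    by (rule geometric_integral_sums[OF c\<phi> cE q]) (use E_top in auto)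
  then have st: "(\<lambda>n. fourier_mode (- int n) z * integral {0..1} (\<lambda>s. \<phi> (Complex s \<rho>) * fourier_mode (int n) (F (Complex s \<rho>)))) sums ?It"
    by (simp add: pow integral_mult_right[symmetric] mult_ac)
  have "(\<lambda>n. integral {0..1} (\<lambda>s. (\<phi> (Complex s (- \<rho>)) * (1 / E (Complex s (- \<rho>)))) * (1 / E (Complex s (- \<rho>))) ^ n)) sums
       integral {0..1} (\<lambda>s. (\<phi> (Complex s (- \<rho>)) * (1 / E (Complex s (- \<rho>)))) / (1 - 1 / E (Complex s (- \<rho>))))"
    by (rule geometric_integral_sums[OF _ _ q]) (use E_bot in \<open>auto intro!: continuous_on_mult continuous_on_divide continuous_on_const c\<phi> cE simp: E_ne\<close>)
  moreover have "(\<phi> x * (1 / E x)) / (1 - 1 / E x) = \<phi> x / (E x - 1)" for x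
    using E_ne[of x] by (cases "E x = 1") (simp_all add: field_simps)
  moreover have "(\<phi> x * (1 / E x)) * (1 / E x) ^ n = fourier_mode (int n + 1) z * (\<phi> x * fourier_mode (- (int n + 1)) (F x))" for x n
  proof -
    have "(\<phi> x * (1 / E x)) * (1 / E x) ^ n = \<phi> x * (1 / E x) ^ Suc n" by simp
    then show ?thesis unfolding pow' by (simp only: mult_ac)
  qed
  ultimately have sb: "(\<lambda>n. fourier_mode (int n + 1) z * integral {0..1} (\<lambda>s. \<phi> (Complex s (- \<rho>)) * fourier_mode (- (int n + 1)) (F (Complex s (- \<rho>))))) sums ?Ib"
    by (simp only: integral_mult_right)
  have "(\<Sum>x\<in>preimages F \<rho> z. \<phi> x / deriv F x) = ?Ib - integral {0..1} (\<lambda>s. \<phi> (Complex s \<rho>) / (E (Complex s \<rho>) - 1))"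
    unfolding E_def
  proof (rule preimages_sum_eq_integrals[OF \<rho> \<phi> \<phi>_per])
    show "Im z < Im (F (Complex s \<rho>))" "Im (F (Complex s (- \<rho>))) < Im z" for s
      using top[of s] bot[of s] \<delta> by linarith+
  qed
  \<comment> \<open>The upper integral enters with a minus sign, which turns E - 1 into 1 -
    E.\<close>
  also have "integral {0..1} (\<lambda>s. \<phi> (Complex s \<rho>) / (E (Complex s \<rho>) - 1)) = - ?It"
    unfolding integral_neg[symmetric] by (intro integral_cong) (metis minus_diff_eq minus_divide_right)
  finally have eq: "(\<Sum>x\<in>preimages F \<rho> z. \<phi> x / deriv F x) = ?Ib + ?It" by simp
  have "(if even i then fourier_mode (- int (i div 2)) z * integral {0..1} (\<lambda>s. \<phi> (Complex s \<rho>) * fourier_mode (int (i div 2)) (F (Complex s \<rho>)))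
      else fourier_mode (int ((i - 1) div 2) + 1) z * integral {0..1} (\<lambda>s. \<phi> (Complex s (- \<rho>)) * fourier_mode (- (int ((i - 1) div 2) + 1)) (F (Complex s (- \<rho>)))))
    = fourier_mode (mode_freq i) z * integral {0..1} (\<lambda>s. \<phi> (mode_line \<rho> i s) * fourier_mode (- mode_freq i) (F (mode_line \<rho> i s)))" for i
  proof (cases "even i")
    case False
    then have "(i - 1) div 2 = i div 2" by (auto elim!: oddE)
    then show ?thesis using False by (simp add: mode_freq_def mode_line_def)
  qed (simp add: mode_freq_def mode_line_def)
  then show ?thesis
    using sums_interleave[OF sb st] unfolding eq by (simp only:)
qed

text \<open>With weight F' every preimage counts 1. The coefficients become integrals of derivatives
  of periodic functions and vanish, except at frequency 0, where the increment of F over a period is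
  left.\<close>

lemma card_preimages:
  assumes \<rho>: "0 < \<rho>" "\<rho> < r" and \<delta>: "0 < \<delta>" and top: "\<And>s. Im z + \<delta> \<le> Im (F (Complex s \<rho>))"
    and bot: "\<And>s. Im (F (Complex s (- \<rho>))) \<le> Im z - \<delta>"
  shows "int (card (preimages F \<rho> z)) = d"
proof -
  have d_holo: "deriv F holomorphic_on annulus r"
    by (rule holomorphic_deriv[OF holo open_annulus])
  let ?I = "\<lambda>i. integral {0..1} (\<lambda>s. deriv F (mode_line \<rho> i s) * fourier_mode (- mode_freq i) (F (mode_line \<rho> i s)))"
  have s1: "(\<lambda>i. fourier_mode (mode_freq i) z * ?I i) sums (\<Sum>x\<in>preimages F \<rho> z. deriv F x / deriv F x)"
    by (rule preimages_sum_sums[where \<phi> = "deriv F" and z = z and \<delta> = \<delta> and \<rho> = \<rho>, OF \<rho> d_holo deriv_shift \<delta> top bot])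
  have I: "?I i = (if i = 0 then of_int d else 0)" for i
  proof -
    define y where "y = (if even i then \<rho> else - \<rho>)"
    have L: "mode_line \<rho> i s = Complex s y" for s by (simp add: mode_line_def y_def)
    have ann: "Complex s y \<in> annulus r" for s using \<rho> by (auto simp: annulus_def y_def)
    have C1: "Complex 1 y = Complex 0 y + 1" by (simp add: complex_eq_iff)
    have line: "((\<lambda>s. Complex s y) has_vector_derivative 1) (at s within {0..1})" for s
      unfolding Complex_eq by (auto intro!: derivative_eq_intros)
    have Fd: "(F has_field_derivative deriv F (Complex s y)) (at (Complex s y))" for s
      by (rule holomorphic_derivI[OF holo open_annulus ann])
    show ?thesis
    proof (cases "i = 0")
      case True
      have "((\<lambda>s. deriv F (Complex s y)) has_integral (F (Complex 1 y) - F (Complex 0 y))) {0..1}"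
      proof (rule fundamental_theorem_of_calculus)
        fix s :: real
        show "((\<lambda>s. F (Complex s y)) has_vector_derivative deriv F (Complex s y)) (at s within {0..1})"
          using field_vector_diff_chain_within[OF line, of F] Fd[of s] by (simp add: o_def has_field_derivative_at_within)
      qed simp
      then show ?thesis
        using shift[OF ann, of 0] unfolding L C1 by (simp add: True mode_freq_def integral_unique)
    next
      case False
      define k where "k = - mode_freq i"
      \<comment> \<open>Frequency 0 belongs to the index 0 alone.\<close>
      have "i div 2 \<noteq> 0" if "even i" using that False by presburger
      then have k: "k \<noteq> 0" by (cases "even i") (simp_all add: k_def mode_freq_def)
      let ?c = "2 * of_real pi * \<i> * of_int k :: complex"
      have c: "?c \<noteq> 0" using k by simp
      have "((\<lambda>s. deriv F (Complex s y) * fourier_mode k (F (Complex s y))) has_integral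
        (fourier_mode k (F (Complex 1 y)) / ?c - fourier_mode k (F (Complex 0 y)) / ?c)) {0..1}"
      proof (rule fundamental_theorem_of_calculus)
        fix s :: real
        have "((\<lambda>x. fourier_mode k (F x) / ?c) has_field_derivative
            ?c * fourier_mode k (F (Complex s y)) * deriv F (Complex s y) / ?c) (at (Complex s y))"
          by (intro DERIV_cdivide DERIV_chain2[OF has_field_derivative_fourier_mode Fd])
        then have "((\<lambda>x. fourier_mode k (F x) / ?c) has_field_derivative deriv F (Complex s y) * fourier_mode k (F (Complex s y))) (at (Complex s y))"
          using c by (simp add: mult.commute)
        then show "((\<lambda>s. fourier_mode k (F (Complex s y)) / ?c) has_vector_derivative
            deriv F (Complex s y) * fourier_mode k (F (Complex s y))) (at s within {0..1})"
          using field_vector_diff_chain_within[OF line, of "\<lambda>x. fourier_mode k (F x) / ?c"]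
          by (simp add: o_def has_field_derivative_at_within)
      qed simp
      moreover have "fourier_mode k (F (Complex 1 y)) = fourier_mode k (F (Complex 0 y))"
        unfolding C1 shift[OF ann] by (simp add: fourier_mode_add)
      ultimately show ?thesis
        using False unfolding L k_def[symmetric] by (simp add: integral_unique)
    qed
  qed
  have "(\<lambda>i. fourier_mode (mode_freq i) z * ?I i) sums (\<Sum>i\<in>{0}. fourier_mode (mode_freq i) z * ?I i)"
  proof (rule sums_finite)
    show "fourier_mode (mode_freq i) z * ?I i = 0" if "i \<notin> {0}" for i
      unfolding I using that by simp
  qed simp
  moreover have "mode_freq 0 = 0" by (simp add: mode_freq_def)
  ultimately have s2: "(\<lambda>i. fourier_mode (mode_freq i) z * ?I i) sums of_int d"
    unfolding I by simp
  have "(\<Sum>x\<in>preimages F \<rho> z. deriv F x / deriv F x) = of_nat (card (preimages F \<rho> z))"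
  proof -
    have "preimages F \<rho> z \<subseteq> annulus r" using \<rho> by (auto simp: preimages_def annulus_def)
    then have "(\<Sum>x\<in>preimages F \<rho> z. deriv F x / deriv F x) = (\<Sum>x\<in>preimages F \<rho> z. 1)"
      using deriv_nz by (intro sum.cong) auto
    then show ?thesis by simp
  qed
  with sums_unique2[OF s1 s2] have "of_int (int (card (preimages F \<rho> z))) = (of_int d :: complex)"
    by (simp only: of_int_of_nat_eq)
  then show ?thesis by (simp only: of_int_eq_iff)
qed

end

section \<open>Convergence of Fredholm series\<close>

text \<open>Exchanging two positions with the same index keeps every product and reverses the sign
  of the permutation, so the sum equals its own negative.\<close>

lemma minor_eq_0:
  assumes "\<not> inj_on i {..<n}"
  shows "minor n b i = 0"
proof -
  obtain x y where xy: "x < n" "y < n" "x \<noteq> y" "i x = i y"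
    using assms by (auto simp: inj_on_def)
  let ?\<tau> = "Transposition.transpose x y"
  have \<tau>: "?\<tau> permutes {..<n}" by (rule permutes_swap_id) (use xy in auto)
  have i\<tau>: "i (?\<tau> c) = i c" for c
    using xy(4) by (simp add: Transposition.transpose_def)
  have "minor n b i = (\<Sum>\<sigma> | \<sigma> permutes {..<n}. of_int (sign (?\<tau> \<circ> \<sigma>)) * (\<Prod>a<n. b (i a) (i ((?\<tau> \<circ> \<sigma>) a))))"
    unfolding minor_def by (rule setum_permutations_compose_left[OF \<tau>])
  also have "\<dots> = (\<Sum>\<sigma> | \<sigma> permutes {..<n}. - (of_int (sign \<sigma>) * (\<Prod>a<n. b (i a) (i (\<sigma> a)))))"
  proof (rule sum.cong)
    fix \<sigma> assume "\<sigma> \<in> {\<sigma>. \<sigma> permutes {..<n}}"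
    then have "permutation \<sigma>"
      unfolding permutation_permutes by (intro exI[of _ "{..<n}"]) auto
    moreover have "permutation ?\<tau>" by (rule permutation_swap_id)
    ultimately have "sign (?\<tau> \<circ> \<sigma>) = - sign \<sigma>"
      using xy(3) by (simp add: sign_compose sign_swap_id)
    then show "of_int (sign (?\<tau> \<circ> \<sigma>)) * (\<Prod>a<n. b (i a) (i ((?\<tau> \<circ> \<sigma>) a))) = - (of_int (sign \<sigma>) * (\<Prod>a<n. b (i a) (i (\<sigma> a))))"
      by (simp add: i\<tau>)
  qed simp
  also have "\<dots> = - minor n b i" unfolding minor_def by (rule sum_negf)
  finally show ?thesis by simp
qed

text \<open>Distinct indices sum to at least \<open>0 + \<dots> + (n - 1)\<close>; the gain
  \<open>q ^ (\<Sum>{0..<n})\<close> over the trivial bound makes Hadamard's inequality unnecessary.\<close>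

lemma geometric_det_bound:
  fixes b :: "nat \<Rightarrow> nat \<Rightarrow> complex" and q :: real
  assumes q: "0 < q" "q < 1" and b: "\<And>i j. norm (b i j) \<le> C"
  shows "norm ((\<Prod>a<n. of_real ((q\<^sup>2) ^ i a)) * minor n b i)
     \<le> fact n * C ^ n * q ^ (\<Sum>{0..<n}) * (\<Prod>a<n. q ^ i a)"
proof -
  have C: "0 \<le> C" using b[of 0 0] norm_ge_zero order_trans by blast
  have q0: "0 \<le> (\<Prod>a<n. q ^ i a)" using q by (intro prod_nonneg) auto
  show ?thesis
  proof (cases "inj_on i {..<n}")
    case False
    show ?thesis using C q q0 by (simp add: minor_eq_0[OF False])
  next
    case True
    have S: "norm (minor n b i) \<le> fact n * C ^ n" by (rule norm_minor_le[OF b])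
    \<comment> \<open>Of the weight \<open>(q\<^sup>2) ^ i a\<close> one factor
      \<open>q ^ i a\<close> is spent on the triangular gain, the other is kept for summing over
      tuples.\<close>
    have "(\<Prod>a<n. (q\<^sup>2) ^ i a) = (\<Prod>a<n. q ^ i a) * (\<Prod>a<n. q ^ i a)"
      unfolding prod.distrib[symmetric]
      by (intro prod.cong) (auto simp: power2_eq_square power_mult_distrib)
    moreover have "(\<Prod>a<n. q ^ i a) \<le> q ^ (\<Sum>{0..<n})"
    proof -
      have "(\<Prod>a<n. q ^ i a) = q ^ (\<Sum>a<n. i a)" by (simp add: power_sum)
      also have "(\<Sum>a<n. i a) = \<Sum> (i ` {..<n})" using True by (simp add: sum.reindex)
      also have "q ^ \<Sum> (i ` {..<n}) \<le> q ^ (\<Sum>{0..<n})"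
        using card_sum_le_nat_sum[of "i ` {..<n}"] q by (intro power_decreasing) (auto simp: card_image[OF True])
      finally show ?thesis .
    qed
    ultimately have "(\<Prod>a<n. (q\<^sup>2) ^ i a) \<le> q ^ (\<Sum>{0..<n}) * (\<Prod>a<n. q ^ i a)"
      using q0 by (simp add: mult_right_mono)
    moreover have "norm (\<Prod>a<n. of_real ((q\<^sup>2) ^ i a) :: complex) = (\<Prod>a<n. (q\<^sup>2) ^ i a)"
      using q by (simp add: norm_power flip: prod_norm)
    ultimately have "norm (\<Prod>a<n. of_real ((q\<^sup>2) ^ i a) :: complex) * norm (minor n b i) \<le> q ^ (\<Sum>{0..<n}) * (\<Prod>a<n. q ^ i a) * (fact n * C ^ n)"
      using S by (intro mult_mono) (use q q0 in auto)
    then show ?thesis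
      by (simp add: norm_mult mult_ac)
  qed
qed

text \<open>The ratio of consecutive terms is \<open>a * q ^ n\<close>, which tends to 0 for every
  \<open>a\<close>: the triangular power beats any geometric growth.\<close>

lemma summable_power_times_triangular_power:
  fixes a q :: real
  assumes q: "0 < q" "q < 1" and a: "0 \<le> a"
  shows "summable (\<lambda>n. a ^ n * q ^ (\<Sum>{0..<n}))"
proof -
  have "(\<lambda>n. a * q ^ n) \<longlonglongrightarrow> a * 0"
    using q by (intro tendsto_mult_left LIMSEQ_realpow_zero) auto
  then have "\<forall>\<^sub>F n in sequentially. a * q ^ n < 1 / 2"
    by (rule order_tendstoD) simp
  then obtain N where N: "\<And>n. N \<le> n \<Longrightarrow> a * q ^ n < 1 / 2"
    unfolding eventually_sequentially by blast
  show ?thesis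
  proof (rule summable_ratio_test[of "1 / 2" N])
    fix n assume "N \<le> n"
    then have "(a * q ^ n) * (a ^ n * q ^ (\<Sum>{0..<n})) \<le> 1 / 2 * (a ^ n * q ^ (\<Sum>{0..<n}))"
      using N[of n] a q by (intro mult_right_mono) auto
    then show "norm (a ^ Suc n * q ^ (\<Sum>{0..<Suc n})) \<le> 1 / 2 * norm (a ^ n * q ^ (\<Sum>{0..<n}))"
      using a q by (simp add: power_add mult_ac)
  qed simp
qed

text \<open>The M-test is applied twice: to the sum over tuples for each n, and to the sum over n,
  where n! cancels and the triangular power of q wins. The bounds \<open>C\<close> and
  \<open>K\<close> are uniform on \<open>W\<close>, so \<open>W\<close> is meant to be a piece
  bounded in z and u.\<close>

lemma holomorphic3_on_fredholm_series:
  fixes l :: "complex \<times> complex \<times> complex \<Rightarrow> nat \<Rightarrow> ('a \<Rightarrow> complex) \<Rightarrow> complex" and q :: real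
  assumes W: "open W" and q: "0 < q" "q < 1"
    and l: "\<And>i j. holomorphic3_on (\<lambda>p. l p i (e j)) W"
    and C: "\<And>i j p. p \<in> W \<Longrightarrow> norm (l p i (e j)) \<le> C"
    and \<zeta>: "holomorphic3_on \<zeta> W" and K: "\<And>p. p \<in> W \<Longrightarrow> norm (\<zeta> p) \<le> K"
  shows "holomorphic3_on (\<lambda>p. \<Sum>n. \<zeta> p ^ n * fredholm_coeff (\<lambda>i. of_real ((q\<^sup>2) ^ i)) (l p) e n) W"
proof (cases "W = {}")
  case True
  then show ?thesis by (simp add: holomorphic3_on_def)
next
  case False
  then obtain p0 where p0: "p0 \<in> W" by blast
  have C0: "0 \<le> C" and K0: "0 \<le> K"
    using order_trans[OF norm_ge_zero C[OF p0]] order_trans[OF norm_ge_zero K[OF p0]] by auto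
  define tm where "tm = (\<lambda>(n::nat) i p. (\<Prod>a<n. of_real ((q\<^sup>2) ^ i a)) * minor n (\<lambda>i j. l p i (e j)) i)"
  define S where "S = (\<lambda>n::nat. {..<n} \<rightarrow>\<^sub>E (UNIV :: nat set))"
  have tm_le: "norm (tm n i p) \<le> fact n * C ^ n * q ^ (\<Sum>{0..<n}) * (\<Prod>a<n. q ^ i a)" if "p \<in> W" for n i p
    unfolding tm_def by (rule geometric_det_bound[OF q C[OF that]])
  have geo: "(\<lambda>k::nat. q ^ k) sums (1 / (1 - q))" using q by (intro geometric_sums) simp
  have Ssum: "(\<lambda>i. \<Prod>a<n. q ^ i a) summable_on S n" for n
    unfolding S_def by (rule summable_on_prod_PiE_nat) (use q geo in \<open>auto simp: sums_iff\<close>)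
  have Sinf: "infsum (\<lambda>i. \<Prod>a<n. q ^ i a) (S n) = (1 / (1 - q)) ^ n" for n
  proof -
    have su: "(\<lambda>k. q ^ k) summable_on UNIV"
      using geo q by (subst summable_on_UNIV_nonneg_real_iff) (auto simp: sums_iff)
    then have "(\<lambda>k. q ^ k) sums infsum (\<lambda>k. q ^ k) UNIV"
      by (intro has_sum_imp_sums has_sum_infsum)
    then have "infsum (\<lambda>k. q ^ k) UNIV = 1 / (1 - q)"
      using geo by (rule sums_unique2)
    moreover have "infsum (\<lambda>i. \<Prod>a<n. q ^ i a) (S n) = (\<Prod>a<n. infsum (\<lambda>k. q ^ k) UNIV)"
      unfolding S_def by (rule infsum_prod_PiE) (use su Ssum[of n, unfolded S_def] in auto)
    ultimately show ?thesis by simp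
  qed
  have summ: "(\<lambda>i. fact n * C ^ n * q ^ (\<Sum>{0..<n}) * (\<Prod>a<n. q ^ i a)) summable_on S n" for n
    by (rule summable_on_cmult_right[OF Ssum])
  have coeff_holo: "holomorphic3_on (\<lambda>p. infsum (\<lambda>i. tm n i p) (S n)) W" for n
  proof (rule holomorphic3_uniform_limit[OF W])
    show "uniform_limit W (\<lambda>X p. \<Sum>i\<in>X. tm n i p) (\<lambda>p. infsum (\<lambda>i. tm n i p) (S n)) (finite_subsets_at_top (S n))"
      by (rule Weierstrass_m_test_general[OF _ summ]) (use tm_le in auto)
    show "holomorphic3_on (\<lambda>p. \<Sum>i\<in>X. tm n i p) W" for X
      unfolding tm_def minor_def
      by (intro holomorphic3_sum holomorphic3_mult holomorphic3_prod holomorphic3_const W l)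
  qed simp
  define g where "g = (\<lambda>n p. \<zeta> p ^ n * ((1 / fact n) * infsum (\<lambda>i. tm n i p) (S n)))"
  \<comment> \<open>Each order contributes a factor \<open>K\<close> from \<zeta>, \<open>C\<close>
    from the minor and 1 / (1 - q) from one geometric series.\<close>
  define a where "a = K * (C * (1 / (1 - q)))"
  have g_le: "norm (g n p) \<le> a ^ n * q ^ (\<Sum>{0..<n})" if p: "p \<in> W" for n p
  proof -
    have "norm (infsum (\<lambda>i. tm n i p) (S n)) \<le> infsum (\<lambda>i. fact n * C ^ n * q ^ (\<Sum>{0..<n}) * (\<Prod>a<n. q ^ i a)) (S n)"
    proof (rule norm_infsum_le[OF has_sum_infsum has_sum_infsum[OF summ]])
      have "(\<lambda>i. norm (tm n i p)) summable_on S n"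
        by (rule Infinite_Sum.abs_summable_on_comparison_test'[OF summ]) (use tm_le[OF p] in auto)
      then show "(\<lambda>i. tm n i p) summable_on S n" by (rule abs_summable_summable)
    qed (use tm_le[OF p] in auto)
    also have "\<dots> = fact n * C ^ n * q ^ (\<Sum>{0..<n}) * (1 / (1 - q)) ^ n"
      by (subst infsum_cmult_right) (simp_all only: Ssum Sinf)
    finally have 1: "norm (infsum (\<lambda>i. tm n i p) (S n)) \<le> fact n * C ^ n * q ^ (\<Sum>{0..<n}) * (1 / (1 - q)) ^ n" .
    have 2: "norm (\<zeta> p) ^ n \<le> K ^ n" using K[OF p] by (intro power_mono) auto
    have "norm (g n p) = norm (\<zeta> p) ^ n * (norm (infsum (\<lambda>i. tm n i p) (S n)) / fact n)"
      by (simp add: g_def norm_mult norm_power norm_divide)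
    also have "\<dots> \<le> K ^ n * (fact n * C ^ n * q ^ (\<Sum>{0..<n}) * (1 / (1 - q)) ^ n / fact n)"
      by (rule mult_mono[OF 2 divide_right_mono[OF 1]]) (use K0 in auto)
    also have "\<dots> = a ^ n * q ^ (\<Sum>{0..<n})"
      by (simp add: a_def power_mult_distrib power_divide)
    finally show ?thesis .
  qed
  have \<zeta>_pow: "holomorphic3_on (\<lambda>p. \<zeta> p ^ n) W" for n
    using holomorphic3_prod[OF W, of "{..<n}" "\<lambda>_. \<zeta>"] \<zeta> by simp
  have a0: "0 \<le> a" using C0 K0 q by (simp add: a_def)
  have "holomorphic3_on (\<lambda>p. \<Sum>n. g n p) W"
  proof (rule holomorphic3_uniform_limit[OF W sequentially_bot])
    show "uniform_limit W (\<lambda>N p. \<Sum>n<N. g n p) (\<lambda>p. \<Sum>n. g n p) sequentially"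
      by (rule Weierstrass_m_test[OF _ summable_power_times_triangular_power[OF q a0]]) (use g_le in auto)
    show "holomorphic3_on (\<lambda>p. \<Sum>n<N. g n p) W" for N
      unfolding g_def by (intro holomorphic3_sum holomorphic3_mult \<zeta>_pow holomorphic3_const coeff_holo W)
  qed
  then show ?thesis
    by (simp add: g_def tm_def S_def minor_def fredholm_coeff_def)
qed

section \<open>Transfer operators of holomorphic families\<close>

text \<open>Differentiation under the integral sign; the joint continuity of the derivative that it
  requires comes from Cauchy's formula.\<close>

lemma holomorphic_on_integral_param:
  fixes h :: "complex \<times> real \<Rightarrow> complex"
  assumes A: "open A" "convex A" and cont: "continuous_on (A \<times> {0..1}) h"
    and hol: "\<And>s. s \<in> {0..1} \<Longrightarrow> (\<lambda>x. h (x, s)) holomorphic_on A"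
  shows "(\<lambda>x. integral {0..1} (\<lambda>s. h (x, s))) holomorphic_on A"
proof -
  have "(\<lambda>x. integral (cbox 0 1) (\<lambda>s. h (x, s))) holomorphic_on A"
  proof (rule leibniz_rule_holomorphic[OF _ _ _ A(2)])
    fix x and s :: real assume x: "x \<in> A" and s: "s \<in> cbox 0 1"
    have "((\<lambda>x. h (x, s)) has_field_derivative deriv (\<lambda>x. h (x, s)) x) (at x)"
      by (rule holomorphic_derivI[OF hol A(1) x]) (use s in simp)
    then show "((\<lambda>x. h (x, s)) has_field_derivative (\<lambda>x s. deriv (\<lambda>x. h (x, s)) x) x s) (at x within A)"
      by (simp add: has_field_derivative_at_within)
  next
    fix x assume x: "x \<in> A"
    show "(\<lambda>s. h (x, s)) integrable_on cbox 0 1"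
      by (intro integrable_continuous continuous_on_compose2[OF cont] continuous_intros) (use x in auto)
  next
    have "continuous_on (A \<times> {0..1}) (\<lambda>(x, s). deriv (\<lambda>x. h (x, s)) x)"
      by (rule continuous_on_deriv_first[OF A(1) cont hol])
    then show "continuous_on (A \<times> cbox 0 1) (\<lambda>(x, s). deriv (\<lambda>x. h (x, s)) x)"
      by simp
  qed
  then show ?thesis by simp
qed

lemma holomorphic2_on_imp_continuous_on:
  assumes "holomorphic2_on h W"
  shows "continuous_on W h"
proof (rule continuous_at_imp_continuous_on, rule ballI)
  fix p assume p: "p \<in> W"
  obtain a b where "(h has_derivative (\<lambda>(x, y). a * x + b * y)) (at p)"
    using bspec[OF assms[unfolded holomorphic2_on_def] p] by (elim exE)
  then show "isCont h p" by (rule has_derivative_continuous)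
qed

lemma holomorphic2_on_imp_holomorphic_on:
  assumes h: "holomorphic2_on h (A \<times> B)"
  shows "y \<in> B \<Longrightarrow> (\<lambda>x. h (x, y)) holomorphic_on A" and "x \<in> A \<Longrightarrow> (\<lambda>y. h (x, y)) holomorphic_on B"
proof -
  have d: "(\<lambda>x. h (x, y)) field_differentiable (at x) \<and> (\<lambda>y. h (x, y)) field_differentiable (at y)"
    if xy: "(x, y) \<in> A \<times> B" for x y
  proof -
    obtain a b where ab: "(h has_derivative (\<lambda>(x, y). a * x + b * y)) (at (x, y))"
      using bspec[OF h[unfolded holomorphic2_on_def] xy] by (elim exE)
    have "((\<lambda>x. (x, y)) has_derivative (\<lambda>x. (x, 0))) (at x)"
      by (intro has_derivative_Pair has_derivative_const has_derivative_ident)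
    from has_derivative_compose[OF this ab]
    have 1: "((\<lambda>x. h (x, y)) has_field_derivative a) (at x)"
      by (simp add: has_field_derivative_def)
    have "((\<lambda>y. (x, y)) has_derivative (\<lambda>y. (0, y))) (at y)"
      by (intro has_derivative_Pair has_derivative_const has_derivative_ident)
    from has_derivative_compose[OF this ab]
    have 2: "((\<lambda>y. h (x, y)) has_field_derivative b) (at y)"
      by (simp add: has_field_derivative_def)
    show ?thesis
      unfolding field_differentiable_def using 1 2 by blast
  qed
  show "y \<in> B \<Longrightarrow> (\<lambda>x. h (x, y)) holomorphic_on A"
    unfolding holomorphic_on_def using d by (simp add: field_differentiable_at_within)
  show "x \<in> A \<Longrightarrow> (\<lambda>y. h (x, y)) holomorphic_on B"
    unfolding holomorphic_on_def using d by (simp add: field_differentiable_at_within)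
qed

text \<open>The enumeration visits both signs of a frequency in turn, so decay in the frequency
  becomes decay in the index at half the rate.\<close>

lemma mode_freq_bound: "int i \<le> 2 * \<bar>mode_freq i\<bar>"
  by (auto simp: mode_freq_def)

lemma norm_sums_minus_partial_le:
  fixes f :: "nat \<Rightarrow> complex"
  assumes f: "f sums s" and le: "\<And>i. norm (f i) \<le> c * q ^ i" and q: "0 \<le> q" "q < 1"
  shows "norm (s - (\<Sum>i<n. f i)) \<le> c * (q ^ n / (1 - q))"
proof -
  have "(\<lambda>i. f (i + n)) sums (s - (\<Sum>i<n. f i))"
    by (rule sums_split_initial_segment[OF f])
  moreover have "(\<lambda>i. c * q ^ n * q ^ i) sums (c * q ^ n * (1 / (1 - q)))"
    using q by (intro sums_mult geometric_sums) auto
  moreover have "norm (f (i + n)) \<le> c * q ^ n * q ^ i" for i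
    using le[of "i + n"] by (simp add: power_add mult_ac)
  ultimately have "norm (s - (\<Sum>i<n. f i)) \<le> c * q ^ n * (1 / (1 - q))"
    by (rule norm_sums_le)
  then show ?thesis by simp
qed

lemma holomorphic3_on_transform:
  assumes W: "open W" and f: "holomorphic3_on f W" and eq: "\<And>p. p \<in> W \<Longrightarrow> f p = g p"
  shows "holomorphic3_on g W"
  unfolding holomorphic3_on_def
proof
  fix p assume p: "p \<in> W"
  obtain a b c where "(f has_derivative (\<lambda>(x, y, w). a * x + b * y + c * w)) (at p)"
    using f p by (rule holomorphic3_onE)
  then have "(g has_derivative (\<lambda>(x, y, w). a * x + b * y + c * w)) (at p)"
    using W p eq by (rule has_derivative_transform_within_open)
  then show "\<exists>a b c. (g has_derivative (\<lambda>(x, y, w). a * x + b * y + c * w)) (at p)"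
    by - (rule exI[of _ a], rule exI[of _ b], rule exI[of _ c])
qed

text \<open>The geometric input of the determinant: integration lines at height \<rho> inside the
  annulus, their images beyond height Q > R, and, for targets in the closed annulus, no preimages
  between the heights \<rho> and R, so that the operator sums precisely the residues between the two
  lines.\<close>

locale transfer_family =
  fixes F :: "complex \<Rightarrow> complex \<Rightarrow> complex" and G :: "complex \<Rightarrow> complex" and T V :: "complex set"
    and d :: int and R \<rho> Q :: real
  assumes T: "open T" "convex T" and \<rho>: "0 < \<rho>" "\<rho> < R" and Q: "R < Q"
    and map: "\<And>t. t \<in> T \<Longrightarrow> annulus_map (F t) d R"
    and F_holo: "holomorphic2_on (\<lambda>(t, z). F t z) (T \<times> annulus R)"
    and top: "\<And>t s. t \<in> T \<Longrightarrow> Q \<le> Im (F t (Complex s \<rho>))"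
    and bot: "\<And>t s. t \<in> T \<Longrightarrow> Im (F t (Complex s (- \<rho>))) \<le> - Q"
    and pre: "\<And>t z. t \<in> T \<Longrightarrow> z \<in> closed_annulus R \<Longrightarrow> preimages (F t) R z = preimages (F t) \<rho> z"
    and V: "open V" "annulus R \<subseteq> V" and G_holo: "G holomorphic_on V" and G_per: "\<And>z. z \<in> V \<Longrightarrow> G (z + 1) = G z"
begin

text \<open>The decay is exp(- 2 pi (Q - R)) per unit of frequency; \<open>mode_freq_bound\<close>
  halves the exponent per index.\<close>

definition \<theta> :: real where "\<theta> = exp (- pi * (Q - R))"

abbreviation integrand :: "complex \<Rightarrow> complex \<Rightarrow> nat \<Rightarrow> (complex \<Rightarrow> complex) \<Rightarrow> real \<Rightarrow> complex" where
  "integrand u t i \<phi> s \<equiv> \<phi> (mode_line \<rho> i s) * exp (- u * G (mode_line \<rho> i s)) * fourier_mode (- mode_freq i) (F t (mode_line \<rho> i s))"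

text \<open>In \<open>mode\<close> the exponential is divided by its supremum exp(2 pi |n| R) on the
  closed annulus. The functional takes over this factor together with that of
  \<open>\<theta> ^ i\<close>, and stays bounded since the integral is at most of order exp(- 2 pi
  |n| Q). It carries all the dependence on u and t.\<close>

definition functional :: "complex \<Rightarrow> complex \<Rightarrow> nat \<Rightarrow> (complex \<Rightarrow> complex) \<Rightarrow> complex" where
  "functional u t i \<phi> = of_real (exp (2 * pi * of_int \<bar>mode_freq i\<bar> * R) / \<theta> ^ i) *
     integral {0..1} (integrand u t i \<phi>)"

definition mode :: "nat \<Rightarrow> complex \<Rightarrow> complex" where
  "mode i z = of_real (exp (- 2 * pi * of_int \<bar>mode_freq i\<bar> * R)) * annulus_mode R (mode_freq i) z"

lemma theta_bounds: "0 < \<theta>" "\<theta> < 1"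
  using Q by (auto simp: \<theta>_def)

lemma mode_line_annulus: "mode_line \<rho> i s \<in> annulus R"
  using \<rho> by (auto simp: mode_line_def annulus_def)

lemma continuous_on_mode_line: "continuous_on A f \<Longrightarrow> continuous_on A (\<lambda>x. mode_line \<rho> i (f x))"
  unfolding mode_line_def Complex_eq by (intro continuous_intros)

lemma continuous_on_G_line: "continuous_on A f \<Longrightarrow> continuous_on A (\<lambda>x. G (mode_line \<rho> i (f x)))"
  using V(2) mode_line_annulus
  by (intro continuous_on_compose2[OF holomorphic_on_imp_continuous_on[OF G_holo] continuous_on_mode_line]) auto

lemma continuous_on_F_line:
  assumes "continuous_on A f" "continuous_on A g" "\<And>x. x \<in> A \<Longrightarrow> f x \<in> T"
  shows "continuous_on A (\<lambda>x. F (f x) (mode_line \<rho> i (g x)))"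
proof -
  have "continuous_on A (\<lambda>x. (\<lambda>(t, z). F t z) (f x, mode_line \<rho> i (g x)))"
    by (intro continuous_on_compose2[OF holomorphic2_on_imp_continuous_on[OF F_holo]] continuous_on_Pair
        continuous_on_mode_line assms) (use assms(3) mode_line_annulus in auto)
  then show ?thesis by simp
qed

lemma continuous_on_space_line:
  assumes "\<phi> \<in> hol_space R" "continuous_on A f"
  shows "continuous_on A (\<lambda>x. \<phi> (mode_line \<rho> i (f x)))"
  by (rule hol_space_continuous[OF assms(1) continuous_on_mode_line[OF assms(2)]])
    (use mode_line_annulus annulus_subset_closed_annulus in blast)

text \<open>Only two lines occur, selected by the parity of \<open>i\<close>, so the indices 0 and 1
  give a bound for all.\<close>

lemma G_bounded_on_lines: "\<exists>B\<ge>0. \<forall>i. \<forall>s\<in>{0..1}. norm (G (mode_line \<rho> i s)) \<le> B"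
proof -
  have "\<exists>B. \<forall>s\<in>{0..1}. norm (G (mode_line \<rho> i s)) \<le> B" for i
  proof -
    have "compact ((\<lambda>s. G (mode_line \<rho> i s)) ` {0..1})"
      by (intro compact_continuous_image continuous_on_G_line continuous_intros compact_Icc)
    then have "bounded ((\<lambda>s. G (mode_line \<rho> i s)) ` {0..1})"
      by (rule compact_imp_bounded)
    then show ?thesis
      by (simp add: bounded_iff)
  qed
  then obtain B where B: "\<And>i s. s \<in> {0..1} \<Longrightarrow> norm (G (mode_line \<rho> i s)) \<le> B i"
    by metis
  have "norm (G (mode_line \<rho> i s)) \<le> max 0 (max (B 0) (B 1))" if s: "s \<in> {0..1}" for i and s :: real
  proof -
    have "mode_line \<rho> i s = mode_line \<rho> 0 s \<or> mode_line \<rho> i s = mode_line \<rho> 1 s"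
      by (simp add: mode_line_def)
    then show ?thesis
      using B[OF s, of 0] B[OF s, of 1] by (auto simp: le_max_iff_disj)
  qed
  then show ?thesis
    by (intro exI[of _ "max 0 (max (B 0) (B 1))"]) simp
qed

lemma functional_integrand_integrable:
  assumes t: "t \<in> T" and \<phi>: "\<phi> \<in> hol_space R"
  shows "(integrand u t i \<phi>) integrable_on {0..1}"
  using t by (intro integrable_continuous_interval continuous_intros continuous_on_space_line[OF \<phi>]
      continuous_on_G_line continuous_on_F_line) auto

text \<open>With n the frequency, the integral gains exp(- 2 pi |n| Q), the normalisation costs
  exp(2 pi |n| R) / \<open>\<theta> ^ i\<close>, and i <= 2 |n| makes the product at most 1. The
  bound is the same for all i and all t in \<open>T\<close>.\<close>

lemma norm_functional_le:
  assumes t: "t \<in> T" and \<phi>: "\<phi> \<in> hol_space R" and B: "\<And>i s. s \<in> {0..1} \<Longrightarrow> norm (G (mode_line \<rho> i s)) \<le> B"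
  shows "norm (functional u t i \<phi>) \<le> exp (norm u * B) * hol_norm R \<phi>"
proof -
  define m where "m = (of_int \<bar>mode_freq i\<bar> :: real)"
  define c where "c = hol_norm R \<phi> * exp (norm u * B) * exp (- 2 * pi * m * Q)"
  have \<phi>0: "0 \<le> hol_norm R \<phi>" by (rule hol_norm_nonneg[OF _ \<phi>]) (use \<rho> in simp)
  have F_le: "norm (fourier_mode (- mode_freq i) (F t (mode_line \<rho> i s))) \<le> exp (- 2 * pi * m * Q)" for s
  proof -
    \<comment> \<open>The sign of the frequency fits the line: nonpositive frequencies meet Im F >=
      Q, positive ones Im F <= - Q.\<close>
    have "m * Q \<le> - (of_int (mode_freq i) * Im (F t (mode_line \<rho> i s)))"
    proof (cases "even i")
      case True
      have "real (i div 2) * Q \<le> real (i div 2) * Im (F t (Complex s \<rho>))"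
        by (rule mult_left_mono[OF top[OF t]]) simp
      moreover have "m = real (i div 2)" "real_of_int (mode_freq i) = - real (i div 2)"
        using True by (simp_all add: m_def mode_freq_def)
      moreover have "mode_line \<rho> i s = Complex s \<rho>" using True by (simp only: mode_line_def if_True)
      ultimately show ?thesis by (simp only: mult_minus_left minus_minus)
    next
      case False
      have "real (i div 2 + 1) * Q \<le> real (i div 2 + 1) * (- Im (F t (Complex s (- \<rho>))))"
        by (rule mult_left_mono) (use bot[OF t, of s] in linarith, simp)
      moreover have "m = real (i div 2 + 1)" "real_of_int (mode_freq i) = real (i div 2 + 1)"
        using False by (simp_all add: m_def mode_freq_def)
      moreover have "mode_line \<rho> i s = Complex s (- \<rho>)" using False by (simp only: mode_line_def if_False)
      ultimately show ?thesis by (simp only: mult_minus_right)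
    qed
    then have "2 * pi * (m * Q) \<le> 2 * pi * (- (of_int (mode_freq i) * Im (F t (mode_line \<rho> i s))))"
      by (rule mult_left_mono) simp
    moreover have "- 2 * pi * (- k) * y \<le> - 2 * pi * m * Q" if "2 * pi * (m * Q) \<le> 2 * pi * (- (k * y))" for k y
      using that by (simp add: algebra_simps)
    ultimately show ?thesis
      unfolding norm_fourier_mode of_int_minus exp_le_cancel_iff by blast
  qed
  have "norm (integral {0..1} (integrand u t i \<phi>))
     \<le> integral {0..1} (\<lambda>s::real. c)"
  proof (rule integral_norm_bound_integral[OF functional_integrand_integrable[OF t \<phi>]])
    fix s :: real assume s: "s \<in> {0..1}"
    have "norm (\<phi> (mode_line \<rho> i s)) \<le> hol_norm R \<phi>"
      using mode_line_annulus annulus_subset_closed_annulus by (intro hol_space_imp_le_norm[OF \<phi>]) blast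
    moreover have "norm (exp (- u * G (mode_line \<rho> i s))) \<le> exp (norm u * B)"
    proof -
      have "norm (- u * G (mode_line \<rho> i s)) \<le> norm u * B"
        unfolding norm_mult norm_minus_cancel by (intro mult_left_mono B s) simp
      then have "exp (norm (- u * G (mode_line \<rho> i s))) \<le> exp (norm u * B)" by simp
      then show ?thesis by (rule order_trans[OF norm_exp])
    qed
    ultimately have "norm (\<phi> (mode_line \<rho> i s)) * norm (exp (- u * G (mode_line \<rho> i s))) \<le> hol_norm R \<phi> * exp (norm u * B)"
      by (rule mult_mono) (use \<phi>0 in auto)
    then have "norm (\<phi> (mode_line \<rho> i s)) * norm (exp (- u * G (mode_line \<rho> i s))) * norm (fourier_mode (- mode_freq i) (F t (mode_line \<rho> i s))) \<le> c"
      unfolding c_def using F_le by (rule mult_mono) (use \<phi>0 in auto)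
    then show "norm (\<phi> (mode_line \<rho> i s) * exp (- u * G (mode_line \<rho> i s)) * fourier_mode (- mode_freq i) (F t (mode_line \<rho> i s))) \<le> c"
      by (simp only: norm_mult)
  qed auto
  then have I: "norm (integral {0..1} (integrand u t i \<phi>)) \<le> c"
    by simp
  have "norm (of_real (exp (2 * pi * m * R) / \<theta> ^ i) :: complex) = exp (2 * pi * m * R) / \<theta> ^ i"
    using theta_bounds(1) by (simp only: norm_of_real abs_of_pos exp_gt_zero zero_less_power divide_pos_pos)
  then have "norm (functional u t i \<phi>) \<le> exp (2 * pi * m * R) / \<theta> ^ i * c"
    unfolding functional_def norm_mult m_def[symmetric]
    using I theta_bounds(1) by (simp only:) (intro mult_left_mono, auto)
  also have "\<dots> = (exp (2 * pi * m * R) * exp (- 2 * pi * m * Q)) / \<theta> ^ i * (exp (norm u * B) * hol_norm R \<phi>)"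
    unfolding c_def by (simp only: times_divide_eq_left times_divide_eq_right mult_ac)
  also have "\<dots> \<le> 1 * (exp (norm u * B) * hol_norm R \<phi>)"
  proof (rule mult_right_mono)
    have "real i * (pi * (Q - R)) \<le> 2 * m * (pi * (Q - R))"
    proof (rule mult_right_mono)
      have "of_int (int i) \<le> (of_int (2 * \<bar>mode_freq i\<bar>) :: real)"
        unfolding of_int_le_iff by (rule mode_freq_bound)
      then show "real i \<le> 2 * m" by (simp add: m_def)
    qed (use Q in simp)
    then have "2 * pi * m * R + - 2 * pi * m * Q \<le> real i * (- pi * (Q - R))"
      by (simp add: algebra_simps)
    then have "exp (2 * pi * m * R) * exp (- 2 * pi * m * Q) \<le> \<theta> ^ i"
      by (simp only: \<theta>_def exp_add[symmetric] exp_of_nat_mult[symmetric] exp_le_cancel_iff)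
    then show "exp (2 * pi * m * R) * exp (- 2 * pi * m * Q) / \<theta> ^ i \<le> 1"
      using theta_bounds by simp
  qed (use \<phi>0 in simp)
  finally show ?thesis by simp
qed

lemma bounded_functional_functional:
  assumes t: "t \<in> T" and B: "\<And>i s. s \<in> {0..1} \<Longrightarrow> norm (G (mode_line \<rho> i s)) \<le> B"
  shows "bounded_functional (hol_space R) (hol_norm R) (exp (norm u * B)) (functional u t i)"
  unfolding bounded_functional_def
proof (intro conjI ballI allI)
  show "functional u t i (\<lambda>x. \<phi> x + \<psi> x) = functional u t i \<phi> + functional u t i \<psi>"
    if "\<phi> \<in> hol_space R" "\<psi> \<in> hol_space R" for \<phi> \<psi>
    unfolding functional_def distrib_right
    using functional_integrand_integrable[OF t that(1), of i u] functional_integrand_integrable[OF t that(2), of i u]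
    by (simp only: integral_add distrib_left)
  show "functional u t i (\<lambda>x. c * \<phi> x) = c * functional u t i \<phi>" for c \<phi>
    unfolding functional_def mult.assoc[of c] integral_mult_right by (simp only: mult.left_commute)
qed (rule norm_functional_le[OF t _ B])

lemma mode_in_hol_space: "mode i \<in> hol_space R"
proof -
  have "(\<lambda>z. of_real (exp (- 2 * pi * of_int \<bar>mode_freq i\<bar> * R)) * annulus_mode R (mode_freq i) z) \<in> hol_space R"
    using annulus_mode_in_hol_space func_space_hol_space unfolding func_space_def by blast
  then show ?thesis unfolding mode_def[abs_def] .
qed

lemma norm_mode_le: "z \<in> closed_annulus R \<Longrightarrow> norm (mode i z) \<le> 1"
proof -
  assume z: "z \<in> closed_annulus R"
  have "norm (mode i z) \<le> exp (- 2 * pi * of_int \<bar>mode_freq i\<bar> * R) * exp (2 * pi * \<bar>of_int (mode_freq i)\<bar> * R)"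
    unfolding mode_def norm_mult annulus_mode_def using norm_fourier_mode_le[OF z, of "mode_freq i"] z
    by (intro mult_mono) auto
  then show ?thesis by (simp add: exp_add[symmetric])
qed

text \<open>The Fourier expansion of preimage sums, with weight \<phi> exp(- u G); every z of the
  closed annulus is at vertical distance at least Q - R from the images of the two lines.\<close>

lemma transfer_op_sums:
  assumes t: "t \<in> T" and \<phi>: "\<phi> \<in> hol_space R" and z: "z \<in> closed_annulus R"
  shows "(\<lambda>i. of_real (\<theta> ^ i) * functional u t i \<phi> * mode i z) sums transfer_op F G R u t \<phi> z"
proof -
  interpret annulus_map "F t" d R by (rule map[OF t])
  define \<psi> where "\<psi> = (\<lambda>x. \<phi> x * exp (- u * G x))"
  have \<psi>: "\<psi> holomorphic_on annulus R"
    unfolding \<psi>_def using \<phi> V(2)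
    by (intro holomorphic_intros holomorphic_on_subset[OF G_holo]) (auto simp: hol_space_def)
  have \<psi>_per: "\<psi> (x + 1) = \<psi> x" if "x \<in> annulus R" for x
    using hol_space_periodic[OF \<phi>] G_per[of x] V(2) that by (auto simp: \<psi>_def)
  have zI: "\<bar>Im z\<bar> \<le> R" using z by (simp add: closed_annulus_def)
  have "(\<lambda>i. fourier_mode (mode_freq i) z * integral {0..1} (\<lambda>s. \<psi> (mode_line \<rho> i s) * fourier_mode (- mode_freq i) (F t (mode_line \<rho> i s))))
     sums (\<Sum>x\<in>preimages (F t) \<rho> z. \<psi> x / deriv (F t) x)"
  proof (rule preimages_sum_sums[OF \<rho> \<psi> \<psi>_per])
    show "0 < Q - R" using Q by simp
    show "Im z + (Q - R) \<le> Im (F t (Complex s \<rho>))" "Im (F t (Complex s (- \<rho>))) \<le> Im z - (Q - R)" for s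
      using top[OF t, of s] bot[OF t, of s] zI by linarith+
  qed
  moreover have "(\<Sum>x\<in>preimages (F t) \<rho> z. \<psi> x / deriv (F t) x) = transfer_op F G R u t \<phi> z"
    using z unfolding transfer_op_def pre[OF t z] by (simp add: \<psi>_def mult.commute)
  moreover have "fourier_mode (mode_freq i) z * integral {0..1} (\<lambda>s. \<psi> (mode_line \<rho> i s) * fourier_mode (- mode_freq i) (F t (mode_line \<rho> i s)))
     = of_real (\<theta> ^ i) * functional u t i \<phi> * mode i z" for i
  proof -
    \<comment> \<open>The normalising factors of \<open>lam\<close>, \<open>functional\<close> and
      \<open>mode\<close> cancel.\<close>
    have "of_real (\<theta> ^ i) * of_real (exp (2 * pi * of_int \<bar>mode_freq i\<bar> * R) / \<theta> ^ i) * of_real (exp (- 2 * pi * of_int \<bar>mode_freq i\<bar> * R)) = (1 :: complex)"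
      using theta_bounds unfolding of_real_mult[symmetric] by (simp add: exp_minus)
    moreover have "c1 * (c2 * I) * (c3 * f) = (c1 * c2 * c3) * (f * I)" for c1 c2 c3 I f :: complex
      by (simp only: mult_ac)
    ultimately show ?thesis
      unfolding functional_def mode_def annulus_mode_def \<psi>_def if_P[OF z] by (simp only: mult_1_left)
  qed
  ultimately show ?thesis by (simp only:)
qed

abbreviation partial_sum :: "complex \<Rightarrow> complex \<Rightarrow> (complex \<Rightarrow> complex) \<Rightarrow> nat \<Rightarrow> complex \<Rightarrow> complex" where
  "partial_sum u t \<phi> n z \<equiv> \<Sum>i<n. of_real (\<theta> ^ i) * functional u t i \<phi> * mode i z"

lemma transfer_op_partial_sum:
  assumes t: "t \<in> T" and \<phi>: "\<phi> \<in> hol_space R" and B: "\<And>i s. s \<in> {0..1} \<Longrightarrow> norm (G (mode_line \<rho> i s)) \<le> B"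
    and z: "z \<in> closed_annulus R"
  shows "norm (transfer_op F G R u t \<phi> z - partial_sum u t \<phi> n z)
     \<le> exp (norm u * B) * hol_norm R \<phi> * (\<theta> ^ n / (1 - \<theta>))"
proof (rule norm_sums_minus_partial_le[OF transfer_op_sums[OF t \<phi> z] _ less_imp_le[OF theta_bounds(1)] theta_bounds(2)])
  fix i
  have \<phi>0: "0 \<le> hol_norm R \<phi>" by (rule hol_norm_nonneg[OF _ \<phi>]) (use \<rho> in simp)
  have "norm (functional u t i \<phi>) * norm (mode i z) \<le> exp (norm u * B) * hol_norm R \<phi> * 1"
    using norm_functional_le[OF t \<phi> B] norm_mode_le[OF z] by (rule mult_mono) (use \<phi>0 in auto)
  then have "\<theta> ^ i * (norm (functional u t i \<phi>) * norm (mode i z)) \<le> \<theta> ^ i * (exp (norm u * B) * hol_norm R \<phi> * 1)"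
    by (rule mult_left_mono) (use theta_bounds in simp)
  then show "norm (of_real (\<theta> ^ i) * functional u t i \<phi> * mode i z) \<le> exp (norm u * B) * hol_norm R \<phi> * \<theta> ^ i"
    using theta_bounds(1) by (simp add: norm_mult norm_power mult_ac)
qed

text \<open>As a uniform limit of combinations of modes on the closed annulus, the image inherits
  continuity up to the boundary and holomorphy inside, without any study of how the preimages depend
  on z.\<close>

lemma transfer_op_in_hol_space:
  assumes t: "t \<in> T" and \<phi>: "\<phi> \<in> hol_space R"
  shows "transfer_op F G R u t \<phi> \<in> hol_space R"
proof -
  obtain B where B: "0 \<le> B" "\<And>i s. s \<in> {0..1} \<Longrightarrow> norm (G (mode_line \<rho> i s)) \<le> B"
    using G_bounded_on_lines by blast
  define c where "c = exp (norm u * B) * hol_norm R \<phi>"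
  define S where "S = (\<lambda>n z. \<Sum>i<n. of_real (\<theta> ^ i) * functional u t i \<phi> * mode i z)"
  have le: "norm (transfer_op F G R u t \<phi> z - S n z) \<le> c * (\<theta> ^ n / (1 - \<theta>))" if "z \<in> closed_annulus R" for z n
    unfolding S_def c_def by (rule transfer_op_partial_sum[OF t \<phi> B(2) that])
  have S: "S n \<in> hol_space R" for n
    unfolding S_def by (rule func_space_sum[OF func_space_hol_space]) (rule mode_in_hol_space)
  have ul: "uniform_limit (closed_annulus R) S (transfer_op F G R u t \<phi>) sequentially"
  proof (rule uniform_limitI)
    fix e :: real assume e: "0 < e"
    have "(\<lambda>n. c * (\<theta> ^ n / (1 - \<theta>))) \<longlonglongrightarrow> c * (0 / (1 - \<theta>))"
      using theta_bounds by (intro tendsto_intros LIMSEQ_realpow_zero) auto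
    then have "\<forall>\<^sub>F n in sequentially. c * (\<theta> ^ n / (1 - \<theta>)) < e"
      by (rule order_tendstoD) (use e in simp)
    then show "\<forall>\<^sub>F n in sequentially. \<forall>z\<in>closed_annulus R. dist (S n z) (transfer_op F G R u t \<phi> z) < e"
    proof eventually_elim
      case (elim n)
      show ?case
        using le[of _ n] elim by (auto simp: dist_norm norm_minus_commute intro: le_less_trans)
    qed
  qed
  show ?thesis
  proof (rule hol_spaceI)
    show "continuous_on (closed_annulus R) (transfer_op F G R u t \<phi>)"
      by (rule uniform_limit_theorem[OF _ ul sequentially_bot]) (use S in \<open>auto simp: hol_space_def\<close>)
    show "transfer_op F G R u t \<phi> holomorphic_on annulus R"
      unfolding holomorphic_on_def
    proof
      fix z assume z: "z \<in> annulus R"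
      have "transfer_op F G R u t \<phi> field_differentiable (at z)"
      proof (rule field_differentiable_uniform_limit[OF open_annulus z sequentially_bot])
        show "S n field_differentiable at x" if "x \<in> annulus R" for n x
          using S[of n] that open_annulus by (auto simp: hol_space_def intro: holomorphic_on_imp_differentiable_at)
        show "uniform_limit (annulus R) S (transfer_op F G R u t \<phi>) sequentially"
          by (rule uniform_limit_on_subset[OF ul annulus_subset_closed_annulus])
      qed
      then show "transfer_op F G R u t \<phi> field_differentiable (at z within annulus R)"
        by (rule field_differentiable_at_within)
    qed
    \<comment> \<open>The remainder after the empty partial sum is the value of the operator
      itself.\<close>
    show "norm (transfer_op F G R u t \<phi> z) \<le> c * (\<theta> ^ 0 / (1 - \<theta>))" if "z \<in> closed_annulus R" for z
      using le[OF that, of 0] by (simp add: S_def)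
    show "transfer_op F G R u t \<phi> (z + 1) = transfer_op F G R u t \<phi> z" for z
    proof (cases "z \<in> closed_annulus R")
      case True
      then have "z + 1 \<in> closed_annulus R" by (simp add: closed_annulus_def)
      from transfer_op_sums[OF t \<phi> this, of u] transfer_op_sums[OF t \<phi> True, of u]
      show ?thesis
        by (simp only: hol_space_periodic[OF mode_in_hol_space]) (rule sums_unique2)
    next
      case False
      then have "z + 1 \<notin> closed_annulus R" by (simp add: closed_annulus_def)
      then show ?thesis using False by (simp add: transfer_op_def)
    qed
  qed (simp add: transfer_op_def)
qed

lemma summable_rep_transfer_op:
  assumes t: "t \<in> T"
  shows "summable_rep (2 / 3) (hol_space R) (hol_norm R) (transfer_op F G R u t) (\<lambda>i. of_real (\<theta> ^ i)) (functional u t) mode"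
  unfolding summable_rep_def
proof (intro conjI ballI)
  obtain B where B: "0 \<le> B" "\<And>i s. s \<in> {0..1} \<Longrightarrow> norm (G (mode_line \<rho> i s)) \<le> B"
    using G_bounded_on_lines by blast
  have R: "0 < R" using \<rho> by simp
  show "\<exists>C. \<forall>i. bounded_functional (hol_space R) (hol_norm R) C (functional u t i) \<and> mode i \<in> hol_space R \<and> hol_norm R (mode i) \<le> C"
  proof (intro exI allI conjI)
    show "bounded_functional (hol_space R) (hol_norm R) (exp (norm u * B)) (functional u t i)" for i
      by (rule bounded_functional_functional[OF t B(2)])
    have "hol_norm R (mode i) \<le> 1" for i by (rule hol_norm_le[OF R norm_mode_le])
    \<comment> \<open>\<open>B\<close> is nonnegative, so one constant bounds both the functionals
      and the modes.\<close>
    moreover have "1 \<le> exp (norm u * B)" using B(1) by simp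
    ultimately show "hol_norm R (mode i) \<le> exp (norm u * B)" for i by (rule order_trans)
  qed (rule mode_in_hol_space)
  have "norm (of_real (\<theta> ^ i) :: complex) powr (2 / 3) = (\<theta> powr (2 / 3)) ^ i" for i
    using theta_bounds(1) by (simp add: norm_power powr_def ln_realpow exp_of_nat_mult[symmetric])
  moreover have "\<theta> powr (2 / 3) < 1"
    using theta_bounds by (simp add: powr_def mult_less_0_iff)
  ultimately show "summable (\<lambda>i. norm (of_real (\<theta> ^ i) :: complex) powr (2 / 3))"
    by (simp add: summable_geometric)
  fix \<phi> assume \<phi>: "\<phi> \<in> hol_space R"
  show "transfer_op F G R u t \<phi> \<in> hol_space R" by (rule transfer_op_in_hol_space[OF t \<phi>])
  show "(\<lambda>n. hol_norm R (\<lambda>z. transfer_op F G R u t \<phi> z - partial_sum u t \<phi> n z)) \<longlonglongrightarrow> 0"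
  proof (rule tendsto_sandwich[OF _ _ tendsto_const])
    have "(\<lambda>n. exp (norm u * B) * hol_norm R \<phi> * (\<theta> ^ n / (1 - \<theta>))) \<longlonglongrightarrow> exp (norm u * B) * hol_norm R \<phi> * (0 / (1 - \<theta>))"
      using theta_bounds by (intro tendsto_intros LIMSEQ_realpow_zero) auto
    then show "(\<lambda>n. exp (norm u * B) * hol_norm R \<phi> * (\<theta> ^ n / (1 - \<theta>))) \<longlonglongrightarrow> 0"
      by simp
    show "\<forall>\<^sub>F n in sequentially. hol_norm R (\<lambda>z. transfer_op F G R u t \<phi> z - partial_sum u t \<phi> n z)
        \<le> exp (norm u * B) * hol_norm R \<phi> * (\<theta> ^ n / (1 - \<theta>))"
      by (intro always_eventually allI hol_norm_le[OF R] transfer_op_partial_sum[OF t \<phi> B(2)])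
    have "(\<lambda>z. transfer_op F G R u t \<phi> z - partial_sum u t \<phi> n z) \<in> hol_space R" for n
      by (intro func_space_diff[OF func_space_hol_space] func_space_sum[OF func_space_hol_space]
          transfer_op_in_hol_space[OF t \<phi>] mode_in_hol_space)
    then show "\<forall>\<^sub>F n in sequentially. 0 \<le> hol_norm R (\<lambda>z. transfer_op F G R u t \<phi> z - partial_sum u t \<phi> n z)"
      by (intro always_eventually allI hol_norm_nonneg[OF R])
  qed
qed

lemma dyn_det_eq:
  assumes "t \<in> T"
  shows "dyn_det F G R z u t = (\<Sum>n. (- z) ^ n * fredholm_coeff (\<lambda>i. of_real (\<theta> ^ i)) (functional u t) mode n)"
proof -
  interpret approximation "hol_space R" "hol_norm R" "\<lambda>m. {..m} \<times> {..m}" fejer_functional "fejer_mode R" "\<lambda>_. 1" 1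
    by (rule approximation_hol_space) (use \<rho> in simp)
  show ?thesis
    unfolding dyn_det_def by (rule fredholm_det_eq[OF summable_rep_transfer_op[OF assms]])
qed

text \<open>z is a dummy coordinate that puts the functional on the domain of the determinant. In u
  and t the integrand is holomorphic on a fixed segment, and the integral inherits this.\<close>

lemma holomorphic3_on_functional:
  assumes \<phi>: "\<phi> \<in> hol_space R"
  shows "holomorphic3_on (\<lambda>(z, u, t). functional u t i \<phi>) (UNIV \<times> UNIV \<times> T)"
proof -
  define L where "L = mode_line \<rho> i"
  define k where "k = - mode_freq i"
  define h where "h = (\<lambda>u t s. \<phi> (L s) * exp (- u * G (L s)) * fourier_mode k (F t (L s)))"
  have h_cont: "continuous_on A (\<lambda>x. h (a x) (b x) (c x))"
    if "continuous_on A a" "continuous_on A b" "continuous_on A c" "\<And>x. x \<in> A \<Longrightarrow> b x \<in> T" for a b c and A :: "'x::topological_space set"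
    unfolding h_def L_def
    by (intro continuous_on_mult continuous_on_exp continuous_on_minus continuous_on_fourier_mode
        continuous_on_space_line[OF \<phi>] continuous_on_G_line continuous_on_F_line that)
  define J where "J = (\<lambda>p :: complex \<times> complex \<times> complex. integral {0..1} (\<lambda>s. h (fst (snd p)) (snd (snd p)) s))"
  have W: "open (UNIV \<times> UNIV \<times> T :: (complex \<times> complex \<times> complex) set)" by (intro open_Times open_UNIV T)
  have "holomorphic3_on J (UNIV \<times> UNIV \<times> T)"
  proof (rule holomorphic3_onI[OF W])
    have "continuous_on ((UNIV \<times> UNIV \<times> T) \<times> cbox 0 (1::real)) (\<lambda>(p, s). h (fst (snd p)) (snd (snd p)) s)"
      unfolding case_prod_unfold
      by (rule h_cont) (auto intro!: continuous_on_fst continuous_on_snd continuous_on_id)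
    from integral_continuous_on_param[OF this]
    show "continuous_on (UNIV \<times> UNIV \<times> T) J"
      by (simp add: J_def)
    fix z u t :: complex assume p: "(z, u, t) \<in> UNIV \<times> UNIV \<times> T"
    show "(\<lambda>x. J (x, u, t)) field_differentiable at z"
      by (simp add: J_def)
    have "(\<lambda>x. integral {0..1} (\<lambda>s. (\<lambda>(x, s). h x t s) (x, s))) holomorphic_on UNIV"
    proof (rule holomorphic_on_integral_param)
      show "continuous_on (UNIV \<times> {0..1}) (\<lambda>(x, s). h x t s)"
        unfolding case_prod_unfold
        by (rule h_cont) (use p in \<open>auto intro!: continuous_on_fst continuous_on_snd continuous_on_id continuous_on_const\<close>)
      show "(\<lambda>x. (\<lambda>(x, s). h x t s) (x, s)) holomorphic_on UNIV" for s
        by (simp add: h_def) (intro holomorphic_intros)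
    qed auto
    then show "(\<lambda>x. J (z, x, t)) field_differentiable at u"
      by (intro holomorphic_on_imp_differentiable_at[of _ UNIV]) (auto simp: J_def)
    have "(\<lambda>x. integral {0..1} (\<lambda>s. (\<lambda>(x, s). h u x s) (x, s))) holomorphic_on T"
    proof (rule holomorphic_on_integral_param[OF T])
      show "continuous_on (T \<times> {0..1}) (\<lambda>(x, s). h u x s)"
        unfolding case_prod_unfold
        by (rule h_cont) (auto intro!: continuous_on_fst continuous_on_snd continuous_on_id continuous_on_const)
      have "(\<lambda>x. F x (L s)) holomorphic_on T" for s
        using holomorphic2_on_imp_holomorphic_on(1)[OF F_holo, of "L s"] mode_line_annulus by (simp add: L_def)
      then show "(\<lambda>x. (\<lambda>(x, s). h u x s) (x, s)) holomorphic_on T" for s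
        by (simp add: h_def) (intro holomorphic_intros)
    qed
    then show "(\<lambda>x. J (z, u, x)) field_differentiable at t"
      using T(1) p by (intro holomorphic_on_imp_differentiable_at[of _ T]) (auto simp: J_def)
  qed
  from holomorphic3_mult[OF W holomorphic3_const this]
  have "holomorphic3_on (\<lambda>p. of_real (exp (2 * pi * of_int \<bar>mode_freq i\<bar> * R) / \<theta> ^ i) * J p) (UNIV \<times> UNIV \<times> T)" .
  then show ?thesis
    by (simp only: functional_def J_def h_def L_def k_def case_prod_unfold)
qed

lemma holomorphic3_on_dyn_det:
  "holomorphic3_on (\<lambda>(z, u, t). dyn_det F G R z u t) (UNIV \<times> UNIV \<times> T)"
proof -
  \<comment> \<open>The functionals are bounded by exp(|u| B) and the Fredholm series asks for
    bounded z; an exhaustion by balls provides both bounds, which are already uniform in t.\<close>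
  define W where "W = (\<lambda>k::nat. ball (0::complex) (real k) \<times> ball (0::complex) (real k) \<times> T)"
  obtain B where B: "0 \<le> B" "\<And>i s. s \<in> {0..1} \<Longrightarrow> norm (G (mode_line \<rho> i s)) \<le> B"
    using G_bounded_on_lines by blast
  have R: "0 < R" using \<rho> by simp
  \<comment> \<open>The Fredholm series is set up for \<open>lam\<close> of the form
    \<open>(q\<^sup>2) ^ i\<close>.\<close>
  define q where "q = sqrt \<theta>"
  have q: "0 < q" "q < 1" "q\<^sup>2 = \<theta>" using theta_bounds by (auto simp: q_def)
  have "holomorphic3_on (\<lambda>(z, u, t). dyn_det F G R z u t) (W k)" for k
  proof -
    have oW: "open (W k)" unfolding W_def by (intro open_Times open_ball T)
    have sub: "W k \<subseteq> UNIV \<times> UNIV \<times> T" by (auto simp: W_def)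
    define l where "l = (\<lambda>p :: complex \<times> complex \<times> complex. functional (fst (snd p)) (snd (snd p)))"
    define \<zeta> where "\<zeta> = (\<lambda>p::complex \<times> complex \<times> complex. - fst p)"
    have "holomorphic3_on (\<lambda>p. \<Sum>n. \<zeta> p ^ n * fredholm_coeff (\<lambda>i. of_real ((q\<^sup>2) ^ i)) (l p) mode n) (W k)"
    proof (rule holomorphic3_on_fredholm_series[OF oW q(1,2)])
      show "holomorphic3_on (\<lambda>p. l p i (mode j)) (W k)" for i j
        using holomorphic3_on_functional[OF mode_in_hol_space] sub
        by (auto simp: holomorphic3_on_def l_def case_prod_unfold)
      show "norm (l p i (mode j)) \<le> exp (real k * B) * 1" if p: "p \<in> W k" for i j p
      proof -
        have "norm (l p i (mode j)) \<le> exp (norm (fst (snd p)) * B) * hol_norm R (mode j)"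
          unfolding l_def by (rule norm_functional_le[OF _ mode_in_hol_space B(2)]) (use p in \<open>auto simp: W_def\<close>)
        also have "\<dots> \<le> exp (real k * B) * 1"
        proof (rule mult_mono)
          have "norm (fst (snd p)) * B \<le> real k * B"
            using p B(1) by (intro mult_right_mono) (auto simp: W_def)
          then show "exp (norm (fst (snd p)) * B) \<le> exp (real k * B)" by simp
          show "hol_norm R (mode j) \<le> 1" by (rule hol_norm_le[OF R norm_mode_le])
          show "0 \<le> hol_norm R (mode j)" by (rule hol_norm_nonneg[OF R mode_in_hol_space])
        qed simp
        finally show ?thesis .
      qed
      have "(\<zeta> has_derivative (\<lambda>(x, y, w). (- 1) * x + 0 * y + 0 * w)) (at p)" for p
        unfolding \<zeta>_def case_prod_unfold
        by (rule has_derivative_eq_rhs[OF has_derivative_minus[OF has_derivative_fst[OF has_derivative_ident]]]) auto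
      then show "holomorphic3_on \<zeta> (W k)"
        unfolding holomorphic3_on_def
        by (intro ballI exI[where x = 0, THEN exI[where x = 0], THEN exI[where x = "- 1"]])
      show "norm (\<zeta> p) \<le> real k" if "p \<in> W k" for p
        using that by (auto simp: \<zeta>_def W_def)
    qed
    moreover have "(\<Sum>n. \<zeta> p ^ n * fredholm_coeff (\<lambda>i. of_real ((q\<^sup>2) ^ i)) (l p) mode n)
      = (\<lambda>(z, u, t). dyn_det F G R z u t) p" if "p \<in> W k" for p
    proof -
      have t: "snd (snd p) \<in> T" using that by (auto simp: W_def)
      show ?thesis
        unfolding case_prod_unfold dyn_det_eq[OF t] q(3) \<zeta>_def l_def ..
    qed
    ultimately show ?thesis by (rule holomorphic3_on_transform[OF oW])
  qed
  then have "holomorphic3_on (\<lambda>(z, u, t). dyn_det F G R z u t) (\<Union>k\<in>UNIV. W k)"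
    by (intro holomorphic3_on_UN)
  moreover have "(\<Union>k\<in>UNIV. W k) = UNIV \<times> UNIV \<times> T"
  proof (intro equalityI subsetI)
    fix p :: "complex \<times> complex \<times> complex" assume p: "p \<in> UNIV \<times> UNIV \<times> T"
    obtain k :: nat where "max (norm (fst p)) (norm (fst (snd p))) < real k"
      using reals_Archimedean2 by blast
    then have "p \<in> W k" using p by (auto simp: W_def)
    then show "p \<in> (\<Union>k\<in>UNIV. W k)" by blast
  qed (auto simp: W_def)
  ultimately show ?thesis by simp
qed

end

section \<open>Expanding maps of the circle\<close>

text \<open>Cauchy's inequalities bound the n-th Taylor term by M q^n with q = |w - c| / s, and q <=
  1/2 makes the tail from n = 2 at most 2 M q^2. The bound is given on the open disc, which fits
  into the half-open box defining M in the theorem; continuity carries it to the circle.\<close>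

lemma taylor_remainder_le:
  fixes c :: complex
  assumes s: "0 < s" and cont: "continuous_on (cball c s) f" and hol: "f holomorphic_on ball c s"
    and M: "\<And>w. w \<in> ball c s \<Longrightarrow> norm (f w) \<le> M" and w: "norm (w - c) \<le> s / 2"
  shows "norm (f w - f c - deriv f c * (w - c)) \<le> 2 * M * (norm (w - c) / s)\<^sup>2"
proof -
  define q where "q = norm (w - c) / s"
  have q: "0 \<le> q" "q \<le> 1 / 2" using s w by (auto simp: q_def field_simps)
  have "norm (f c) \<le> M" using s by (intro M) simp
  then have M0: "0 \<le> M" using norm_ge_zero order_trans by blast
  have Mc: "norm (f x) \<le> M" if "x \<in> cball c s" for x
    by (rule continuous_on_closure_norm_le[of "ball c s" f M x]) (use cont M that s in auto)
  have "w \<in> ball c s" using w s by (simp add: dist_norm norm_minus_commute)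
  then have sums: "(\<lambda>n. (deriv ^^ n) f c / fact n * (w - c) ^ n) sums f w"
    by (rule holomorphic_power_series[OF hol])
  have le: "norm ((deriv ^^ n) f c / fact n * (w - c) ^ n) \<le> M * q ^ n" for n
  proof -
    have "norm ((deriv ^^ n) f c) \<le> fact n * M / s ^ n"
      by (rule Cauchy_inequality[OF hol cont s]) (use Mc in \<open>auto simp: dist_norm\<close>)
    then have "norm ((deriv ^^ n) f c) / fact n \<le> fact n * M / s ^ n / fact n"
      by (rule divide_right_mono) simp
    then have "norm ((deriv ^^ n) f c) / fact n * norm (w - c) ^ n \<le> M / s ^ n * norm (w - c) ^ n"
      by (intro mult_right_mono) simp_all
    then show ?thesis
      by (simp add: q_def norm_mult norm_divide norm_power power_divide)
  qed
  have "norm (f w - (\<Sum>n<2. (deriv ^^ n) f c / fact n * (w - c) ^ n)) \<le> M * (q\<^sup>2 / (1 - q))"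
    by (rule norm_sums_minus_partial_le[OF sums le]) (use q in auto)
  moreover have "(\<Sum>n<2. (deriv ^^ n) f c / fact n * (w - c) ^ n) = f c + deriv f c * (w - c)"
    by (simp add: numeral_2_eq_2)
  ultimately have "norm (f w - f c - deriv f c * (w - c)) \<le> M * (q\<^sup>2 / (1 - q))"
    by (simp only: diff_diff_eq)
  moreover have "q\<^sup>2 / (1 - q) \<le> q\<^sup>2 / (1 / 2)"
    using q by (intro divide_left_mono) auto
  then have "M * (q\<^sup>2 / (1 - q)) \<le> M * (q\<^sup>2 / (1 / 2))"
    using M0 by (rule mult_left_mono)
  ultimately have "norm (f w - f c - deriv f c * (w - c)) \<le> M * (q\<^sup>2 / (1 / 2))"
    by (rule order_trans)
  then show ?thesis by (simp add: q_def mult_ac)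
qed

lemma deriv_of_real_extension:
  fixes F :: "complex \<Rightarrow> complex" and f :: "real \<Rightarrow> real"
  assumes F: "(F has_field_derivative d) (at (of_real x))" and ext: "\<And>s. F (of_real s) = of_real (f s)"
  shows "d = of_real (deriv f x)"
proof -
  have "((\<lambda>s. F (of_real s)) has_vector_derivative d) (at x)"
    using F by (rule has_vector_derivative_real_field)
  then have v: "((\<lambda>s. complex_of_real (f s)) has_vector_derivative d) (at x)"
    by (simp add: ext)
  have "((\<lambda>s. Im (complex_of_real (f s))) has_vector_derivative Im d) (at x)"
    by (rule bounded_linear.has_vector_derivative[OF bounded_linear_Im v])
  moreover have "((\<lambda>s. Im (complex_of_real (f s))) has_vector_derivative 0) (at x)"
    by simp
  ultimately have "Im d = 0" by (rule vector_derivative_unique_at)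
  moreover have "((\<lambda>s. Re (complex_of_real (f s))) has_vector_derivative Re d) (at x)"
    by (rule bounded_linear.has_vector_derivative[OF bounded_linear_Re v])
  then have "(f has_field_derivative Re d) (at x)"
    by (simp add: has_real_derivative_iff_has_vector_derivative)
  then have "deriv f x = Re d" by (rule DERIV_imp_deriv)
  ultimately show ?thesis by (simp add: complex_eq_iff)
qed

text \<open>At t = 0 the strict inequality has a positive gap on the compact \<open>K\<close>, and
  uniform continuity on a smaller closed disc times \<open>K\<close> keeps the change below this
  gap. All shrinking of the range of t goes through this lemma.\<close>

lemma compact_perturbation_gt:
  fixes h :: "complex \<Rightarrow> complex \<Rightarrow> real"
  assumes \<epsilon>: "0 < \<epsilon>" and K: "compact K"
    and cont: "continuous_on (ball 0 \<epsilon> \<times> K) (\<lambda>(t, w). h t w)" and gt: "\<And>w. w \<in> K \<Longrightarrow> c < h 0 w"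
  shows "\<exists>\<delta>>0. \<delta> \<le> \<epsilon> \<and> (\<forall>t\<in>ball 0 \<delta>. \<forall>w\<in>K. c < h t w)"
proof (cases "K = {}")
  case True
  then show ?thesis using \<epsilon> by auto
next
  case False
  have c0: "continuous_on K (h 0)"
  proof -
    have "continuous_on K (\<lambda>w. (\<lambda>(t, w). h t w) (0, w))"
      by (rule continuous_on_compose2[OF cont]) (use \<epsilon> in \<open>auto intro!: continuous_intros\<close>)
    then show ?thesis by simp
  qed
  obtain w0 where w0: "w0 \<in> K" "\<And>w. w \<in> K \<Longrightarrow> h 0 w0 \<le> h 0 w"
    using continuous_attains_inf[OF K False c0] by blast
  have "uniformly_continuous_on (cball 0 (\<epsilon> / 2) \<times> K) (\<lambda>(t, w). h t w)"
    using \<epsilon> by (intro compact_uniformly_continuous continuous_on_subset[OF cont] compact_Times K) auto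
  moreover have "0 < h 0 w0 - c" using gt[OF w0(1)] by simp
  ultimately obtain \<delta> where \<delta>: "0 < \<delta>"
    "\<And>p p'. p \<in> cball 0 (\<epsilon> / 2) \<times> K \<Longrightarrow> p' \<in> cball 0 (\<epsilon> / 2) \<times> K \<Longrightarrow> dist p' p < \<delta> \<Longrightarrow>
      dist ((\<lambda>(t, w). h t w) p') ((\<lambda>(t, w). h t w) p) < h 0 w0 - c"
    unfolding uniformly_continuous_on_def by meson
  show ?thesis
  proof (intro exI conjI ballI)
    show "0 < min \<delta> (\<epsilon> / 2)" "min \<delta> (\<epsilon> / 2) \<le> \<epsilon>" using \<delta>(1) \<epsilon> by auto
    fix t w :: complex assume t: "t \<in> ball 0 (min \<delta> (\<epsilon> / 2))" and w: "w \<in> K"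
    have "dist ((\<lambda>(t, w). h t w) (t, w)) ((\<lambda>(t, w). h t w) (0, w)) < h 0 w0 - c"
      by (rule \<delta>(2)) (use t w \<epsilon> in \<open>auto simp: dist_Pair_Pair\<close>)
    then have "\<bar>h t w - h 0 w\<bar> < h 0 w0 - c" by (simp add: dist_real_def)
    then show "c < h t w" using w0(2)[OF w] by linarith
  qed
qed

text \<open>Distinct integers have distance at least 1. Applied to F_t(z + 1) - F_t(z), it gives all
  lifts, for complex t too, the same degree.\<close>

lemma continuous_on_Ints_constant:
  fixes h :: "'a::topological_space \<Rightarrow> complex"
  assumes "connected S" "continuous_on S h" and Z: "\<And>x. x \<in> S \<Longrightarrow> h x \<in> \<int>"
    and "x \<in> S" "y \<in> S"
  shows "h x = h y"
proof -
  have "h constant_on S"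
  proof (rule continuous_discrete_range_constant[OF assms(1,2)])
    fix x assume x: "x \<in> S"
    show "\<exists>e>0. \<forall>y. y \<in> S \<and> h y \<noteq> h x \<longrightarrow> e \<le> norm (h y - h x)"
    proof (intro exI[of _ 1] conjI allI impI)
      fix y assume y: "y \<in> S \<and> h y \<noteq> h x"
      obtain m n where mn: "h x = of_int m" "h y = of_int n"
        using Z[OF x] Z[of y] y by (auto elim!: Ints_cases)
      then have "m \<noteq> n" using y by auto
      then have "1 \<le> \<bar>n - m\<bar>" by simp
      then have "(1 :: real) \<le> of_int \<bar>n - m\<bar>" by linarith
      then show "1 \<le> norm (h y - h x)"
        unfolding mn of_int_diff[symmetric] norm_of_int by simp
    qed simp
  qed
  then show ?thesis using assms(4,5) unfolding constant_on_def by auto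
qed

lemma holomorphic2_on_subset: "holomorphic2_on h W \<Longrightarrow> W' \<subseteq> W \<Longrightarrow> holomorphic2_on h W'"
  unfolding holomorphic2_on_def by (meson subsetD)

text \<open>On the real axis F is real with derivative at least \<open>lambda\<close>, so the
  imaginary part starts like \<open>deriv f s * y\<close>; the Taylor error on the disc of radius r
  / 2 is 2 M (2 |y| / r)^2 = 8 M y^2 / r^2. The factor \<sigma>, the sign of \<open>y\<close>,
  treats both half planes at once.\<close>

lemma expanding_Im_estimate:
  fixes F :: "complex \<Rightarrow> complex" and f :: "real \<Rightarrow> real"
  assumes r: "0 < r" and holo: "F holomorphic_on annulus r"
    and ext: "\<And>x. F (of_real x) = of_real (f x)" and lam: "\<And>x. lambda \<le> deriv f x"
    and M: "\<And>x. Re x \<in> {- r/2..1 + r/2} \<Longrightarrow> Im x \<in> {- r/2..<r/2} \<Longrightarrow> norm (F x) \<le> M"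
    and s: "s \<in> {0..1}" and y: "\<bar>y\<bar> \<le> r\<^sub>0" and r0: "r\<^sub>0 \<le> r / 4" "0 \<le> \<sigma> * y"  "\<bar>\<sigma>\<bar> = 1"
  shows "(lambda - 8 * M * r\<^sub>0 / r\<^sup>2) * \<bar>y\<bar> \<le> \<sigma> * Im (F (Complex s y))"
proof -
  have sr: "of_real s \<in> annulus r" using r by (simp add: annulus_def)
  have cb: "cball (complex_of_real s) (r / 2) \<subseteq> annulus r"
  proof
    fix x assume "x \<in> cball (complex_of_real s) (r / 2)"
    then have "\<bar>Im (of_real s - x)\<bar> \<le> r / 2" unfolding mem_cball dist_norm by (rule order_trans[OF abs_Im_le_cmod])
    then show "x \<in> annulus r" using r by (simp add: annulus_def)
  qed
  have "norm (F (Complex s y) - F (of_real s) - deriv F (of_real s) * (Complex s y - of_real s))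
      \<le> 2 * M * (norm (Complex s y - of_real s) / (r / 2))\<^sup>2"
  proof (rule taylor_remainder_le)
    show "continuous_on (cball (complex_of_real s) (r / 2)) F"
      by (rule continuous_on_subset[OF holomorphic_on_imp_continuous_on[OF holo] cb])
    show "F holomorphic_on ball (complex_of_real s) (r / 2)"
      by (rule holomorphic_on_subset[OF holo]) (use cb ball_subset_cball in blast)
    show "norm (F w) \<le> M" if "w \<in> ball (complex_of_real s) (r / 2)" for w
    proof -
      have n: "norm (of_real s - w) < r / 2" using that by (simp add: dist_norm)
      have "\<bar>Re (of_real s - w)\<bar> < r / 2" "\<bar>Im (of_real s - w)\<bar> < r / 2"
        by (rule le_less_trans[OF abs_Re_le_cmod n], rule le_less_trans[OF abs_Im_le_cmod n])
      then have "\<bar>s - Re w\<bar> < r / 2" "\<bar>Im w\<bar> < r / 2" by simp_all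
      moreover have "0 \<le> s" "s \<le> 1" using s by auto
      ultimately have "- r / 2 \<le> Re w" "Re w \<le> 1 + r / 2" "- r / 2 \<le> Im w" "Im w < r / 2"
        by linarith+
      then show ?thesis by (intro M) simp_all
    qed
    have "Complex s y - of_real s = \<i> * of_real y" by (simp add: complex_eq_iff)
    then show "norm (Complex s y - of_real s) \<le> r / 2 / 2"
      using y r0 by (simp add: norm_mult)
  qed (use r in simp)
  also have "Complex s y - of_real s = \<i> * of_real y" by (simp add: complex_eq_iff)
  finally have est: "norm (F (Complex s y) - F (of_real s) - deriv F (of_real s) * (\<i> * of_real y)) \<le> 8 * M * y\<^sup>2 / r\<^sup>2"
    by (simp add: norm_mult power_divide power2_eq_square)
  have "deriv F (of_real s) = of_real (deriv f s)"
    by (rule deriv_of_real_extension[OF holomorphic_derivI[OF holo open_annulus sr] ext])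
  then have "Im (F (Complex s y) - F (of_real s) - deriv F (of_real s) * (\<i> * of_real y)) = Im (F (Complex s y)) - deriv f s * y"
    by (simp add: ext)
  then have I: "\<bar>Im (F (Complex s y)) - deriv f s * y\<bar> \<le> 8 * M * y\<^sup>2 / r\<^sup>2"
    using order_trans[OF abs_Im_le_cmod est] by simp
  have "norm (F (of_real s)) \<le> M" using s r by (intro M) auto
  then have M0: "0 \<le> M" using norm_ge_zero order_trans by blast
  have \<sigma>y: "\<sigma> * y = \<bar>y\<bar>" using r0(2,3) by (metis abs_mult abs_of_nonneg mult_1)
  have "lambda * \<bar>y\<bar> \<le> deriv f s * \<bar>y\<bar>" by (rule mult_right_mono[OF lam]) simp
  \<comment> \<open>One factor |y| is bounded by \<open>r\<^sub>0\<close>, which makes the error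
    linear in |y|.\<close>
  moreover have "8 * M * y\<^sup>2 / r\<^sup>2 \<le> 8 * M * r\<^sub>0 / r\<^sup>2 * \<bar>y\<bar>"
  proof -
    have "\<bar>y\<bar> * \<bar>y\<bar> \<le> r\<^sub>0 * \<bar>y\<bar>" by (rule mult_right_mono[OF y]) simp
    then have "8 * M / r\<^sup>2 * (\<bar>y\<bar> * \<bar>y\<bar>) \<le> 8 * M / r\<^sup>2 * (r\<^sub>0 * \<bar>y\<bar>)"
      by (rule mult_left_mono) (use M0 in simp)
    then show ?thesis by (simp add: power2_eq_square)
  qed
  moreover have "\<sigma> * Im (F (Complex s y)) \<ge> deriv f s * \<bar>y\<bar> - 8 * M * y\<^sup>2 / r\<^sup>2"
  proof -
    have "\<bar>\<sigma> * Im (F (Complex s y)) - deriv f s * \<bar>y\<bar>\<bar> = \<bar>\<sigma>\<bar> * \<bar>Im (F (Complex s y)) - deriv f s * y\<bar>"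
      unfolding abs_mult[symmetric] \<sigma>y[symmetric] by (simp add: algebra_simps)
    then have "\<bar>\<sigma> * Im (F (Complex s y)) - deriv f s * \<bar>y\<bar>\<bar> \<le> 8 * M * y\<^sup>2 / r\<^sup>2"
      using I by (simp only: r0(3) mult_1_left)
    then show ?thesis by linarith
  qed
  ultimately show ?thesis by (simp add: left_diff_distrib)
qed

text \<open>Counting the preimages and confining them to a smaller annulus belong to what decreasing
  \<epsilon> achieves in the setting, so one \<epsilon>' has to serve them and the determinant
  together. The extension \<open>H\<close> is the determinant itself at complex u and t.\<close>

theorem proposition1p2p11:
  fixes f :: "real \<Rightarrow> real \<Rightarrow> real" and g :: "real \<Rightarrow> real"
    and F :: "complex \<Rightarrow> complex \<Rightarrow> complex" and G :: "complex \<Rightarrow> complex"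
    and U V :: "complex set" and D :: nat
    and \<epsilon>\<^sub>0 \<epsilon> lambda r M r\<^sub>0 R :: real
  assumes "0 < \<epsilon>\<^sub>0"
    and f_analytic: "real_analytic2_on (\<lambda>(t, x). f t x) ({-\<epsilon>\<^sub>0<..<\<epsilon>\<^sub>0} \<times> UNIV)"
    and f_degree: "\<And>t x. t \<in> {-\<epsilon>\<^sub>0<..<\<epsilon>\<^sub>0} \<Longrightarrow> f t (x + 1) = f t x + real D"
    and "1 < lambda"
    and f_expanding: "\<And>t x. t \<in> {-\<epsilon>\<^sub>0<..<\<epsilon>\<^sub>0} \<Longrightarrow> lambda \<le> deriv (f t) x"
    and g_analytic: "real_analytic_on g UNIV"
    and g_periodic: "\<And>x. g (x + 1) = g x"
    and "0 < \<epsilon>" "\<epsilon> \<le> \<epsilon>\<^sub>0"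
    and U: "open U" "periodic_set U" "\<real> \<subseteq> U"
    and F_holo: "holomorphic2_on (\<lambda>(t, z). F t z) (ball 0 \<epsilon> \<times> U)"
    and F_lift: "\<And>t z. t \<in> ball 0 \<epsilon> \<Longrightarrow> z \<in> U \<Longrightarrow> F t (z + 1) - F t z \<in> \<int>"
    and F_extends: "\<And>t x. t \<in> {-\<epsilon><..<\<epsilon>} \<Longrightarrow>
                      F (complex_of_real t) (complex_of_real x) = complex_of_real (f t x)"
    and F_deriv: "\<And>t z. t \<in> ball 0 \<epsilon> \<Longrightarrow> z \<in> U \<Longrightarrow> deriv (F t) z \<noteq> 0"
    and V: "open V" "periodic_set V" "\<real> \<subseteq> V"
    and G_holo: "G holomorphic_on V"
    and G_periodic: "\<And>z. z \<in> V \<Longrightarrow> G (z + 1) = G z"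
    and G_extends: "\<And>x. G (complex_of_real x) = complex_of_real (g x)"
    and "0 < r" "annulus r \<subseteq> U"
    and M_finite: "bdd_above {norm (F t x) | t x. t \<in> ball 0 \<epsilon> \<and>
                     Re x \<in> {- r/2..1 + r/2} \<and> Im x \<in> {- r/2..<r/2}}"
    and M: "M = Sup {norm (F t x) | t x. t \<in> ball 0 \<epsilon> \<and>
                     Re x \<in> {- r/2..1 + r/2} \<and> Im x \<in> {- r/2..<r/2}}"
    and "0 < r\<^sub>0" "r\<^sub>0 < min (r / 4) (r\<^sup>2 * (lambda - 1) / (8 * M))"
    and "0 < R" "R < r\<^sub>0" "closed_annulus R \<subseteq> V"
  shows "\<exists>\<epsilon>'. 0 < \<epsilon>' \<and> \<epsilon>' \<le> \<epsilon> \<and>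
     (\<forall>t\<in>ball 0 \<epsilon>'. \<forall>z\<in>annulus r\<^sub>0. card (preimages (F t) r\<^sub>0 z) = D) \<and>
     (\<exists>R'<R. \<forall>t\<in>ball 0 \<epsilon>'. \<forall>z\<in>closed_annulus R. preimages (F t) r\<^sub>0 z \<subseteq> annulus R') \<and>
     (\<exists>W H. open W \<and> holomorphic3_on H W \<and>
        (\<forall>z u t. t \<in> {-\<epsilon>'<..<\<epsilon>'} \<longrightarrow>
           (z, complex_of_real u, complex_of_real t) \<in> W \<and>
           H (z, complex_of_real u, complex_of_real t) =
             dyn_det F G R z (complex_of_real u) (complex_of_real t)))"
proof -

  \<comment> \<open>Constants derived from the rate of expansion\<close>
  have M_le: "norm (F t x) \<le> M" if "t \<in> ball 0 \<epsilon>" "Re x \<in> {- r/2..1 + r/2}" "Im x \<in> {- r/2..<r/2}" for t x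
    unfolding M by (rule cSup_upper[OF _ M_finite]) (use that in blast)
  have r0r: "r\<^sub>0 < r / 4" and r0M: "r\<^sub>0 < r\<^sup>2 * (lambda - 1) / (8 * M)"
    using \<open>r\<^sub>0 < min (r / 4) (r\<^sup>2 * (lambda - 1) / (8 * M))\<close> by auto
  \<comment> \<open>For M <= 0 the upper bound on \<open>r\<^sub>0\<close> would be nonpositive; at
    M = 0 because division by zero yields 0.\<close>
  have M_pos: "0 < M"
  proof (rule ccontr)
    assume "\<not> 0 < M"
    then have "r\<^sup>2 * (lambda - 1) / (8 * M) \<le> 0"
      using \<open>1 < lambda\<close> by (intro divide_nonneg_nonpos) auto
    then show False using r0M \<open>0 < r\<^sub>0\<close> by linarith
  qed
  \<comment> \<open>The expansion factor of |Im| up to height \<open>r\<^sub>0\<close>; that it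
    exceeds 1 is what the bound on \<open>r\<^sub>0\<close> expresses.\<close>
  define \<kappa> where "\<kappa> = lambda - 8 * M * r\<^sub>0 / r\<^sup>2"
  have \<kappa>: "1 < \<kappa>"
  proof -
    have "r\<^sub>0 * (8 * M) < r\<^sup>2 * (lambda - 1)"
      using r0M M_pos by (simp add: pos_less_divide_eq)
    then have "8 * M * r\<^sub>0 / r\<^sup>2 < lambda - 1"
      using \<open>0 < r\<close> by (simp add: pos_divide_less_eq mult_ac)
    then show ?thesis by (simp add: \<kappa>_def)
  qed
  \<comment> \<open>The midpoint of R / \<kappa> and R, so that R' < R < \<kappa> R'.\<close>
  define R' where "R' = (R + R / \<kappa>) / 2"
  have R'\<kappa>: "\<kappa> * R' = (\<kappa> * R + R) / 2" using \<kappa> by (simp add: R'_def field_simps)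
  have "R < \<kappa> * R" using \<kappa> \<open>0 < R\<close> by simp
  moreover have "R / \<kappa> < R" "0 < R / \<kappa>" using \<kappa> \<open>0 < R\<close> by (simp_all add: field_simps)
  ultimately have R': "0 < R'" "R' < R" "R < \<kappa> * R'"
    unfolding R'\<kappa> by (simp_all add: R'_def)
  \<comment> \<open>Q is the midpoint of R and \<kappa> R', and \<open>Q0\<close> that of
    \<open>r\<^sub>0\<close> and \<kappa> \<open>r\<^sub>0\<close>. The lower half of each gap is
    the margin for the Fourier series, the upper half absorbs the perturbation in t.\<close>
  define Q where "Q = (R + \<kappa> * R') / 2"
  have Q: "R < Q" "Q < \<kappa> * R'"
    using R'(3) by (simp_all add: Q_def mult.commute)
  define Q0 where "Q0 = (r\<^sub>0 + \<kappa> * r\<^sub>0) / 2"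
  have "r\<^sub>0 < \<kappa> * r\<^sub>0" using \<kappa> \<open>0 < r\<^sub>0\<close> by simp
  then have Q0: "r\<^sub>0 < Q0" "Q0 < \<kappa> * r\<^sub>0" by (simp_all add: Q0_def)
  have r0r': "r\<^sub>0 < r" using r0r \<open>0 < r\<close> by simp

  \<comment> \<open>Degree and periodicity of the lifts\<close>
  have zero_ball: "0 \<in> ball (0::complex) \<epsilon>" using \<open>0 < \<epsilon>\<close> by simp
  have zero_real: "0 \<in> {-\<epsilon><..<\<epsilon>}" "0 \<in> {-\<epsilon>\<^sub>0<..<\<epsilon>\<^sub>0}" using \<open>0 < \<epsilon>\<close> \<open>0 < \<epsilon>\<^sub>0\<close> by auto
  have F_holo_r: "holomorphic2_on (\<lambda>(t, z). F t z) (ball 0 \<epsilon> \<times> annulus r)"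
    by (rule holomorphic2_on_subset[OF F_holo]) (use \<open>annulus r \<subseteq> U\<close> in auto)
  have F_cont: "continuous_on (ball 0 \<epsilon> \<times> annulus r) (\<lambda>(t, z). F t z)"
    by (rule holomorphic2_on_imp_continuous_on[OF F_holo_r])
  have Ft_holo: "F t holomorphic_on annulus r" if "t \<in> ball 0 \<epsilon>" for t
    using holomorphic2_on_imp_holomorphic_on(2)[OF F_holo_r that] by simp
  have F0_ext: "F 0 (of_real x) = of_real (f 0 x)" for x
    using F_extends[OF zero_real(1), of x] by simp
  have F_shift: "F t (z + 1) = F t z + of_int (int D)" if t: "t \<in> ball 0 \<epsilon>" and z: "z \<in> annulus r" for t z
  proof -
    \<comment> \<open>Continuous with integer values on the connected product of disc and strip,
      hence equal to its value at (0, 0), which is the degree \<open>D\<close>.\<close>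
    have "(\<lambda>(t, z). F t (z + 1) - F t z) (t, z) = (\<lambda>(t, z). F t (z + 1) - F t z) (0, 0)"
    proof (rule continuous_on_Ints_constant[where h = "\<lambda>(t, z). F t (z + 1) - F t z" and S = "ball 0 \<epsilon> \<times> annulus r"])
      show "connected (ball (0::complex) \<epsilon> \<times> annulus r)"
        by (intro connected_Times convex_connected convex_ball convex_annulus)
      have "continuous_on (ball 0 \<epsilon> \<times> annulus r) (\<lambda>p. (\<lambda>(t, z). F t z) (fst p, snd p + 1))"
        by (rule continuous_on_compose2[OF F_cont]) (auto intro!: continuous_intros simp: annulus_def)
      then show "continuous_on (ball 0 \<epsilon> \<times> annulus r) (\<lambda>(t, z). F t (z + 1) - F t z)"
        unfolding case_prod_unfold using F_cont[unfolded case_prod_unfold]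
        by (intro continuous_on_diff) simp_all
      show "(case p of (t, z) \<Rightarrow> F t (z + 1) - F t z) \<in> \<int>" if "p \<in> ball 0 \<epsilon> \<times> annulus r" for p
        using that \<open>annulus r \<subseteq> U\<close> F_lift by (auto simp: subset_iff)
    qed (use t z zero_ball \<open>0 < r\<close> in \<open>auto simp: annulus_def\<close>)
    moreover have "F 0 (0 + 1) - F 0 0 = of_nat D"
      using F0_ext[of 0] F0_ext[of 1] f_degree[OF zero_real(2), of 0] by simp
    ultimately show ?thesis by (simp add: algebra_simps)
  qed
  have map: "annulus_map (F t) (int D) r" if "t \<in> ball 0 \<epsilon>" for t
    using Ft_holo[OF that] F_shift[OF that] F_deriv[OF that] \<open>annulus r \<subseteq> U\<close> by unfold_locales auto
  have F_Im_shift: "Im (F t (Complex s y)) = Im (F t (Complex (s - of_int \<lfloor>s\<rfloor>) y))"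
    if t: "t \<in> ball 0 \<epsilon>" and y: "\<bar>y\<bar> < r" for t s y
  proof -
    \<comment> \<open>Cut off to 0 outside the strip, so that the periodicity demanded by
      \<open>periodic_of_int\<close> holds at every complex number.\<close>
    define h where "h = (\<lambda>x. if x \<in> annulus r then Im (F t x) else 0)"
    have "h (x + 1) = h x" for x
      using F_shift[OF t, of x] by (simp add: h_def annulus_def)
    then have "h (Complex (s - of_int \<lfloor>s\<rfloor>) y + of_int \<lfloor>s\<rfloor>) = h (Complex (s - of_int \<lfloor>s\<rfloor>) y)"
      by (rule periodic_of_int)
    moreover have "Complex (s - of_int \<lfloor>s\<rfloor>) y + of_int \<lfloor>s\<rfloor> = Complex s y" by (simp add: complex_eq_iff)
    ultimately show ?thesis using y by (simp add: h_def annulus_def)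
  qed

  \<comment> \<open>Expansion of imaginary parts, at t = 0 and nearby\<close>
  have estimate: "\<kappa> * \<bar>y\<bar> \<le> \<sigma> * Im (F 0 (Complex s y))"
    if "s \<in> {0..1}" "\<bar>y\<bar> \<le> r\<^sub>0" "0 \<le> \<sigma> * y" "\<bar>\<sigma>\<bar> = 1" for s y \<sigma>
    unfolding \<kappa>_def
  proof (rule expanding_Im_estimate[OF \<open>0 < r\<close> Ft_holo[OF zero_ball] F0_ext f_expanding[OF zero_real(2)]])
    show "norm (F 0 x) \<le> M" if "Re x \<in> {- r/2..1 + r/2}" "Im x \<in> {- r/2..<r/2}" for x
      using M_le[OF zero_ball that] .
  qed (use that r0r in auto)
  have perturb: "\<exists>\<delta>>0. \<delta> \<le> \<epsilon> \<and> (\<forall>t\<in>ball 0 \<delta>. \<forall>s y. a \<le> \<bar>y\<bar> \<longrightarrow> \<bar>y\<bar> \<le> r\<^sub>0 \<longrightarrow> c < sgn y * Im (F t (Complex s y)))"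
    if a: "0 < a" and c: "c < \<kappa> * a" for a c :: real
  proof -
    \<comment> \<open>Compact after reduction to one period; the distance \<open>a\<close> from the
      real axis keeps \<open>sgn (Im w)\<close> continuous.\<close>
    define K where "K = cbox (Complex 0 (- r\<^sub>0)) (Complex 1 r\<^sub>0) \<inter> {w. a \<le> \<bar>Im w\<bar>}"
    have "\<exists>\<delta>>0. \<delta> \<le> \<epsilon> \<and> (\<forall>t\<in>ball 0 \<delta>. \<forall>w\<in>K. c < sgn (Im w) * Im (F t w))"
    proof (rule compact_perturbation_gt[OF \<open>0 < \<epsilon>\<close>])
      show "compact K"
        unfolding K_def by (intro compact_Int_closed compact_cbox closed_Collect_le continuous_intros)
      have "K \<subseteq> annulus r" using r0r' by (auto simp: K_def in_cbox_complex_iff annulus_def)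
      then have "continuous_on (ball 0 \<epsilon> \<times> K) (\<lambda>(t, z). F t z)"
        by (intro continuous_on_subset[OF F_cont]) auto
      then show "continuous_on (ball 0 \<epsilon> \<times> K) (\<lambda>(t, w). sgn (Im w) * Im (F t w))"
        unfolding case_prod_unfold by (intro continuous_intros) (use a in \<open>auto simp: K_def\<close>)
      fix w assume w: "w \<in> K"
      have "\<kappa> * \<bar>Im w\<bar> \<le> sgn (Im w) * Im (F 0 (Complex (Re w) (Im w)))"
        by (rule estimate) (use w a in \<open>auto simp: K_def in_cbox_complex_iff abs_le_iff sgn_if\<close>)
      moreover have "\<kappa> * a \<le> \<kappa> * \<bar>Im w\<bar>" using w \<kappa> by (simp add: K_def)
      ultimately show "c < sgn (Im w) * Im (F 0 w)" using c by simp
    qed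
    then obtain \<delta> where \<delta>: "0 < \<delta>" "\<delta> \<le> \<epsilon>" "\<And>t w. t \<in> ball 0 \<delta> \<Longrightarrow> w \<in> K \<Longrightarrow> c < sgn (Im w) * Im (F t w)"
      by blast
    have "c < sgn y * Im (F t (Complex s y))" if t: "t \<in> ball 0 \<delta>" and y: "a \<le> \<bar>y\<bar>" "\<bar>y\<bar> \<le> r\<^sub>0" for t s y
    proof -
      have "0 \<le> s - of_int \<lfloor>s\<rfloor>" "s - of_int \<lfloor>s\<rfloor> \<le> 1" by linarith+
      then have "Complex (s - of_int \<lfloor>s\<rfloor>) y \<in> K"
        using y by (simp add: K_def in_cbox_complex_iff abs_le_iff)
      from \<delta>(3)[OF t this] have "c < sgn y * Im (F t (Complex (s - of_int \<lfloor>s\<rfloor>) y))" by simp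
      moreover have "t \<in> ball 0 \<epsilon>" "\<bar>y\<bar> < r" using t \<delta>(2) y r0r' by simp_all
      ultimately show ?thesis by (simp only: F_Im_shift[of t y s])
    qed
    then show ?thesis
      by (intro exI[of _ \<delta>] conjI ballI allI impI \<delta>(1,2))
  qed

  \<comment> \<open>The whole range from R' to \<open>r\<^sub>0\<close> is controlled, since
    preimages are to be excluded from it; the integration lines at height R' are a special
    case.\<close>
  obtain \<delta>1 where \<delta>1: "0 < \<delta>1" "\<delta>1 \<le> \<epsilon>"
    "\<And>t s y. t \<in> ball 0 \<delta>1 \<Longrightarrow> R' \<le> \<bar>y\<bar> \<Longrightarrow> \<bar>y\<bar> \<le> r\<^sub>0 \<Longrightarrow> Q < sgn y * Im (F t (Complex s y))"
    using perturb[OF R'(1) Q(2)] by blast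
  \<comment> \<open>Only the boundary lines at height \<open>r\<^sub>0\<close> matter for counting;
    there \<kappa> \<open>r\<^sub>0\<close> leaves room for the larger threshold
    \<open>Q0\<close>.\<close>
  obtain \<delta>2 where \<delta>2: "0 < \<delta>2" "\<delta>2 \<le> \<epsilon>"
    "\<And>t s y. t \<in> ball 0 \<delta>2 \<Longrightarrow> r\<^sub>0 \<le> \<bar>y\<bar> \<Longrightarrow> \<bar>y\<bar> \<le> r\<^sub>0 \<Longrightarrow> Q0 < sgn y * Im (F t (Complex s y))"
    using perturb[OF \<open>0 < r\<^sub>0\<close> Q0(2)] by blast
  define \<epsilon>' where "\<epsilon>' = min \<delta>1 \<delta>2"
  have \<epsilon>': "0 < \<epsilon>'" "\<epsilon>' \<le> \<epsilon>" using \<delta>1 \<delta>2 by (auto simp: \<epsilon>'_def)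
  have balls: "t \<in> ball 0 \<delta>1" "t \<in> ball 0 \<delta>2" "t \<in> ball 0 \<epsilon>" if "t \<in> ball 0 \<epsilon>'" for t :: complex
    using that \<epsilon>' by (auto simp: \<epsilon>'_def)

  \<comment> \<open>Counting and confining the preimages\<close>
  have card: "card (preimages (F t) r\<^sub>0 z) = D" if t: "t \<in> ball 0 \<epsilon>'" and z: "z \<in> annulus r\<^sub>0" for t z
  proof -
    have zI: "\<bar>Im z\<bar> < r\<^sub>0" using z by (simp add: annulus_def)
    have "int (card (preimages (F t) r\<^sub>0 z)) = int D"
    proof (rule annulus_map.card_preimages[OF map[OF balls(3)[OF t]] \<open>0 < r\<^sub>0\<close> r0r'])
      show "0 < Q0 - r\<^sub>0" using Q0 by simp
      show "Im z + (Q0 - r\<^sub>0) \<le> Im (F t (Complex s r\<^sub>0))" for s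
        using \<delta>2(3)[OF balls(2)[OF t], of r\<^sub>0 s] zI \<open>0 < r\<^sub>0\<close> by simp
      show "Im (F t (Complex s (- r\<^sub>0))) \<le> Im z - (Q0 - r\<^sub>0)" for s
        using \<delta>2(3)[OF balls(2)[OF t], of "- r\<^sub>0" s] zI \<open>0 < r\<^sub>0\<close> by simp
    qed
    then show ?thesis by simp
  qed
  have inner: "preimages (F t) r\<^sub>0 z \<subseteq> annulus R'" if t: "t \<in> ball 0 \<epsilon>'" and z: "z \<in> closed_annulus R" for t z
  proof
    fix x assume "x \<in> preimages (F t) r\<^sub>0 z"
    then have x: "\<bar>Im x\<bar> < r\<^sub>0" "F t x - z \<in> \<int>" by (auto simp: preimages_def annulus_def)
    obtain n where n: "F t x - z = of_int n" using x(2) by (rule Ints_cases)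
    \<comment> \<open>F x and z differ by an integer, so they have the same imaginary part.\<close>
    have "Im (F t x - z) = Im (of_int n)" by (simp only: n)
    then have FI: "\<bar>Im (F t x)\<bar> \<le> R" using z by (simp add: closed_annulus_def)
    have "\<not> R' \<le> \<bar>Im x\<bar>"
    proof
      assume "R' \<le> \<bar>Im x\<bar>"
      then have "Q < sgn (Im x) * Im (F t x)"
        using \<delta>1(3)[OF balls(1)[OF t], of "Im x" "Re x"] x(1) by simp
      also have "\<dots> \<le> \<bar>Im (F t x)\<bar>" by (auto simp: sgn_if)
      finally show False using FI Q by linarith
    qed
    then show "x \<in> annulus R'" by (simp add: annulus_def)
  qed

  \<comment> \<open>The determinant over the smaller disc\<close>
  interpret transfer_family F G "ball 0 \<epsilon>'" V "int D" R R' Q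
  proof (rule transfer_family.intro)
    show "open (ball (0::complex) \<epsilon>')" "convex (ball (0::complex) \<epsilon>')" by auto
    have Rr: "annulus R \<subseteq> annulus r" using \<open>R < r\<^sub>0\<close> r0r' by (auto simp: annulus_def)
    show "annulus_map (F t) (int D) R" if "t \<in> ball 0 \<epsilon>'" for t
    proof -
      interpret annulus_map "F t" "int D" r by (rule map[OF balls(3)[OF that]])
      show ?thesis
        by unfold_locales (use Rr shift deriv_nz holomorphic_on_subset[OF holo] in auto)
    qed
    show "holomorphic2_on (\<lambda>(t, z). F t z) (ball 0 \<epsilon>' \<times> annulus R)"
      by (rule holomorphic2_on_subset[OF F_holo_r]) (use Rr balls(3) in auto)
    show "Q \<le> Im (F t (Complex s R'))" if "t \<in> ball 0 \<epsilon>'" for t s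
      using \<delta>1(3)[OF balls(1)[OF that], of R' s] R' \<open>R < r\<^sub>0\<close> by simp
    show "Im (F t (Complex s (- R'))) \<le> - Q" if "t \<in> ball 0 \<epsilon>'" for t s
      using \<delta>1(3)[OF balls(1)[OF that], of "- R'" s] R' \<open>R < r\<^sub>0\<close> by simp
    \<comment> \<open>Preimages in the annulus of R are among those in the annulus of
      \<open>r\<^sub>0\<close>, and these lie below height R'.\<close>
    show "preimages (F t) R z = preimages (F t) R' z" if "t \<in> ball 0 \<epsilon>'" "z \<in> closed_annulus R" for t z
      using inner[OF that] R' \<open>R < r\<^sub>0\<close> by (fastforce simp: preimages_def annulus_def)
    show "annulus R \<subseteq> V"
      using annulus_subset_closed_annulus \<open>closed_annulus R \<subseteq> V\<close> by blast
  qed (use R' Q V G_holo G_periodic in auto)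

  show ?thesis
  proof (rule exI[of _ \<epsilon>'], intro conjI)
    show "\<exists>R'<R. \<forall>t\<in>ball 0 \<epsilon>'. \<forall>z\<in>closed_annulus R. preimages (F t) r\<^sub>0 z \<subseteq> annulus R'"
      using R'(2) inner by blast
    show "\<exists>W H. open W \<and> holomorphic3_on H W \<and>
        (\<forall>z u t. t \<in> {-\<epsilon>'<..<\<epsilon>'} \<longrightarrow>
           (z, complex_of_real u, complex_of_real t) \<in> W \<and>
           H (z, complex_of_real u, complex_of_real t) =
             dyn_det F G R z (complex_of_real u) (complex_of_real t))"
    proof (rule exI[of _ "UNIV \<times> UNIV \<times> ball 0 \<epsilon>'"], rule exI[of _ "\<lambda>(z, u, t). dyn_det F G R z u t"], intro conjI allI impI)
      show "open (UNIV \<times> UNIV \<times> ball (0::complex) \<epsilon>' :: (complex \<times> complex \<times> complex) set)"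
        by (intro open_Times open_UNIV open_ball)
      show "holomorphic3_on (\<lambda>(z, u, t). dyn_det F G R z u t) (UNIV \<times> UNIV \<times> ball 0 \<epsilon>')"
        by (rule holomorphic3_on_dyn_det)
    qed auto
  qed (use \<epsilon>' card in auto)
qed

end
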